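(* Let $\Omega\subseteq\mathbb{R}^N$ be a rectangular domain, $T>0$, $\Omega_T=\Omega\times(0,T)$, let $p_1,\dots,p_N>1$ with $\bar p<N$, let $\alpha_1,\dots,\alpha_N>0$, $\tilde\alpha=\sum_i\alpha_i$, $p^*_\alpha=\bar p^*\tilde\alpha/N$, and let $\sigma\in[1,p^*_\alpha]$. For $\theta\in[0,\bar p/\bar p^*]$ set $q=\theta p^*_\alpha+\sigma(1-\theta)$. Then there exists a constant $C=C(N,{\bf p},\alpha,\theta,\sigma)>0$ such that $$\iint_{\Omega_T}|u|^q\,dx\,dt\le C\,T^{1-\theta\frac{\bar p^*}{\bar p}}\Big(\sup_{t\in[0,T]}\int_\Omega|u|^\sigma(x,t)\,dx\Big)^{1-\theta}\prod_{i=1}^N\Big(\iint_{\Omega_T}\big|D_i|u|^{\alpha_i}\big|^{p_i}\,dx\,dt\Big)^{\frac{\theta\bar p^*}{Np_i}}$$ for every $u\in L^1(0,T;W^{1,1}_0(\Omega))$.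
   Context: $\bar p=\big(\frac1N\sum_{i=1}^N\frac1{p_i}\big)^{-1}$, $\bar p^*=\frac{N\bar p}{N-\bar p}$. A rectangular domain is a product of open intervals. $D_i$ denotes the weak partial derivative in $x_i$; the right-hand side is interpreted as $+\infty$ when some factor is infinite. *)

theory Defs
  imports "HOL-Analysis.Analysis"
begin

definition pbar :: "('n::finite \<Rightarrow> real) \<Rightarrow> real" where
  "pbar p = inverse ((\<Sum>i\<in>UNIV. inverse (p i)) / real CARD('n))"

definition pbar_star :: "('n::finite \<Rightarrow> real) \<Rightarrow> real" where
  "pbar_star p = real CARD('n) * pbar p / (real CARD('n) - pbar p)"

definition p_star_alpha :: "('n::finite \<Rightarrow> real) \<Rightarrow> ('n \<Rightarrow> real) \<Rightarrow> real" where
  "p_star_alpha p \<alpha> = pbar_star p * (\<Sum>i\<in>UNIV. \<alpha> i) / real CARD('n)"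

text \<open>Real power of a nonnegative base with the convention x^0 = 1 (also for x = 0).\<close>
definition pw :: "real \<Rightarrow> real \<Rightarrow> real" where
  "pw x e = (if e = 0 then 1 else x powr e)"

definition rect_domain :: "('n::finite \<Rightarrow> ereal) \<Rightarrow> ('n \<Rightarrow> ereal) \<Rightarrow> (real^'n) set" where
  "rect_domain a b = {x. \<forall>i. a i < ereal (x $ i) \<and> ereal (x $ i) < b i}"

coinductive C_inf :: "('a::euclidean_space \<Rightarrow> real) \<Rightarrow> bool" where
  "(\<forall>x. f differentiable (at x)) \<Longrightarrow>
   (\<forall>v. v \<in> Basis \<longrightarrow> C_inf (\<lambda>x. frechet_derivative f (at x) v)) \<Longrightarrow> C_inf f"

definition test_fun :: "'a::euclidean_space set \<Rightarrow> ('a \<Rightarrow> real) \<Rightarrow> bool" where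
  "test_fun U \<phi> \<longleftrightarrow> C_inf \<phi> \<and> compact (closure {x. \<phi> x \<noteq> 0}) \<and> closure {x. \<phi> x \<noteq> 0} \<subseteq> U"

definition locally_integrable :: "('a::euclidean_space \<Rightarrow> real) \<Rightarrow> 'a set \<Rightarrow> bool" where
  "locally_integrable f U \<longleftrightarrow> (\<forall>K. compact K \<and> K \<subseteq> U \<longrightarrow> set_integrable lebesgue K f)"

definition has_weak_deriv ::
  "('a::euclidean_space \<Rightarrow> real) \<Rightarrow> 'a \<Rightarrow> ('a \<Rightarrow> real) \<Rightarrow> 'a set \<Rightarrow> bool" where
  "has_weak_deriv f v g U \<longleftrightarrow> locally_integrable f U \<and> locally_integrable g U \<and>
     (\<forall>\<phi>. test_fun U \<phi> \<longrightarrow>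
        (LINT x:U|lebesgue. f x * frechet_derivative \<phi> (at x) v) = - (LINT x:U|lebesgue. g x * \<phi> x))"

definition W11_0 :: "'a::euclidean_space set \<Rightarrow> ('a \<Rightarrow> real) \<Rightarrow> bool" where
  "W11_0 U f \<longleftrightarrow> set_integrable lebesgue U f \<and>
     (\<exists>g. (\<forall>v\<in>Basis. has_weak_deriv f v (g v) U \<and> set_integrable lebesgue U (g v)) \<and>
       (\<exists>\<phi>. (\<forall>k. test_fun U (\<phi> k)) \<and>
          ((\<lambda>k. (\<integral>\<^sup>+x\<in>U. ennreal \<bar>\<phi> k x - f x\<bar> \<partial>lebesgue) +
                (\<Sum>v\<in>Basis. \<integral>\<^sup>+x\<in>U. ennreal \<bar>frechet_derivative (\<phi> k) (at x) v - g v x\<bar> \<partial>lebesgue))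
            \<longlonglongrightarrow> 0)))"

definition L1_W11_0 :: "real \<Rightarrow> (real^'n::finite) set \<Rightarrow> ((real^'n) \<times> real \<Rightarrow> real) \<Rightarrow> bool" where
  "L1_W11_0 T \<Omega> u \<longleftrightarrow> u \<in> borel_measurable lebesgue \<and>
     (\<exists>G :: 'n \<Rightarrow> (real^'n) \<times> real \<Rightarrow> real.
        (\<forall>i. G i \<in> borel_measurable lebesgue) \<and>
        (AE t in lborel. t \<in> {0<..<T} \<longrightarrow>
           W11_0 \<Omega> (\<lambda>x. u (x, t)) \<and>
           (\<forall>i. has_weak_deriv (\<lambda>x. u (x, t)) (axis i 1) (\<lambda>x. G i (x, t)) \<Omega>)) \<and>
        set_integrable lebesgue (\<Omega> \<times> {0<..<T}) u \<and>
        (\<forall>i. set_integrable lebesgue (\<Omega> \<times> {0<..<T}) (G i)))"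

end

theory Submission
  imports Defs
begin

text \<open>For almost every \<open>t\<close> the function \<open>w = \<bar>u(\<cdot>, t)\<bar>\<close> satisfies an anisotropic Sobolev inequality
  \<open>\<integral> w\<^sup>r \<le> C \<Prod>\<^sub>i (\<integral> \<bar>D\<^sub>i w powr \<alpha>\<^sub>i\<bar> powr p\<^sub>i) powr (\<tau> / p\<^sub>i)\<close> with \<open>r = p_star_alpha p \<alpha>\<close> and
  \<open>\<tau> = pbar_star p / N\<close>. On almost every line in direction \<open>i\<close> the power \<open>w powr \<alpha>\<^sub>i\<close> is controlled by the
  integral of its weak derivative, and membership of \<open>u(\<cdot>, t)\<close> in \<open>W11_0\<close> makes the essential infimum of
  \<open>w\<close> on the line vanish; hence, with \<open>\<gamma>\<^sub>i = 1 + r (1 - 1 / p\<^sub>i) / \<alpha>\<^sub>i\<close>, the power \<open>w powr (\<alpha>\<^sub>i \<gamma>\<^sub>i)\<close> is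
  bounded by the line integral of \<open>w powr (r (1 - 1 / p\<^sub>i)) \<bar>D\<^sub>i w powr \<alpha>\<^sub>i\<bar>\<close>. Multiplying these bounds,
  the Loomis-Whitney inequality and Hoelder's inequality give the Sobolev inequality after absorbing a
  power of \<open>\<integral> w\<^sup>r\<close> on the left. Interpolating \<open>w\<^sup>q\<close> between \<open>w\<^sup>r\<close> and \<open>w powr \<sigma>\<close> in \<open>x\<close>, and Hoelder's inequality
  in \<open>t\<close>, complete the proof.\<close>

section \<open>Powers of extended nonnegative reals and Hoelder's inequality\<close>

text \<open>The zero boundary condition is known for \<open>u\<close>, the integrable derivatives
  for powers of \<open>\<bar>u\<bar>\<close> whose exponent changes with the direction. The two meet
  on single lines: a vanishing essential infimum passes through the increasing map
  \<open>x powr \<alpha> i\<close>, without any trace or chain rule for the powers. The derivatives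
  live on the space-time cylinder; a line in a spatial direction never leaves its time slice, so the
  line estimate is made on the cylinder and sliced afterwards. Put
  \<open>s = (\<Sum>i. 1 / p i)\<close>. The exponent \<open>r\<close> is forced by two demands:
  Hoelder's inequality with weights \<open>1 - 1 / p i\<close> and \<open>1 / p i\<close> must
  return the integral of \<open>w powr r\<close>, and the product of the \<open>N\<close> line
  bounds, each raised to \<open>1 / (N - 1)\<close>, must be \<open>w powr r\<close>. This gives
  \<open>(\<Sum>i. \<alpha> i) + r * (N - s) = r * (N - 1)\<close>. The condition
  \<open>pbar p < N\<close> says \<open>s > 1\<close>, which leaves the integral on the right with
  an exponent below 1. Absorbing it requires finiteness, which is not known beforehand for
  \<open>w\<close> itself; truncations are therefore estimated, uniformly in the truncation
  level.\<close>

definition epow :: "ennreal \<Rightarrow> real \<Rightarrow> ennreal" where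
  "epow x a = (if a = 0 then 1 else if x = top then top else ennreal (enn2real x powr a))"

lemma epow_0 [simp]: "epow x 0 = 1"
  by (simp add: epow_def)

lemma epow_zero: "a \<noteq> 0 \<Longrightarrow> epow 0 a = 0"
  by (simp add: epow_def)

lemma epow_top: "a \<noteq> 0 \<Longrightarrow> epow top a = top"
  by (simp add: epow_def)

lemma epow_ennreal: "0 \<le> r \<Longrightarrow> a \<noteq> 0 \<Longrightarrow> epow (ennreal r) a = ennreal (r powr a)"
  by (simp add: epow_def)

text \<open>Exponent 0 gives 1 for every base, \<open>0\<close> and \<open>top\<close> included, so
  a Hoelder weight 0 deletes its factor. On finite bases this agrees with \<open>pw\<close>, which
  lets the final estimate be read back in real numbers.\<close>

lemma epow_pw: "x < top \<Longrightarrow> epow x a = ennreal (pw (enn2real x) a)"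
  by (auto simp: epow_def pw_def)

lemma epow_1 [simp]: "epow x 1 = x"
  by (cases x) (auto simp: epow_def)

lemma epow_one [simp]: "epow 1 a = 1"
  by (simp add: epow_def)

lemma epow_mono: "x \<le> y \<Longrightarrow> 0 \<le> a \<Longrightarrow> epow x a \<le> epow y a"
  by (cases x; cases y) (auto simp: epow_def top_unique intro!: ennreal_leI powr_mono2)

lemma epow_eq_0_iff: "epow x a = 0 \<longleftrightarrow> x = 0 \<and> a \<noteq> 0"
  by (cases x) (auto simp: epow_def)

lemma epow_mult: "0 \<le> a \<Longrightarrow> epow (x * y) a = epow x a * epow y a"
proof (cases "a = 0 \<or> x = top \<or> y = top")
  case True
  assume "0 \<le> a"
  with True show ?thesis
    by (cases "a = 0"; cases "x = 0"; cases "y = 0")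
       (auto simp: epow_zero epow_top ennreal_mult_top ennreal_top_mult epow_eq_0_iff)
next
  case False
  then obtain r s where "x = ennreal r" "0 \<le> r" "y = ennreal s" "0 \<le> s"
    by (metis ennreal_cases)
  with False show ?thesis
    by (simp add: epow_ennreal powr_mult flip: ennreal_mult)
qed

lemma epow_epow: "0 \<le> a \<Longrightarrow> 0 \<le> b \<Longrightarrow> epow (epow x a) b = epow x (a * b)"
  by (cases x) (auto simp: epow_def powr_powr)

lemma epow_prod: "0 \<le> a \<Longrightarrow> epow (\<Prod>i\<in>I. f i) a = (\<Prod>i\<in>I. epow (f i) a)"
  by (induction I rule: infinite_finite_induct) (auto simp: epow_mult)

lemma epow_eq_top_iff: "epow x a = top \<longleftrightarrow> x = top \<and> a \<noteq> 0"
  by (cases x) (auto simp: epow_def)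

lemma epow_measurable [measurable (raw)]:
  assumes [measurable]: "f \<in> borel_measurable M"
  shows "(\<lambda>x. epow (f x) a) \<in> borel_measurable M"
  unfolding epow_def by measurable

lemma epow_divide: "0 \<le> a \<Longrightarrow> c \<noteq> 0 \<Longrightarrow> c < top \<Longrightarrow> epow (x / c) a * epow c a = epow x a"
  by (subst epow_mult[symmetric]) (auto simp: ennreal_divide_times ennreal_divide_self less_top)

section \<open>Weighted means and Hoelder's inequality for finitely many factors\<close>

lemma weighted_AM_GM:
  fixes x :: "'a \<Rightarrow> real"
  assumes "finite I" "\<And>i. i \<in> I \<Longrightarrow> 0 < x i" "\<And>i. i \<in> I \<Longrightarrow> 0 \<le> a i" "sum a I = 1"
  shows "(\<Prod>i\<in>I. x i powr a i) \<le> (\<Sum>i\<in>I. a i * x i)"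
proof -
  \<comment> \<open>Jensen's inequality for \<open>exp\<close> at the points
    \<open>ln (x i)\<close>.\<close>
  have "exp (\<Sum>i\<in>I. a i *\<^sub>R ln (x i)) \<le> (\<Sum>i\<in>I. a i * exp (ln (x i)))"
    using assms by (intro convex_on_sum[OF _ _ exp_convex]) auto
  moreover have "exp (\<Sum>i\<in>I. a i *\<^sub>R ln (x i)) = (\<Prod>i\<in>I. x i powr a i)"
    using assms(1,2) by (simp add: exp_sum powr_def less_imp_neq[symmetric] cong: prod.cong)
  ultimately show ?thesis using assms(2) by simp
qed

text \<open>Indices of weight 0 are dropped at the start: \<open>epow top 0 = 1\<close> and
  \<open>0 * top = 0\<close> make them neutral. Among the others a base 0 kills the left side, even
  next to a base \<open>top\<close>; failing that, a base \<open>top\<close> makes the right side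
  infinite.\<close>

lemma weighted_AM_GM_ennreal:
  fixes x :: "'a \<Rightarrow> ennreal"
  assumes "finite I" and a: "\<And>i. i \<in> I \<Longrightarrow> 0 \<le> a i" and "sum a I = 1"
  shows "(\<Prod>i\<in>I. epow (x i) (a i)) \<le> (\<Sum>i\<in>I. ennreal (a i) * x i)"
proof -
  define J where "J = {i \<in> I. a i \<noteq> 0}"
  have "sum a J = sum a I"
    using assms(1) by (intro sum.mono_neutral_left) (auto simp: J_def)
  then have J: "finite J" "\<And>i. i \<in> J \<Longrightarrow> 0 < a i" "sum a J = 1"
    using assms by (auto simp: J_def less_le)
  have IJ_prod: "(\<Prod>i\<in>I. epow (x i) (a i)) = (\<Prod>i\<in>J. epow (x i) (a i))"
    using assms(1) by (intro prod.mono_neutral_right) (auto simp: J_def)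
  have IJ_sum: "(\<Sum>i\<in>I. ennreal (a i) * x i) = (\<Sum>i\<in>J. ennreal (a i) * x i)"
    using assms(1) by (intro sum.mono_neutral_right) (auto simp: J_def)
  note IJ = IJ_prod IJ_sum
  consider "\<exists>i\<in>J. x i = 0" | "\<exists>i\<in>J. x i = top" | "\<forall>i\<in>J. x i \<noteq> 0 \<and> x i \<noteq> top" by blast
  then show ?thesis
  proof cases
    case 1
    then have "(\<Prod>i\<in>J. epow (x i) (a i)) = 0"
      using J by (force simp: epow_eq_0_iff intro!: prod_zero)
    then show ?thesis using IJ(1) by (metis zero_le)
  next
    case 2
    then obtain i where i: "i \<in> J" "x i = top" by blast
    have "top = ennreal (a i) * x i" using J(2)[OF i(1)] i by (simp add: ennreal_mult_top)
    also have "\<dots> \<le> (\<Sum>i\<in>J. ennreal (a i) * x i)"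
      using J i by (intro member_le_sum) auto
    finally show ?thesis using IJ by (simp add: top_unique)
  next
    case 3
    define y where "y i = enn2real (x i)" for i
    have y: "x i = ennreal (y i)" "0 < y i" if "i \<in> J" for i
      using 3 that by (auto simp: y_def enn2real_positive_iff less_top zero_less_iff_neq_zero)
    have "(\<Prod>i\<in>J. epow (x i) (a i)) = (\<Prod>i\<in>J. ennreal (y i powr a i))"
      using J(2) y by (intro prod.cong refl) (metis epow_ennreal less_imp_le less_irrefl)
    also have "\<dots> = ennreal (\<Prod>i\<in>J. y i powr a i)" by (simp add: prod_ennreal)
    also have "\<dots> \<le> ennreal (\<Sum>i\<in>J. a i * y i)"
      using J y by (intro ennreal_leI weighted_AM_GM) (auto simp: less_imp_le)
    also have "\<dots> = (\<Sum>i\<in>J. ennreal (a i * y i))"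
      using J y by (intro sum_ennreal[symmetric]) (auto simp: less_imp_le)
    also have "\<dots> = (\<Sum>i\<in>J. ennreal (a i) * x i)"
      using J y by (intro sum.cong) (auto simp: ennreal_mult less_imp_le)
    finally show ?thesis using IJ by simp
  qed
qed

text \<open>Each factor is divided by its integral, after which the weighted mean inequality
  integrates to the sum of the weights, which is 1. Integrals equal to 0 or \<open>top\<close>
  cannot be divided out and are split off, the value 0 before \<open>top\<close> because
  \<open>0 * top = 0\<close>.\<close>

lemma Holder_nn_integral:
  fixes f :: "'i \<Rightarrow> 'a \<Rightarrow> ennreal"
  assumes I: "finite I" and a: "\<And>i. i \<in> I \<Longrightarrow> 0 \<le> a i" and s: "sum a I = 1"
    and f[measurable]: "\<And>i. i \<in> I \<Longrightarrow> f i \<in> borel_measurable M"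
  shows "(\<integral>\<^sup>+x. (\<Prod>i\<in>I. epow (f i x) (a i)) \<partial>M) \<le> (\<Prod>i\<in>I. epow (\<integral>\<^sup>+x. f i x \<partial>M) (a i))"
proof -
  define c where "c i = (\<integral>\<^sup>+x. f i x \<partial>M)" for i
  consider (z) "\<exists>i\<in>I. a i \<noteq> 0 \<and> c i = 0" | (t) "\<forall>i\<in>I. a i \<noteq> 0 \<longrightarrow> c i \<noteq> 0" "\<exists>i\<in>I. a i \<noteq> 0 \<and> c i = top"
    | (g) "\<forall>i\<in>I. a i \<noteq> 0 \<longrightarrow> c i \<noteq> 0 \<and> c i \<noteq> top" by blast
  then show ?thesis
  proof cases
    case z
    then obtain i where i: "i \<in> I" "a i \<noteq> 0" "c i = 0" by blast
    have "AE x in M. f i x = 0"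
      using i by (auto simp: c_def nn_integral_0_iff_AE)
    then have "AE x in M. (\<Prod>i\<in>I. epow (f i x) (a i)) = 0"
      by (rule eventually_mono) (use i I in \<open>auto intro!: bexI[of _ i] simp: epow_zero\<close>)
    then have "(\<integral>\<^sup>+x. (\<Prod>i\<in>I. epow (f i x) (a i)) \<partial>M) = 0"
      by (subst nn_integral_0_iff_AE) measurable
    then show ?thesis by simp
  next
    case t
    then obtain i where i: "i \<in> I" "a i \<noteq> 0" "c i = top" by blast
    have "(\<Prod>i\<in>I. epow (c i) (a i)) = top"
      using i t I by (subst ennreal_prod_eq_top) (auto simp: epow_eq_0_iff epow_eq_top_iff)
    then show ?thesis by (simp add: c_def)
  next
    case g
    \<comment> \<open>Where the weight is 0 the integral may still be 0 or \<open>top\<close>; the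
      divisor 1 is harmless there, since the factor is 1 anyway.\<close>
    define d where "d i = (if a i = 0 then 1 else c i)" for i
    have d: "d i \<noteq> 0" "d i < top" if "i \<in> I" for i using g that by (auto simp: d_def less_top)
    have "(\<integral>\<^sup>+x. (\<Prod>i\<in>I. epow (f i x) (a i)) \<partial>M)
        = (\<integral>\<^sup>+x. (\<Prod>i\<in>I. epow (f i x / d i) (a i)) * (\<Prod>i\<in>I. epow (d i) (a i)) \<partial>M)"
      using d a by (simp add: prod.distrib[symmetric] epow_divide cong: prod.cong)
    also have "\<dots> = (\<integral>\<^sup>+x. (\<Prod>i\<in>I. epow (f i x / d i) (a i)) \<partial>M) * (\<Prod>i\<in>I. epow (d i) (a i))"
      by (intro nn_integral_multc) measurable
    also have "\<dots> \<le> (\<integral>\<^sup>+x. (\<Sum>i\<in>I. ennreal (a i) * (f i x / d i)) \<partial>M) * (\<Prod>i\<in>I. epow (d i) (a i))"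
      by (intro mult_right_mono nn_integral_mono weighted_AM_GM_ennreal assms) auto
    also have "(\<integral>\<^sup>+x. (\<Sum>i\<in>I. ennreal (a i) * (f i x / d i)) \<partial>M) = (\<Sum>i\<in>I. ennreal (a i) * (c i / d i))"
      by (subst nn_integral_sum) (auto simp: nn_integral_cmult nn_integral_divide c_def)
    also have "\<dots> = (\<Sum>i\<in>I. ennreal (a i))"
      using g by (intro sum.cong) (auto simp: d_def less_top ennreal_divide_self)
    also have "\<dots> = 1" using s a by (subst sum_ennreal) auto
    also have "(\<Prod>i\<in>I. epow (d i) (a i)) = (\<Prod>i\<in>I. epow (c i) (a i))"
      by (intro prod.cong) (auto simp: d_def)
    finally show ?thesis by (simp add: c_def)
  qed
qed

section \<open>Line integrals and the Loomis-Whitney inequality\<close>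

lemma AE_lborel_translate:
  fixes c :: "'a::euclidean_space"
  assumes "AE x in lborel. P x" shows "AE x in lborel. P (x + c)"
proof -
  obtain N where N: "{x. \<not> P x} \<subseteq> N" "N \<in> null_sets lborel"
    using assms by (auto elim!: AE_E simp: null_sets_def)
  have "(+) c \<in> measurable lborel lborel" by simp
  moreover have "AE x in distr lborel lborel ((+) c). x \<notin> N"
    using N(2) lborel_distr_plus[of c] by (metis AE_not_in distr_cong sets_lborel)
  ultimately have "AE x in lborel. c + x \<notin> N"
    using N(2) by (subst (asm) AE_distr_iff) (auto simp: null_sets_def)
  then show ?thesis by (rule eventually_mono) (use N in \<open>auto simp: add.commute\<close>)
qed

lemma nn_integral_lborel_translate:
  fixes c :: "'a::euclidean_space"
  assumes [measurable]: "F \<in> borel_measurable borel"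
  shows "(\<integral>\<^sup>+x. F (x + c) \<partial>lborel) = (\<integral>\<^sup>+x. F x \<partial>lborel)"
proof -
  have "(\<integral>\<^sup>+x. F x \<partial>lborel) = (\<integral>\<^sup>+x. F x \<partial>distr lborel borel ((+) c))"
    by (simp add: lborel_distr_plus)
  also have "\<dots> = (\<integral>\<^sup>+x. F (c + x) \<partial>lborel)"
    by (subst nn_integral_distr) auto
  finally show ?thesis by (simp add: add.commute)
qed

text \<open>A line integral is kept as a function on the whole space that is invariant under translation along
  \<open>e\<close>, so that no coordinate ever has to be removed.\<close>

definition line_int :: "'a::euclidean_space \<Rightarrow> ('a \<Rightarrow> ennreal) \<Rightarrow> 'a \<Rightarrow> ennreal" where
  "line_int e F x = (\<integral>\<^sup>+s. F (x + s *\<^sub>R e) \<partial>lborel)"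

lemma line_int_measurable [measurable (raw)]:
  assumes [measurable]: "F \<in> borel_measurable borel"
  shows "line_int e F \<in> borel_measurable borel"
  unfolding line_int_def by measurable

lemma line_int_translate:
  assumes [measurable]: "F \<in> borel_measurable borel"
  shows "line_int e F (x + h *\<^sub>R e) = line_int e F x"
proof -
  have "line_int e F (x + h *\<^sub>R e) = (\<integral>\<^sup>+s. F (x + (s + h) *\<^sub>R e) \<partial>lborel)"
    by (simp add: line_int_def algebra_simps)
  also have "\<dots> = line_int e F x"
    unfolding line_int_def by (rule nn_integral_lborel_translate) measurable
  finally show ?thesis .
qed

lemma line_int_commute:
  assumes [measurable]: "F \<in> borel_measurable borel"
  shows "line_int e (line_int e' F) x = line_int e' (line_int e F) x"
  unfolding line_int_def
  by (subst lborel_pair.Fubini') (auto simp: algebra_simps)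

lemma line_int_mono: "(\<And>x. F x \<le> G x) \<Longrightarrow> line_int e F x \<le> line_int e G x"
  unfolding line_int_def by (intro nn_integral_mono) auto

text \<open>A list of directions, so that the Loomis-Whitney inequality can be proved by adding one
  direction at a time. After all of \<open>Basis\<close> the function is constant and equals the
  full integral.\<close>

fun iter_line_int :: "'a::euclidean_space list \<Rightarrow> ('a \<Rightarrow> ennreal) \<Rightarrow> 'a \<Rightarrow> ennreal" where
  "iter_line_int [] F = F"
| "iter_line_int (e # es) F = line_int e (iter_line_int es F)"

lemma iter_line_int_measurable [measurable (raw)]:
  "F \<in> borel_measurable borel \<Longrightarrow> iter_line_int es F \<in> borel_measurable borel"
  by (induction es) auto

lemma iter_line_int_line_int:
  assumes [measurable]: "F \<in> borel_measurable borel"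
  shows "iter_line_int es (line_int e F) = line_int e (iter_line_int es F)"
proof (induction es)
  case (Cons d es)
  then show ?case by (auto intro!: ext line_int_commute)
qed auto

text \<open>In the Loomis-Whitney inequality the factor with index \<open>e\<close> is integrated
  over every direction except \<open>e\<close>; when it is itself a line integral along
  \<open>e\<close>, the missing direction is restored.\<close>

lemma iter_line_int_remove1:
  assumes [measurable]: "F \<in> borel_measurable borel" and "e \<in> set es"
  shows "iter_line_int (remove1 e es) (line_int e F) = iter_line_int es F"
  using assms(2)
proof (induction es)
  case (Cons d es)
  have "line_int e (line_int d G) = line_int d (line_int e G)" if "G \<in> borel_measurable borel" for G
    using that by (auto intro: line_int_commute)
  with Cons show ?case by (auto simp: iter_line_int_line_int)
qed auto

lemma iter_line_int_translate:
  assumes "F \<in> borel_measurable borel" "\<And>x h. F (x + h *\<^sub>R e) = F x"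
  shows "iter_line_int es F (x + h *\<^sub>R e) = iter_line_int es F x"
proof (induction es arbitrary: x)
  case (Cons d es)
  have "iter_line_int es F (x + h *\<^sub>R e + s *\<^sub>R d) = iter_line_int es F (x + s *\<^sub>R d)" for s
    using Cons[of "x + s *\<^sub>R d"] by (simp add: algebra_simps)
  then show ?case by (simp add: line_int_def)
qed (use assms in auto)

text \<open>Link to the construction of \<open>lborel\<close> as an image of a product of
  one-dimensional measures; Tonelli's theorem on the product peels off one coordinate per list
  element.\<close>

lemma iter_line_int_PiM:
  fixes F :: "'a::euclidean_space \<Rightarrow> ennreal"
  assumes [measurable]: "F \<in> borel_measurable borel" and "distinct es"
  shows "iter_line_int es F x = (\<integral>\<^sup>+f. F (x + (\<Sum>b\<in>set es. f b *\<^sub>R b)) \<partial>(\<Pi>\<^sub>M b\<in>set es. lborel))"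
  using assms(2)
proof (induction es arbitrary: x)
  case Nil
  show ?case by (simp add: PiM_empty nn_integral_count_space_finite)
next
  case (Cons e es)
  interpret product_sigma_finite "\<lambda>_::'a. lborel :: real measure" ..
  have *: "(\<Sum>b\<in>set es. (f(e := s)) b *\<^sub>R b) = (\<Sum>b\<in>set es. f b *\<^sub>R b)" for f :: "'a \<Rightarrow> real" and s
    using Cons(2) by (intro sum.cong) auto
  show ?case
    using Cons
    apply (simp add: line_int_def)
    apply (subst product_nn_integral_insert_rev)
       apply (auto simp: * add.assoc simp del: fun_upd_apply)
    apply (auto simp add: *)
    done
qed

lemma nn_integral_iter_line_int:
  fixes F :: "'a::euclidean_space \<Rightarrow> ennreal"
  assumes [measurable]: "F \<in> borel_measurable borel" and "distinct es" "set es = Basis"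
  shows "iter_line_int es F x = (\<integral>\<^sup>+x. F x \<partial>lborel)"
proof -
  have "iter_line_int es F x = (\<integral>\<^sup>+f. F (x + (\<Sum>b\<in>Basis. f b *\<^sub>R b)) \<partial>(\<Pi>\<^sub>M b\<in>(Basis::'a set). lborel))"
    using assms by (simp add: iter_line_int_PiM)
  also have "\<dots> = (\<integral>\<^sup>+y. F (x + y) \<partial>lborel)"
    by (subst (2) lborel_eq) (simp add: nn_integral_distr)
  also have "\<dots> = (\<integral>\<^sup>+x. F x \<partial>lborel)"
    using nn_integral_lborel_translate[of F x] by (simp add: add.commute)
  finally show ?thesis .
qed

text \<open>Each integration along \<open>e\<close> leaves the factor with index \<open>e\<close> alone; Hoelder's inequality with equal
  exponents handles the remaining \<open>DIM('a) - 1\<close> factors.\<close>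

lemma loomis_whitney_iter:
  fixes F :: "'a::euclidean_space \<Rightarrow> 'a \<Rightarrow> ennreal"
  assumes [measurable]: "\<And>b. b \<in> Basis \<Longrightarrow> F b \<in> borel_measurable borel"
    and inv: "\<And>b x h. b \<in> Basis \<Longrightarrow> F b (x + h *\<^sub>R b) = F b x"
    and "distinct es" "set es \<subseteq> Basis" and dim: "DIM('a) \<ge> 2"
  shows "iter_line_int es (\<lambda>x. \<Prod>b\<in>Basis. epow (F b x) (1 / (DIM('a) - 1))) x
    \<le> (\<Prod>b\<in>Basis. epow (iter_line_int (remove1 b es) (F b) x) (1 / (DIM('a) - 1)))"
  using assms(3,4)
proof (induction es arbitrary: x)
  case (Cons e es)
  define q where "q = 1 / (real DIM('a) - 1)"
  define H where "H b = iter_line_int (remove1 b es) (F b)" for b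
  have [measurable]: "H b \<in> borel_measurable borel" if "b \<in> Basis" for b
    unfolding H_def using that by measurable
  have e: "e \<in> Basis" "e \<notin> set es" using Cons by auto
  have q: "0 \<le> q" "(\<Sum>b\<in>Basis - {e}. q) = 1"
    using dim e by (auto simp: q_def card_Diff_singleton of_nat_diff)
  have "iter_line_int (e # es) (\<lambda>x. \<Prod>b\<in>Basis. epow (F b x) q) x
      \<le> line_int e (\<lambda>x. \<Prod>b\<in>Basis. epow (H b x) q) x"
    using Cons unfolding H_def q_def by (auto intro!: line_int_mono)
  also have "\<dots> = (\<integral>\<^sup>+s. epow (H e x) q * (\<Prod>b\<in>Basis-{e}. epow (H b (x + s *\<^sub>R e)) q) \<partial>lborel)"
  proof -
    have "H e (x + s *\<^sub>R e) = H e x" for s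
      unfolding H_def using e inv by (intro iter_line_int_translate) auto
    then show ?thesis
      using e by (simp add: line_int_def prod.remove[of Basis e])
  qed
  also have "\<dots> = epow (H e x) q * (\<integral>\<^sup>+s. (\<Prod>b\<in>Basis-{e}. epow (H b (x + s *\<^sub>R e)) q) \<partial>lborel)"
    by (intro nn_integral_cmult) measurable
  also have "\<dots> \<le> epow (H e x) q * (\<Prod>b\<in>Basis-{e}. epow (\<integral>\<^sup>+s. H b (x + s *\<^sub>R e) \<partial>lborel) q)"
    using q by (intro mult_left_mono Holder_nn_integral) auto
  \<comment> \<open>\<open>remove1 e (e # es)\<close> is \<open>es\<close>, so the factor
    \<open>e\<close> gains no integral, while every other factor gains exactly the one along
    \<open>e\<close>.\<close>
  also have "\<dots> = (\<Prod>b\<in>Basis. epow (iter_line_int (remove1 b (e # es)) (F b) x) q)"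
    using e by (auto simp: prod.remove[of Basis e] H_def remove1_idem line_int_def
        intro!: arg_cong2[where f="(*)"] prod.cong)
  finally show ?case by (simp add: q_def)
qed (auto)

text \<open>\<open>line_int b (f b)\<close> does not change along \<open>b\<close>, which is what
  the iterated version asks of its factors. Running through all of \<open>Basis\<close> produces
  full integrals on both sides, so the base point 0 is immaterial.\<close>

lemma loomis_whitney:
  fixes f :: "'a::euclidean_space \<Rightarrow> 'a \<Rightarrow> ennreal"
  assumes [measurable]: "\<And>b. b \<in> Basis \<Longrightarrow> f b \<in> borel_measurable borel" and dim: "DIM('a) \<ge> 2"
  shows "(\<integral>\<^sup>+x. (\<Prod>b\<in>Basis. epow (line_int b (f b) x) (1 / (DIM('a) - 1))) \<partial>lborel)
    \<le> (\<Prod>b\<in>Basis. epow (\<integral>\<^sup>+x. f b x \<partial>lborel) (1 / (DIM('a) - 1)))"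
proof -
  obtain es where es: "distinct es" "set es = (Basis :: 'a set)"
    using finite_distinct_list[OF finite_Basis] by blast
  have "(\<integral>\<^sup>+x. (\<Prod>b\<in>Basis. epow (line_int b (f b) x) (1 / (DIM('a) - 1))) \<partial>lborel)
      = iter_line_int es (\<lambda>x. \<Prod>b\<in>Basis. epow (line_int b (f b) x) (1 / (DIM('a) - 1))) 0"
    using es by (subst nn_integral_iter_line_int) auto
  also have "\<dots> \<le> (\<Prod>b\<in>Basis. epow (iter_line_int (remove1 b es) (line_int b (f b)) 0) (1 / (DIM('a) - 1)))"
    using es dim by (intro loomis_whitney_iter) (auto simp: line_int_translate)
  also have "\<dots> = (\<Prod>b\<in>Basis. epow (\<integral>\<^sup>+x. f b x \<partial>lborel) (1 / (DIM('a) - 1)))"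
    using es by (intro prod.cong) (auto simp: iter_line_int_remove1 nn_integral_iter_line_int)
  finally show ?thesis .
qed

section \<open>A level set estimate on the line\<close>

lemma AE_lborel_uminus:
  assumes "AE x in lborel. P (x::real)" shows "AE x in lborel. P (- x)"
proof -
  obtain N where N: "{x. \<not> P x} \<subseteq> N" "N \<in> null_sets lborel"
    using assms by (auto elim!: AE_E simp: null_sets_def)
  have "uminus \<in> measurable lborel (lborel :: real measure)" by simp
  moreover have "AE x in distr lborel lborel uminus. x \<notin> N"
    using N(2) lborel_distr_uminus by (metis AE_not_in distr_cong sets_lborel)
  ultimately have "AE x in lborel. - x \<notin> N"
    using N(2) by (subst (asm) AE_distr_iff) (auto simp: null_sets_def)
  then show ?thesis by (rule eventually_mono) (use N in auto)
qed

text \<open>The increment bound is known for almost every \<open>r\<close> only and \<open>f\<close>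
  need not be continuous, so a first point below level \<open>m\<close> need not exist. The infimum
  \<open>\<tau>\<close> of the admissible points below \<open>m\<close> replaces it: almost
  everywhere on \<open>{0..\<tau>}\<close> the value is at least \<open>m\<close>, while the drop
  from \<open>2 * m\<close> to below \<open>m\<close> costs \<open>g\<close> a mass of at least
  \<open>m\<close> on that interval. The weight is at least \<open>m powr (\<gamma> - 1)\<close>
  there.\<close>

lemma level_bound_right:
  fixes f :: "real \<Rightarrow> real" and g :: "real \<Rightarrow> ennreal"
  assumes [measurable]: "f \<in> borel_measurable borel" "g \<in> borel_measurable borel"
    and ae: "AE r in lborel. r \<in> {0..r0} \<longrightarrow> ennreal \<bar>f r - f 0\<bar> \<le> (\<integral>\<^sup>+s\<in>{0..r}. g s \<partial>lborel)"
    and fin: "(\<integral>\<^sup>+s\<in>{0..r0}. g s \<partial>lborel) < \<infinity>"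
    and r0: "0 \<le> r0" "ennreal \<bar>f r0 - f 0\<bar> \<le> (\<integral>\<^sup>+s\<in>{0..r0}. g s \<partial>lborel)" "f r0 < m"
    and m: "0 < m" "2 * m \<le> f 0" "m \<le> K" and \<gamma>: "1 \<le> \<gamma>"
  shows "ennreal (m powr \<gamma>) \<le> (\<integral>\<^sup>+s\<in>{0..r0}. ennreal (min (f s) K powr (\<gamma> - 1)) * g s \<partial>lborel)"
proof -
  define P where "P = {r \<in> {0..r0}. ennreal \<bar>f r - f 0\<bar> \<le> (\<integral>\<^sup>+s\<in>{0..r}. g s \<partial>lborel)}"
  define \<tau> where "\<tau> = Inf {r \<in> P. f r < m}"
  have ne: "{r \<in> P. f r < m} \<noteq> {}" using r0 by (auto simp: P_def)
  have bb: "bdd_below {r \<in> P. f r < m}" by (auto simp: P_def intro!: bdd_belowI[of _ 0])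
  have \<tau>: "0 \<le> \<tau>" "\<tau> \<le> r0"
    unfolding \<tau>_def using ne r0 by (auto simp: P_def intro!: cInf_greatest cInf_lower bdd_belowI[of _ 0])
  have below: "m \<le> f r" if "r \<in> P" "r < \<tau>" for r
    using that cInf_lower[OF _ bb, of r] unfolding \<tau>_def by fastforce
  define \<nu> where "\<nu> = density lborel g"
  have \<nu>: "emeasure \<nu> {0..b} = (\<integral>\<^sup>+s\<in>{0..b}. g s \<partial>lborel)" for b
    by (simp add: \<nu>_def emeasure_density mult.commute)
  \<comment> \<open>\<open>\<tau>\<close> itself need not be an admissible point below
    \<open>m\<close>. The mass bound is first obtained on slightly larger intervals; continuity from
    above, available because of \<open>fin\<close>, brings it down to
    \<open>{0..\<tau>}\<close>.\<close>
  define A where "A n = {0..min r0 (\<tau> + inverse (real (Suc n)))}" for n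
  have A_fin: "emeasure \<nu> (A n) \<noteq> \<infinity>" for n
  proof -
    have "emeasure \<nu> (A n) \<le> emeasure \<nu> {0..r0}"
      by (intro emeasure_mono) (auto simp: A_def \<nu>_def)
    then show ?thesis using fin \<nu>[of r0] by (auto simp: top_unique)
  qed
  have lower: "ennreal m \<le> emeasure \<nu> (A n)" for n
  proof -
    have "\<tau> < \<tau> + inverse (real (Suc n))" by simp
    then obtain r where r: "r \<in> P" "f r < m" "r < \<tau> + inverse (real (Suc n))"
      unfolding \<tau>_def using cInf_lessD[OF ne] by blast
    have "ennreal m \<le> ennreal \<bar>f r - f 0\<bar>" using r m by (intro ennreal_leI) auto
    also have "\<dots> \<le> emeasure \<nu> {0..r}" using r by (auto simp: P_def \<nu>)
    also have "\<dots> \<le> emeasure \<nu> (A n)"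
      using r by (intro emeasure_mono) (auto simp: A_def \<nu>_def P_def)
    finally show ?thesis .
  qed
  have "(INF n. emeasure \<nu> (A n)) = emeasure \<nu> (\<Inter>n. A n)"
  proof (intro INF_emeasure_decseq A_fin)
    have "inverse (real (Suc n)) \<le> inverse (real (Suc k))" if "k \<le> n" for k n
      using that by (intro le_imp_inverse_le) auto
    then show "decseq A" unfolding decseq_def A_def by (auto intro!: min.coboundedI2 simp del: of_nat_Suc)
  qed (auto simp: A_def \<nu>_def)
  moreover have "(\<Inter>n. A n) = {0..\<tau>}"
  proof safe
    fix x assume x: "x \<in> (\<Inter>n. A n)"
    have "x \<le> \<tau>"
    proof (rule ccontr)
      assume "\<not> x \<le> \<tau>"
      then obtain n where "inverse (real (Suc n)) < x - \<tau>"
        using reals_Archimedean[of "x - \<tau>"] by auto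
      moreover have "x \<in> A n" using x by blast
      ultimately show False by (auto simp: A_def)
    qed
    moreover have "x \<in> A 0" using x by blast
    ultimately show "x \<in> {0..\<tau>}" by (auto simp: A_def)
  qed (use \<tau> in \<open>auto simp: A_def intro!: add_increasing2\<close>)
  ultimately have m_le: "ennreal m \<le> emeasure \<nu> {0..\<tau>}"
    using lower by (metis INF_greatest)
  \<comment> \<open>\<open>below\<close> speaks of \<open>r < \<tau>\<close> only; the endpoint is
    discarded as a null set.\<close>
  have ae': "AE s in lborel. s \<in> {0..\<tau>} \<longrightarrow> m \<le> f s"
    using ae AE_lborel_singleton[of \<tau>]
    by eventually_elim (use \<tau> below in \<open>auto simp: P_def\<close>)
  have "m powr \<gamma> = m powr (\<gamma> - 1) * m"
    using m by (simp add: powr_diff)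
  then have "ennreal (m powr \<gamma>) = ennreal (m powr (\<gamma> - 1)) * ennreal m"
    using m by (simp add: ennreal_mult)
  also have "\<dots> \<le> ennreal (m powr (\<gamma> - 1)) * (\<integral>\<^sup>+s\<in>{0..\<tau>}. g s \<partial>lborel)"
    using m_le by (intro mult_left_mono) (auto simp: \<nu>)
  also have "\<dots> = (\<integral>\<^sup>+s. ennreal (m powr (\<gamma> - 1)) * (g s * indicator {0..\<tau>} s) \<partial>lborel)"
    by (intro nn_integral_cmult[symmetric]) measurable
  also have "\<dots> \<le> (\<integral>\<^sup>+s\<in>{0..r0}. ennreal (min (f s) K powr (\<gamma> - 1)) * g s \<partial>lborel)"
    using ae' by (intro nn_integral_mono_AE, eventually_elim)
      (use \<tau> m \<gamma> in \<open>auto simp: indicator_def intro!: mult_right_mono ennreal_leI powr_mono2\<close>)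
  finally show ?thesis .
qed

text \<open>If \<open>c = min (f 0) K\<close>, the graph of \<open>f\<close> must descend from level \<open>c\<close> to level \<open>c / 2\<close> through
  a set on which \<open>f \<ge> c / 2\<close>; this replaces the chain rule for \<open>f powr \<gamma>\<close>, at the price of the
  constant \<open>2 powr \<gamma>\<close>.\<close>

lemma level_bound:
  fixes f :: "real \<Rightarrow> real" and g :: "real \<Rightarrow> ennreal"
  assumes [measurable]: "f \<in> borel_measurable borel" "g \<in> borel_measurable borel" "J \<in> sets borel"
    and J: "convex J" "0 \<in> J"
    and ae: "AE r in lborel. r \<in> J \<longrightarrow> ennreal \<bar>f r - f 0\<bar> \<le> (\<integral>\<^sup>+s\<in>closed_segment 0 r. g s \<partial>lborel)"
    and fin: "\<And>r. r \<in> J \<Longrightarrow> (\<integral>\<^sup>+s\<in>closed_segment 0 r. g s \<partial>lborel) < \<infinity>"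
    and van: "\<And>\<epsilon>. 0 < \<epsilon> \<Longrightarrow> \<not> (AE r in lborel. r \<in> J \<longrightarrow> \<epsilon> \<le> f r)"
    and f0: "0 \<le> f 0" and K: "0 < K" and \<gamma>: "1 \<le> \<gamma>"
  shows "ennreal ((min (f 0) K / 2) powr \<gamma>) \<le> (\<integral>\<^sup>+s\<in>J. ennreal (min (f s) K powr (\<gamma> - 1)) * g s \<partial>lborel)"
proof (cases "f 0 = 0")
  case False
  define m where "m = min (f 0) K / 2"
  have m: "0 < m" "2 * m \<le> f 0" "m \<le> K" using False f0 K by (auto simp: m_def)
  \<comment> \<open>If there were no such point, almost every \<open>r\<close> in \<open>J\<close>
    would satisfy \<open>m \<le> f r\<close>, against \<open>van\<close> at level
    \<open>m\<close>.\<close>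
  have "\<exists>r. r \<in> J \<and> f r < m \<and> ennreal \<bar>f r - f 0\<bar> \<le> (\<integral>\<^sup>+s\<in>closed_segment 0 r. g s \<partial>lborel)"
  proof (rule ccontr)
    assume *: "\<not> ?thesis"
    from ae have "AE r in lborel. r \<in> J \<longrightarrow> m \<le> f r"
      by eventually_elim (use * in \<open>force simp: not_less\<close>)
    with van[OF m(1)] show False by simp
  qed
  then obtain r0 where r0: "r0 \<in> J" "f r0 < m"
    "ennreal \<bar>f r0 - f 0\<bar> \<le> (\<integral>\<^sup>+s\<in>closed_segment 0 r0. g s \<partial>lborel)" by blast
  have seg: "closed_segment 0 r \<subseteq> J" if "r \<in> J" for r
    using J that by (simp add: closed_segment_subset)
  show ?thesis
  proof (cases "0 \<le> r0")
    case True
    have "ennreal (m powr \<gamma>) \<le> (\<integral>\<^sup>+s\<in>{0..r0}. ennreal (min (f s) K powr (\<gamma> - 1)) * g s \<partial>lborel)"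
    proof (rule level_bound_right)
      show "AE r in lborel. r \<in> {0..r0} \<longrightarrow> ennreal \<bar>f r - f 0\<bar> \<le> (\<integral>\<^sup>+s\<in>{0..r}. g s \<partial>lborel)"
        using ae by eventually_elim (use seg[OF r0(1)] True in \<open>auto simp: closed_segment_eq_real_ivl\<close>)
    qed (use r0 fin[OF r0(1)] True m \<gamma> in \<open>auto simp: closed_segment_eq_real_ivl\<close>)
    also have "\<dots> \<le> (\<integral>\<^sup>+s\<in>J. ennreal (min (f s) K powr (\<gamma> - 1)) * g s \<partial>lborel)"
      using seg[OF r0(1)] True
      by (intro nn_integral_mono) (auto simp: indicator_def closed_segment_eq_real_ivl)
    finally show ?thesis by (simp add: m_def)
  next
    case False
    \<comment> \<open>A descent to the left of 0 becomes one to the right under the reflection of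
      \<open>s\<close> to \<open>- s\<close>.\<close>
    have refl: "(\<integral>\<^sup>+s. h (- s) \<partial>lborel) = (\<integral>\<^sup>+s. h s \<partial>lborel)"
      if "h \<in> borel_measurable borel" for h :: "real \<Rightarrow> ennreal"
      using nn_integral_real_affine[OF that, of "-1" 0] by simp
    have seg_eq: "(\<integral>\<^sup>+s\<in>closed_segment 0 (- r). g s \<partial>lborel) = (\<integral>\<^sup>+s\<in>{0..r}. g (- s) \<partial>lborel)" if "0 \<le> r" for r
    proof -
      have "(\<integral>\<^sup>+s\<in>closed_segment 0 (- r). g s \<partial>lborel) = (\<integral>\<^sup>+s. g s * indicator {-r..0} s \<partial>lborel)"
        using that by (simp add: closed_segment_eq_real_ivl cong: if_cong)
      also have "\<dots> = (\<integral>\<^sup>+s. g (-s) * indicator {-r..0} (- s) \<partial>lborel)"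
        by (subst refl[symmetric]) simp_all
      also have "\<dots> = (\<integral>\<^sup>+s\<in>{0..r}. g (- s) \<partial>lborel)"
        by (intro nn_integral_cong) (auto simp: indicator_def)
      finally show ?thesis .
    qed
    have "ennreal (m powr \<gamma>) \<le> (\<integral>\<^sup>+s\<in>{0..-r0}. ennreal (min (f (-s)) K powr (\<gamma> - 1)) * g (-s) \<partial>lborel)"
    proof (rule level_bound_right)
      show "AE r in lborel. r \<in> {0..-r0} \<longrightarrow> ennreal \<bar>f (-r) - f (-0)\<bar> \<le> (\<integral>\<^sup>+s\<in>{0..r}. g (-s) \<partial>lborel)"
        using AE_lborel_uminus[OF ae]
      proof eventually_elim
        case (elim r)
        then show ?case
          using seg[OF r0(1)] False seg_eq[of r] by (auto simp: closed_segment_eq_real_ivl subset_iff)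
      qed
    qed (use r0 fin[OF r0(1)] False m \<gamma> seg_eq[of "-r0"] in auto)
    also have "\<dots> = (\<integral>\<^sup>+s\<in>{r0..0}. ennreal (min (f s) K powr (\<gamma> - 1)) * g s \<partial>lborel)"
      by (subst refl[symmetric]) (auto simp: indicator_def intro!: nn_integral_cong)
    also have "\<dots> \<le> (\<integral>\<^sup>+s\<in>J. ennreal (min (f s) K powr (\<gamma> - 1)) * g s \<partial>lborel)"
      using seg[OF r0(1)] False
      by (intro nn_integral_mono) (auto simp: indicator_def closed_segment_eq_real_ivl)
    finally show ?thesis by (simp add: m_def)
  qed
qed (use K in auto)

section \<open>Smooth bump functions\<close>

text \<open>\<open>C_inf\<close> is coinductive, but the derivative of a product is a sum of
  products, so closure under products is not a direct coinduction. The finite orders allow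
  induction, and \<open>C_inf_iff\<close> leads back.\<close>

fun smooth_upto :: "nat \<Rightarrow> ('a::euclidean_space \<Rightarrow> real) \<Rightarrow> bool" where
  "smooth_upto 0 f \<longleftrightarrow> True"
| "smooth_upto (Suc n) f \<longleftrightarrow> (\<forall>x. f differentiable (at x)) \<and>
     (\<forall>v\<in>Basis. smooth_upto n (\<lambda>x. frechet_derivative f (at x) v))"

lemma smooth_upto_SucI:
  assumes "\<And>x. (f has_derivative f' x) (at x)" "\<And>v. v \<in> Basis \<Longrightarrow> smooth_upto n (\<lambda>x. f' x v)"
  shows "smooth_upto (Suc n) f"
  using assms frechet_derivative_at[OF assms(1)] by (auto simp: differentiable_def)

lemma smooth_upto_SucD:
  assumes "smooth_upto (Suc n) f"
  shows "(f has_derivative frechet_derivative f (at x)) (at x)"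
    "v \<in> Basis \<Longrightarrow> smooth_upto n (\<lambda>x. frechet_derivative f (at x) v)"
  using assms by (auto simp: frechet_derivative_works)

lemma smooth_upto_lower: "smooth_upto (Suc n) f \<Longrightarrow> smooth_upto n f"
  by (induction n arbitrary: f) auto

lemma C_inf_iff: "C_inf f \<longleftrightarrow> (\<forall>n. smooth_upto n f)"
proof
  have "smooth_upto n f" if "C_inf f" for n
    using that
  proof (induction n arbitrary: f)
    case (Suc n)
    from Suc.prems show ?case by (cases rule: C_inf.cases) (auto intro: Suc.IH)
  qed auto
  then show "C_inf f \<Longrightarrow> \<forall>n. smooth_upto n f" by blast
next
  assume "\<forall>n. smooth_upto n f"
  then show "C_inf f"
  proof (coinduction arbitrary: f)
    case C_inf
    then have "smooth_upto (Suc n) f" for n by blast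
    then show ?case by auto
  qed
qed

lemma smooth_upto_const: "smooth_upto n (\<lambda>x. c)"
  by (induction n arbitrary: c) (auto simp: frechet_derivative_const)

lemma smooth_upto_add: "smooth_upto n f \<Longrightarrow> smooth_upto n g \<Longrightarrow> smooth_upto n (\<lambda>x. f x + g x)"
proof (induction n arbitrary: f g)
  case (Suc n)
  show ?case
    by (rule smooth_upto_SucI[OF has_derivative_add[OF smooth_upto_SucD(1)[OF Suc.prems(1)] smooth_upto_SucD(1)[OF Suc.prems(2)]]])
       (use Suc in auto)
qed auto

lemma smooth_upto_mult: "smooth_upto n f \<Longrightarrow> smooth_upto n g \<Longrightarrow> smooth_upto n (\<lambda>x. f x * g x)"
proof (induction n arbitrary: f g)
  case (Suc n)
  show ?case
    by (rule smooth_upto_SucI[OF has_derivative_mult[OF smooth_upto_SucD(1)[OF Suc.prems(1)] smooth_upto_SucD(1)[OF Suc.prems(2)]]])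
       (use Suc smooth_upto_lower[OF Suc.prems(1)] smooth_upto_lower[OF Suc.prems(2)] in
         \<open>auto intro!: smooth_upto_add\<close>)
qed auto

lemma smooth_upto_affine:
  fixes h :: "real \<Rightarrow> real" and w :: "'a::euclidean_space"
  shows "smooth_upto n h \<Longrightarrow> smooth_upto n (\<lambda>x. h (c + x \<bullet> w))"
proof (induction n arbitrary: h)
  case (Suc n)
  let ?h' = "\<lambda>x. frechet_derivative h (at x) 1"
  have lin: "frechet_derivative h (at y) t = t * ?h' y" for y t
    using linear_cmul[OF linear_frechet_derivative, of h "at y" t 1] Suc.prems by simp
  have "((\<lambda>x. h (c + x \<bullet> w)) has_derivative (\<lambda>v. (v \<bullet> w) * ?h' (c + x \<bullet> w))) (at x)" for x
  proof -
    have "((\<lambda>x. c + x \<bullet> w) has_derivative (\<lambda>v. v \<bullet> w)) (at x)"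
      by (auto intro!: derivative_eq_intros)
    from has_derivative_compose[OF this smooth_upto_SucD(1)[OF Suc.prems]]
    show ?thesis by (subst (asm) lin)
  qed
  moreover have "smooth_upto n (\<lambda>x. (v \<bullet> w) * ?h' (c + x \<bullet> w))" for v
    using Suc by (intro smooth_upto_mult smooth_upto_const Suc.IH) auto
  ultimately show ?case by (rule smooth_upto_SucI)
qed auto

lemma smooth_upto_DERIV:
  fixes h :: "real \<Rightarrow> real"
  assumes "\<And>x. (h has_real_derivative h' x) (at x)" "smooth_upto n h'"
  shows "smooth_upto (Suc n) h"
  by (rule smooth_upto_SucI[of h "\<lambda>x v. h' x * v"])
    (use assms in \<open>auto simp: has_field_derivative_def\<close>)

section \<open>Closure properties of smooth functions\<close>

lemma C_inf_const: "C_inf (\<lambda>x. c)"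
  by (simp add: C_inf_iff smooth_upto_const)

lemma C_inf_mult: "C_inf f \<Longrightarrow> C_inf g \<Longrightarrow> C_inf (\<lambda>x. f x * g x)"
  by (simp add: C_inf_iff smooth_upto_mult)

lemma C_inf_diff: "C_inf f \<Longrightarrow> C_inf g \<Longrightarrow> C_inf (\<lambda>x. f x - g x)"
  using smooth_upto_add[of _ f "\<lambda>x. -1 * g x"] smooth_upto_mult[OF smooth_upto_const[of _ "-1"], of _ g]
  by (simp add: C_inf_iff)

lemma C_inf_prod: "(\<And>i. i \<in> I \<Longrightarrow> C_inf (f i)) \<Longrightarrow> C_inf (\<lambda>x. \<Prod>i\<in>I. f i x)"
  by (induction I rule: infinite_finite_induct) (auto intro: C_inf_const C_inf_mult)

lemma C_inf_affine: "C_inf h \<Longrightarrow> C_inf (\<lambda>x. h (c + x \<bullet> w))"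
  by (simp add: C_inf_iff smooth_upto_affine)

lemma C_inf_DERIV:
  fixes h :: "real \<Rightarrow> real"
  assumes "\<And>x. (h has_real_derivative h' x) (at x)" "C_inf h'"
  shows "C_inf h"
  unfolding C_inf_iff
proof
  fix n show "smooth_upto n h"
    by (rule smooth_upto_lower, rule smooth_upto_DERIV) (use assms in \<open>auto simp: C_inf_iff\<close>)
qed

lemma C_inf_differentiable: "C_inf f \<Longrightarrow> f differentiable (at x)"
  by (erule C_inf.cases) blast

lemma C_inf_frechet: "C_inf f \<Longrightarrow> v \<in> Basis \<Longrightarrow> C_inf (\<lambda>x. frechet_derivative f (at x) v)"
  by (erule C_inf.cases) blast

lemma C_inf_continuous: "C_inf f \<Longrightarrow> continuous_on A f"
  by (intro differentiable_imp_continuous_on differentiable_at_imp_differentiable_on C_inf_differentiable)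

text \<open>The case \<open>k = 0\<close> is the classical function that is flat at 0. The inverse
  powers are the factors its derivatives produce: the family is closed under differentiation up to
  linear combinations, so smoothness follows for all \<open>k\<close> at once.\<close>

definition exp_inv :: "nat \<Rightarrow> real \<Rightarrow> real" where
  "exp_inv k s = (if s \<le> 0 then 0 else inverse s ^ k * exp (- inverse s))"

lemma tendsto_exp_inv: "(exp_inv k \<longlongrightarrow> 0) (at_right 0)"
proof -
  have "((\<lambda>s. inverse s ^ k / exp (inverse s)) \<longlongrightarrow> 0) (at_right (0::real))"
    by (rule filterlim_compose[OF tendsto_power_div_exp_0 filterlim_inverse_at_top_right])
  then show ?thesis
    by (rule Lim_transform_eventually)
       (auto simp: eventually_at_filter exp_inv_def exp_minus field_simps)
qed

lemma exp_inv_DERIV: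
  "(exp_inv k has_real_derivative (exp_inv (k + 2) s - real k * exp_inv (k + 1) s)) (at s)"
proof -
  consider "s < 0" | "s = 0" | "0 < s" by linarith
  then show ?thesis
  proof cases
    case 1
    have "((\<lambda>_. 0) has_real_derivative 0) (at s)" by simp
    then have "(exp_inv k has_real_derivative 0) (at s)"
      by (rule has_field_derivative_transform_within_open[of _ _ _ "{..<0}"])
         (use 1 in \<open>auto simp: exp_inv_def\<close>)
    then show ?thesis using 1 by (simp add: exp_inv_def)
  next
    case 2
    \<comment> \<open>For \<open>y > 0\<close> the difference quotient at 0 is
      \<open>exp_inv (Suc k) y\<close>, so the limit from the right is the known one for the next
      index.\<close>
    have "((\<lambda>y. (exp_inv k y - exp_inv k 0) / (y - 0)) \<longlongrightarrow> 0) (at 0)"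
    proof (rule filterlim_split_at)
      show "((\<lambda>y. (exp_inv k y - exp_inv k 0) / (y - 0)) \<longlongrightarrow> 0) (at_left 0)"
        by (rule Lim_transform_eventually[OF tendsto_const])
           (auto simp: eventually_at_filter exp_inv_def)
      show "((\<lambda>y. (exp_inv k y - exp_inv k 0) / (y - 0)) \<longlongrightarrow> 0) (at_right 0)"
        by (rule Lim_transform_eventually[OF tendsto_exp_inv[of "Suc k"]])
           (auto simp: eventually_at_filter exp_inv_def divide_inverse)
    qed
    then show ?thesis using 2 by (simp add: has_field_derivative_iff exp_inv_def)
  next
    case 3
    have "((\<lambda>s. inverse s ^ k * exp (- inverse s)) has_real_derivative
        (exp_inv (k + 2) s - real k * exp_inv (k + 1) s)) (at s)"
    proof -
      have "((\<lambda>s. inverse s ^ k) has_real_derivative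
          real k * (- (inverse s ^ Suc (Suc 0)) * inverse s ^ (k - Suc 0))) (at s)"
        by (rule DERIV_power[OF DERIV_inverse]) (use 3 in auto)
      from DERIV_mult[OF this, of "\<lambda>s. exp (- inverse s)" "exp (- inverse s) * (inverse s * inverse s)"]
      have "((\<lambda>s. inverse s ^ k * exp (- inverse s)) has_real_derivative
          real k * (- (inverse s ^ Suc (Suc 0)) * inverse s ^ (k - Suc 0)) * exp (- inverse s)
          + exp (- inverse s) * (inverse s * inverse s) * inverse s ^ k) (at s)"
        using 3 by (auto intro!: derivative_eq_intros)
      then show ?thesis using 3 by (cases k) (simp_all add: exp_inv_def algebra_simps)
    qed
    then show ?thesis
      by (rule has_field_derivative_transform_within_open[of _ _ _ "{0<..}"])
         (use 3 in \<open>auto simp: exp_inv_def\<close>)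
  qed
qed

lemma C_inf_exp_inv: "C_inf (exp_inv k)"
proof -
  have "smooth_upto n (exp_inv k)" for n k
  proof (induction n arbitrary: k)
    case (Suc n)
    have "smooth_upto n (\<lambda>s. exp_inv (k + 2) s + (- real k) * exp_inv (k + 1) s)"
      by (intro smooth_upto_add smooth_upto_mult smooth_upto_const Suc.IH)
    then show ?case
      by (intro smooth_upto_DERIV[OF exp_inv_DERIV]) (simp add: algebra_simps)
  qed auto
  then show ?thesis by (simp add: C_inf_iff)
qed

text \<open>The factor \<open>n\<close> steepens both flanks: at each point of the open interval the
  values tend to 1, and outside it they are 0. Instead of a plateau or a normalised integral,
  pointwise convergence to the indicator under the bound 1 is used, for dominated
  convergence.\<close>

definition bump :: "nat \<Rightarrow> real \<Rightarrow> real \<Rightarrow> real \<Rightarrow> real" where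
  "bump n a b s = exp_inv 0 (real n * (s - a)) * exp_inv 0 (real n * (b - s))"

lemma C_inf_bump: "C_inf (bump n a b)"
proof -
  have "C_inf (\<lambda>s. exp_inv 0 (- (real n * a) + s \<bullet> real n) * exp_inv 0 (real n * b + s \<bullet> (- real n)))"
    by (intro C_inf_mult C_inf_affine C_inf_exp_inv)
  then show ?thesis by (simp add: bump_def[abs_def] algebra_simps)
qed

lemma bump_bounds: "0 \<le> bump n a b s" "bump n a b s \<le> 1"
proof -
  have "0 \<le> exp_inv 0 t \<and> exp_inv 0 t \<le> 1" for t by (simp add: exp_inv_def)
  then show "0 \<le> bump n a b s" "bump n a b s \<le> 1"
    by (auto simp: bump_def intro!: mult_le_one)
qed

lemma bump_eq_0: "s \<notin> {a<..<b} \<Longrightarrow> bump n a b s = 0"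
  by (auto simp: bump_def exp_inv_def mult_le_0_iff zero_less_mult_iff)

lemma bump_tendsto: "(\<lambda>n. bump n a b s) \<longlonglongrightarrow> indicator {a<..<b} s"
proof (cases "s \<in> {a<..<b}")
  case True
  have *: "(\<lambda>n. exp_inv 0 (real n * c)) \<longlonglongrightarrow> 1" if "0 < c" for c
  proof -
    have "(\<lambda>n. exp (- inverse (real n * c))) \<longlonglongrightarrow> exp (- 0)"
      using that by (intro tendsto_intros tendsto_inverse_0_at_top filterlim_at_top_mult_tendsto_pos[OF tendsto_const]
          filterlim_real_sequentially)
    moreover have "\<forall>\<^sub>F n in sequentially. exp (- inverse (real n * c)) = exp_inv 0 (real n * c)"
      using eventually_gt_at_top[of 0] by eventually_elim (use that in \<open>auto simp: exp_inv_def mult_le_0_iff\<close>)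
    ultimately show ?thesis by (simp add: Lim_transform_eventually)
  qed
  have "(\<lambda>n. bump n a b s) \<longlonglongrightarrow> 1 * 1"
    unfolding bump_def using True by (intro tendsto_mult *) auto
  then show ?thesis using True by simp
qed (simp add: bump_eq_0)

lemma bump_antiderivative:
  obtains Z where "\<And>s. (Z has_real_derivative bump n a b s) (at s)"
proof -
  have "\<exists>F. \<forall>x. -\<infinity> < ereal x \<longrightarrow> ereal x < \<infinity> \<longrightarrow> (F has_vector_derivative bump n a b x) (at x)"
    using C_inf_continuous[OF C_inf_bump, of UNIV n a b]
    by (intro einterval_antiderivative) (auto simp: continuous_on_eq_continuous_at)
  then show ?thesis
    using that by (auto simp: has_real_derivative_iff_has_vector_derivative)
qed

text \<open>\<open>ennreal (F x)\<close> and \<open>ennreal (- F x)\<close> are the positive and the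
  negative part. Boxes form a generator of the Borel sets that is stable under intersection, so the
  measures with these two densities coincide, and finite densities are determined almost
  everywhere.\<close>

lemma AE_eq_0_if_box_integrals_0:
  fixes F :: "'a::euclidean_space \<Rightarrow> real"
  assumes F: "integrable lborel F"
    and box: "\<And>l r. (\<integral>x. indicator (box l r) x * F x \<partial>lborel) = 0"
  shows "AE x in lborel. F x = 0"
proof -
  have [measurable]: "F \<in> borel_measurable borel" using F by auto
  have fin: "(\<integral>\<^sup>+x. ennreal (F x) \<partial>lborel) \<noteq> \<infinity>" "(\<integral>\<^sup>+x. ennreal (- F x) \<partial>lborel) \<noteq> \<infinity>"
    using F by (auto simp: real_integrable_def)
  have "density lborel (\<lambda>x. ennreal (F x)) = density lborel (\<lambda>x. ennreal (- F x))"
  proof (rule measure_eqI_generator_eq)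
    let ?E = "range (\<lambda>(a, b). box a b :: 'a set)"
    let ?A = "\<lambda>n::nat. box (- (real n *\<^sub>R One)) (real n *\<^sub>R One) :: 'a set"
    show "Int_stable ?E" by (auto simp: Int_stable_def box_Int_box)
    show "?E \<subseteq> Pow UNIV" by simp
    show "sets (density lborel (\<lambda>x. ennreal (F x))) = sigma_sets UNIV ?E"
      "sets (density lborel (\<lambda>x. ennreal (- F x))) = sigma_sets UNIV ?E"
      by (simp_all add: borel_eq_box)
    show "range ?A \<subseteq> ?E" "(\<Union>i. ?A i) = UNIV" unfolding UN_box_eq_UNIV by auto
    have le: "(\<integral>\<^sup>+x. ennreal (c * F x) * indicator X x \<partial>lborel) \<le> (\<integral>\<^sup>+x. ennreal (c * F x) \<partial>lborel)" for X c
      by (intro nn_integral_mono) (auto simp: indicator_def)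
    show "emeasure (density lborel (\<lambda>x. ennreal (F x))) (?A i) \<noteq> \<infinity>" for i
      using fin le[of 1 "?A i"] by (auto simp: emeasure_density top_unique)
    fix X :: "'a set" assume "X \<in> ?E"
    then obtain l r where X: "X = box l r" by auto
    have [measurable]: "X \<in> sets borel" by (simp add: X)
    have "integrable lborel (\<lambda>x. indicator X x * F x)"
      using integrable_mult_indicator[OF _ F, of X] by simp
    moreover have "(\<integral>\<^sup>+x. ennreal (indicator X x * F x) \<partial>lborel) = (\<integral>\<^sup>+x\<in>X. ennreal (F x) \<partial>lborel)"
      "(\<integral>\<^sup>+x. ennreal (- (indicator X x * F x)) \<partial>lborel) = (\<integral>\<^sup>+x\<in>X. ennreal (- F x) \<partial>lborel)"
      by (auto intro!: nn_integral_cong simp: indicator_def)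
    ultimately have "enn2real (\<integral>\<^sup>+x\<in>X. ennreal (F x) \<partial>lborel) = enn2real (\<integral>\<^sup>+x\<in>X. ennreal (- F x) \<partial>lborel)"
      using box[of l r] by (simp add: real_lebesgue_integral_def X)
    moreover have "(\<integral>\<^sup>+x\<in>X. ennreal (F x) \<partial>lborel) < top" "(\<integral>\<^sup>+x\<in>X. ennreal (- F x) \<partial>lborel) < top"
      using fin le[of 1 X] le[of "-1" X] by (auto simp: less_top top_unique)
    ultimately show "emeasure (density lborel (\<lambda>x. ennreal (F x))) X = emeasure (density lborel (\<lambda>x. ennreal (- F x))) X"
      by (simp add: emeasure_density) (metis ennreal_enn2real)
  qed
  then have "AE x in lborel. ennreal (F x) = ennreal (- F x)"
    using fin by (subst (asm) finite_density_unique) auto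
  then show ?thesis
    by eventually_elim (metis ennreal_eq_0_iff ennreal_neg linear neg_0_le_iff_le order_antisym neg_le_0_iff_le)
qed

section \<open>Smooth approximation of boxes and test functions for finite differences\<close>

definition box_bump :: "nat \<Rightarrow> 'a \<Rightarrow> 'a \<Rightarrow> 'a::euclidean_space \<Rightarrow> real" where
  "box_bump n l r y = (\<Prod>b\<in>Basis. bump n (l \<bullet> b) (r \<bullet> b) (y \<bullet> b))"

lemma box_bump_bounds: "0 \<le> box_bump n l r y" "box_bump n l r y \<le> 1"
  by (auto simp: box_bump_def bump_bounds intro!: prod_nonneg prod_le_1)

lemma box_bump_eq_0: "y \<notin> box l r \<Longrightarrow> box_bump n l r y = 0"
  using bump_eq_0 by (fastforce simp: box_bump_def mem_box)

lemma box_bump_tendsto: "(\<lambda>n. box_bump n l r y) \<longlonglongrightarrow> indicator (box l r) y"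
proof -
  have "(\<lambda>n. box_bump n l r y) \<longlonglongrightarrow> (\<Prod>b\<in>Basis. indicator {l \<bullet> b<..<r \<bullet> b} (y \<bullet> b))"
    unfolding box_bump_def by (intro tendsto_prod bump_tendsto)
  moreover have "(\<Prod>b\<in>Basis. indicator {l \<bullet> b<..<r \<bullet> b} (y \<bullet> b)) = (indicator (box l r) y :: real)"
    by (auto simp: indicator_def mem_box)
  ultimately show ?thesis by simp
qed

lemma box_bump_measurable [measurable]: "box_bump n l r \<in> borel_measurable borel"
proof -
  have [measurable]: "bump n a b \<in> borel_measurable borel" for a b
    by (intro borel_measurable_continuous_onI C_inf_continuous C_inf_bump)
  show ?thesis unfolding box_bump_def[abs_def] by measurable
qed

text \<open>The test functions: their derivative along \<open>e\<close> is a difference of two translates of a bump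
  function, so testing with them turns a weak derivative into a finite difference.\<close>

lemma translated_bump_primitive:
  fixes l r e :: "'a::euclidean_space"
  assumes e: "e \<in> Basis" and h: "0 \<le> h"
  obtains \<Phi> where "C_inf \<Phi>"
    "\<And>y. \<Phi> y = (\<integral>s. indicator {0..h} s * box_bump n l r (y - s *\<^sub>R e) \<partial>lborel)"
    "\<And>y. frechet_derivative \<Phi> (at y) e = box_bump n l r y - box_bump n l r (y - h *\<^sub>R e)"
proof -
  define \<zeta> where "\<zeta> b = bump n (l \<bullet> b) (r \<bullet> b)" for b
  obtain Z where Z: "\<And>s. (Z has_real_derivative \<zeta> e s) (at s)"
    unfolding \<zeta>_def using bump_antiderivative by blast
  define A where "A y = (\<Prod>b\<in>Basis-{e}. \<zeta> b (y \<bullet> b))" for y :: 'a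
  \<comment> \<open>\<open>Z\<close> is constant on either side of the bump but need not vanish
    there; the difference of two of its translates does. The form \<open>0 + y \<bullet> e\<close>
    matches the affine composition rule.\<close>
  define \<Phi> where "\<Phi> y = A y * (Z (0 + y \<bullet> e) - Z (- h + y \<bullet> e))" for y
  have A: "A (y + s *\<^sub>R e) = A y" for y s
    unfolding A_def using e by (intro prod.cong) (auto simp: inner_add_left inner_Basis)
  have bb: "box_bump n l r (y + s *\<^sub>R e) = A y * \<zeta> e (y \<bullet> e + s)" for y s
    using e A[of y s] unfolding box_bump_def A_def \<zeta>_def
    by (subst prod.remove[of Basis e]) (auto simp: inner_add_left)
  have smooth: "C_inf \<Phi>"
  proof -
    have "C_inf (\<lambda>y. \<zeta> b (0 + y \<bullet> b))" for b :: 'a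
      unfolding \<zeta>_def by (intro C_inf_affine C_inf_bump)
    moreover have "C_inf Z" using Z by (rule C_inf_DERIV) (simp add: \<zeta>_def C_inf_bump)
    ultimately show ?thesis
      unfolding \<Phi>_def[abs_def] A_def by (intro C_inf_mult C_inf_diff C_inf_affine C_inf_prod) simp
  qed
  moreover have "\<Phi> y = (\<integral>s. indicator {0..h} s * box_bump n l r (y - s *\<^sub>R e) \<partial>lborel)" for y
  proof -
    have "(\<integral>s. \<zeta> e (y \<bullet> e - s) * indicator {0..h} s \<partial>lborel) = - Z (y \<bullet> e - h) - - Z (y \<bullet> e - 0)"
    proof (rule integral_FTC_Icc_real[OF h])
      show "((\<lambda>s. - Z (y \<bullet> e - s)) has_real_derivative \<zeta> e (y \<bullet> e - s)) (at s)" for s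
        by (auto intro!: derivative_eq_intros DERIV_chain2[OF Z])
      show "isCont (\<lambda>s. \<zeta> e (y \<bullet> e - s)) s" for s
        using C_inf_continuous[OF C_inf_bump, of UNIV n "l \<bullet> e" "r \<bullet> e"] unfolding \<zeta>_def
        by (intro continuous_intros isCont_o2[of s "\<lambda>s. y \<bullet> e - s"]) (auto simp: continuous_on_eq_continuous_at)
    qed
    moreover have "(\<integral>s. indicator {0..h} s * box_bump n l r (y - s *\<^sub>R e) \<partial>lborel)
        = (\<integral>s. A y * (\<zeta> e (y \<bullet> e - s) * indicator {0..h} s) \<partial>lborel)"
      using bb[of y "- _"] by (intro Bochner_Integration.integral_cong) auto
    ultimately show ?thesis by (simp add: \<Phi>_def)
  qed
  moreover have "frechet_derivative \<Phi> (at y) e = box_bump n l r y - box_bump n l r (y - h *\<^sub>R e)" for y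
  proof -
    have "(\<Phi> has_derivative frechet_derivative \<Phi> (at y)) (at (y + 0 *\<^sub>R e))"
      using C_inf_differentiable[OF smooth, of y] by (simp add: frechet_derivative_works)
    moreover have "((\<lambda>s. y + s *\<^sub>R e) has_derivative (\<lambda>s. s *\<^sub>R e)) (at 0)"
      by (auto intro!: derivative_eq_intros)
    ultimately have "((\<lambda>s. \<Phi> (y + s *\<^sub>R e)) has_derivative (\<lambda>s. frechet_derivative \<Phi> (at y) (s *\<^sub>R e))) (at 0)"
      using has_derivative_compose by blast
    moreover have "\<Phi> (y + s *\<^sub>R e) = A y * (Z (y \<bullet> e + s) - Z (y \<bullet> e + s - h))" for s
      using e A[of y s] by (simp add: \<Phi>_def inner_add_left algebra_simps)
    moreover have "((\<lambda>s. A y * (Z (y \<bullet> e + s) - Z (y \<bullet> e + s - h))) has_real_derivative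
        A y * (\<zeta> e (y \<bullet> e + 0) - \<zeta> e (y \<bullet> e + 0 - h))) (at 0)"
      by (auto intro!: derivative_eq_intros DERIV_chain2[OF Z])
    ultimately have "frechet_derivative \<Phi> (at y) (1 *\<^sub>R e) = A y * (\<zeta> e (y \<bullet> e + 0) - \<zeta> e (y \<bullet> e + 0 - h))"
      unfolding has_field_derivative_def using has_derivative_unique by (metis (no_types, lifting) mult_cancel_left2 ext)
    then show ?thesis using bb[of y 0] bb[of y "-h"] by (simp add: right_diff_distrib)
  qed
  ultimately show ?thesis using that by blast
qed

section \<open>Weak derivatives along lines\<close>

lemma locally_integrable_lborel:
  fixes f :: "'a::euclidean_space \<Rightarrow> real"
  assumes "locally_integrable f U" "f \<in> borel_measurable borel" "compact K" "K \<subseteq> U"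
  shows "integrable lborel (\<lambda>x. indicator K x * f x)"
proof -
  have K: "K \<in> sets borel" using assms(3) by (simp add: borel_closed compact_imp_closed)
  have "integrable lebesgue (\<lambda>x. indicator K x * f x)"
    using assms by (auto simp: locally_integrable_def set_integrable_def)
  moreover have "(\<lambda>x. indicator K x * f x) \<in> borel_measurable lborel"
    using K assms(2) by simp
  ultimately show ?thesis by (simp add: integrable_completion)
qed

text \<open>Testing with the primitive of translated bumps puts the same bump \<open>\<rho>\<close>
  in front of both sides: the integral of \<open>\<rho>\<close> times
  \<open>f (y + h e) - f y - G y\<close> is 0, where \<open>G y\<close> integrates \<open>g\<close>
  along the segment. Letting the bumps tend to indicators of boxes yields
  \<open>f (y + h e) - f y = G y\<close> almost everywhere, and the bound follows.\<close>

lemma weak_deriv_difference: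
  fixes f g :: "'a::euclidean_space \<Rightarrow> real"
  assumes wd: "has_weak_deriv f e g U" and U: "open U"
    and [measurable]: "f \<in> borel_measurable borel" "g \<in> borel_measurable borel"
    and e: "e \<in> Basis" and h: "0 \<le> h" and K: "cbox L (R + h *\<^sub>R e) \<subseteq> U"
  shows "AE y in lborel. y \<in> box L R \<longrightarrow>
    ennreal \<bar>f (y + h *\<^sub>R e) - f y\<bar> \<le> (\<integral>\<^sup>+s\<in>{0..h}. ennreal \<bar>g (y + s *\<^sub>R e)\<bar> \<partial>lborel)"
proof -
  \<comment> \<open>\<open>K\<close> contains the segment from \<open>y\<close> to
    \<open>y + h *\<^sub>R e\<close> for every \<open>y\<close> in the box. Cutting off at
    \<open>K\<close> makes the locally integrable \<open>f\<close> and \<open>g\<close> integrable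
    on the whole space and changes nothing seen from the box.\<close>
  define K where "K = cbox L (R + h *\<^sub>R e)"
  have K_cpt: "compact K" "K \<subseteq> U" "K \<in> sets borel" using K by (auto simp: K_def)
  note [measurable] = K_cpt(3)
  have shift: "y + s *\<^sub>R e \<in> K" if "y \<in> box L R" "0 \<le> s" "s \<le> h" for y s
  proof -
    have "0 \<le> s * (e \<bullet> b)" "s * (e \<bullet> b) \<le> h * (e \<bullet> b)" if "b \<in> Basis" for b
      using that e \<open>0 \<le> s\<close> \<open>s \<le> h\<close> by (auto simp: inner_Basis)
    with that(1) show ?thesis
      by (fastforce simp: K_def mem_box inner_add_left dest: bspec)
  qed
  define fK where "fK y = indicator K y * f y" for y
  define gK where "gK y = indicator K y * g y" for y
  have [measurable]: "fK \<in> borel_measurable borel" "gK \<in> borel_measurable borel"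
    unfolding fK_def[abs_def] gK_def[abs_def] by measurable
  have fK: "integrable lborel fK" and gK: "integrable lborel gK"
    using wd K_cpt unfolding fK_def[abs_def] gK_def[abs_def] has_weak_deriv_def
    by (auto intro: locally_integrable_lborel)
  have tr: "integrable lborel (\<lambda>y. H (y + c))" "(\<integral>y. H (y + c) \<partial>lborel) = (\<integral>y. H y \<partial>lborel)"
    if "integrable lborel H" for H :: "'a \<Rightarrow> real" and c
  proof -
    have [measurable]: "H \<in> borel_measurable borel" using that by auto
    have eq: "(lborel :: 'a measure) = distr lborel borel ((+) c)" by (simp add: lborel_distr_plus)
    have "integrable (distr lborel borel ((+) c)) H" using that eq by simp
    then show "integrable lborel (\<lambda>y. H (y + c))"
      by (subst (asm) integrable_distr_eq) (auto simp: add.commute)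
    have "(\<integral>y. H y \<partial>lborel) = (\<integral>y. H y \<partial>distr lborel borel ((+) c))" using eq by simp
    also have "\<dots> = (\<integral>y. H (c + y) \<partial>lborel)" by (subst integral_distr) auto
    finally show "(\<integral>y. H (y + c) \<partial>lborel) = (\<integral>y. H y \<partial>lborel)" by (simp add: add.commute)
  qed
  define G where "G y = (\<integral>s. indicator {0..h} s * gK (y + s *\<^sub>R e) \<partial>lborel)" for y
  \<comment> \<open>The weight \<open>w\<close> is 1 when \<open>G\<close> is shown to be integrable
    and the bump when the order of integration is exchanged.\<close>
  have int2: "integrable (lborel \<Otimes>\<^sub>M lborel) (\<lambda>(y, s). w y * (indicator {0..h} s * gK (y + s *\<^sub>R e)))"
    if w [measurable]: "w \<in> borel_measurable borel" and wb: "\<And>y. \<bar>w y\<bar> \<le> 1" for w :: "'a \<Rightarrow> real"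
  proof (rule integrableI_bounded)
    show "(\<lambda>(y, s). w y * (indicator {0..h} s * gK (y + s *\<^sub>R e))) \<in> borel_measurable (lborel \<Otimes>\<^sub>M lborel)"
      by measurable
    have "(\<integral>\<^sup>+x. ennreal (norm (case x of (y, s) \<Rightarrow> w y * (indicator {0..h} s * gK (y + s *\<^sub>R e)))) \<partial>(lborel \<Otimes>\<^sub>M lborel))
      \<le> (\<integral>\<^sup>+(y, s). indicator {0..h} s * ennreal \<bar>gK (y + s *\<^sub>R e)\<bar> \<partial>(lborel \<Otimes>\<^sub>M lborel))"
      using wb by (intro nn_integral_mono) (auto simp: abs_mult indicator_def intro!: ennreal_leI mult_left_le_one_le)
    also have "\<dots> = (\<integral>\<^sup>+s. (\<integral>\<^sup>+y. indicator {0..h} s * ennreal \<bar>gK (y + s *\<^sub>R e)\<bar> \<partial>lborel) \<partial>lborel)"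
      by (subst lborel_pair.nn_integral_snd[symmetric]) auto
    also have "\<dots> = (\<integral>\<^sup>+s. indicator {0..h} s * (\<integral>\<^sup>+y. ennreal \<bar>gK y\<bar> \<partial>lborel) \<partial>lborel)"
      by (intro nn_integral_cong)
        (simp add: nn_integral_cmult nn_integral_lborel_translate[of "\<lambda>y. ennreal \<bar>gK y\<bar>"])
    also have "\<dots> = ennreal h * (\<integral>\<^sup>+y. ennreal \<bar>gK y\<bar> \<partial>lborel)"
      using h by (subst nn_integral_multc) auto
    also have "\<dots> < \<infinity>" using gK by (auto simp: integrable_iff_bounded ennreal_mult_less_top)
    finally show "(\<integral>\<^sup>+x. ennreal (norm (case x of (y, s) \<Rightarrow> w y * (indicator {0..h} s * gK (y + s *\<^sub>R e)))) \<partial>(lborel \<Otimes>\<^sub>M lborel)) < \<infinity>" .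
  qed
  have G: "integrable lborel G"
    using lborel_pair.integrable_fst'[OF int2[of "\<lambda>_. 1"]] by (simp add: G_def[abs_def])
  note [measurable] = borel_measurable_integrable[OF G, simplified]
  define F where "F y = indicator (box L R) y * (fK (y + h *\<^sub>R e) - fK y - G y)" for y
  have FF: "integrable lborel (\<lambda>y. fK (y + h *\<^sub>R e) - fK y - G y)"
    using fK G tr(1)[OF fK] by auto
  then have F: "integrable lborel F"
    unfolding F_def using integrable_mult_indicator[OF _ FF, of "box L R"] by simp
  have *: "(\<integral>y. box_bump n l r y * (fK (y + h *\<^sub>R e) - fK y - G y) \<partial>lborel) = 0"
    if lr: "box l r \<subseteq> box L R" for l r n
  proof -
    define \<rho> where "\<rho> = (box_bump n l r :: 'a \<Rightarrow> real)"
    have [measurable]: "\<rho> \<in> borel_measurable borel" by (simp add: \<rho>_def)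
    have \<rho>: "0 \<le> \<rho> y" "\<rho> y \<le> 1" "\<bar>\<rho> y\<bar> \<le> 1" for y
      using box_bump_bounds[of n l r y] by (auto simp: \<rho>_def)
    have \<rho>_int: "integrable lborel (\<lambda>y. \<rho> (y + c) * H y)" if "integrable lborel H" for H c
      by (rule Bochner_Integration.integrable_bound[OF that])
        (use that \<rho> in \<open>auto simp: abs_mult intro!: mult_left_le_one_le\<close>)
    obtain \<Phi> where smooth: "C_inf \<Phi>"
      and \<Phi>: "\<And>y. \<Phi> y = (\<integral>s. indicator {0..h} s * \<rho> (y - s *\<^sub>R e) \<partial>lborel)"
      and D: "\<And>y. frechet_derivative \<Phi> (at y) e = \<rho> y - \<rho> (y - h *\<^sub>R e)"
      using translated_bump_primitive[OF e h] unfolding \<rho>_def by blast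
    have supp\<rho>: "y \<in> K" if "\<rho> (y - s *\<^sub>R e) \<noteq> 0" "0 \<le> s" "s \<le> h" for y s
      using box_bump_eq_0[of "y - s *\<^sub>R e" l r n] lr shift[of "y - s *\<^sub>R e" s] that by (auto simp: \<rho>_def)
    have supp\<Phi>: "y \<in> K" if "\<Phi> y \<noteq> 0" for y
    proof (rule ccontr)
      assume "y \<notin> K"
      then have "(\<lambda>s. indicator {0..h} s * \<rho> (y - s *\<^sub>R e)) = (\<lambda>s. 0)"
        using supp\<rho> by (fastforce simp: indicator_def)
      with that show False by (simp add: \<Phi>)
    qed
    have "closure {x. \<Phi> x \<noteq> 0} \<subseteq> K"
      using supp\<Phi> K_cpt by (intro closure_minimal) (auto simp: compact_imp_closed)
    then have "test_fun U \<Phi>"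
      using smooth K_cpt unfolding test_fun_def
      by (meson bounded_subset closed_closure compact_eq_bounded_closed order_trans)
    then have test: "(LINT x:U|lebesgue. f x * frechet_derivative \<Phi> (at x) e) = - (LINT x:U|lebesgue. g x * \<Phi> x)"
      using wd by (auto simp: has_weak_deriv_def)
    have [measurable]: "\<Phi> \<in> borel_measurable borel"
      using smooth by (intro borel_measurable_continuous_onI C_inf_continuous)
    have [measurable]: "U \<in> sets borel" using U by simp
    have "(LINT x:U|lebesgue. f x * frechet_derivative \<Phi> (at x) e) = (\<integral>x. indicator U x *\<^sub>R (f x * (\<rho> x - \<rho> (x - h *\<^sub>R e))) \<partial>lborel)"
      unfolding set_lebesgue_integral_def D by (rule integral_completion) measurable
    also have "\<dots> = (\<integral>x. (\<rho> x - \<rho> (x - h *\<^sub>R e)) * fK x \<partial>lborel)"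
    proof (intro Bochner_Integration.integral_cong refl)
      fix x
      have "\<rho> x - \<rho> (x - h *\<^sub>R e) = 0" if "x \<notin> K"
        using supp\<rho>[of x 0] supp\<rho>[of x h] h that by (cases "\<rho> x = 0"; cases "\<rho> (x - h *\<^sub>R e) = 0") auto
      then show "indicator U x *\<^sub>R (f x * (\<rho> x - \<rho> (x - h *\<^sub>R e))) = (\<rho> x - \<rho> (x - h *\<^sub>R e)) * fK x"
        using K_cpt(2) by (cases "x \<in> K") (auto simp: fK_def)
    qed
    also have "\<dots> = (\<integral>x. \<rho> (x + 0) * fK x - \<rho> (x + - h *\<^sub>R e) * fK x \<partial>lborel)"
      by (simp add: algebra_simps)
    also have "\<dots> = (\<integral>x. \<rho> (x + 0) * fK x \<partial>lborel) - (\<integral>x. \<rho> (x + - h *\<^sub>R e) * fK x \<partial>lborel)"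
      by (rule Bochner_Integration.integral_diff[OF \<rho>_int[OF fK] \<rho>_int[OF fK]])
    also have "(\<integral>x. \<rho> (x + - h *\<^sub>R e) * fK x \<partial>lborel) = (\<integral>x. \<rho> x * fK (x + h *\<^sub>R e) \<partial>lborel)"
      using tr(2)[OF \<rho>_int[OF fK, of "- h *\<^sub>R e"], of "h *\<^sub>R e"] by simp
    finally have lhs: "(LINT x:U|lebesgue. f x * frechet_derivative \<Phi> (at x) e)
        = (\<integral>x. \<rho> x * fK x \<partial>lborel) - (\<integral>x. \<rho> x * fK (x + h *\<^sub>R e) \<partial>lborel)" by simp
    have "(LINT x:U|lebesgue. g x * \<Phi> x) = (\<integral>x. indicator U x *\<^sub>R (g x * \<Phi> x) \<partial>lborel)"
      unfolding set_lebesgue_integral_def by (rule integral_completion) measurable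
    also have "\<dots> = (\<integral>x. gK x * \<Phi> x \<partial>lborel)"
      using K_cpt(2) supp\<Phi>
      by (intro Bochner_Integration.integral_cong refl) (auto simp: gK_def indicator_def)
    also have "\<dots> = (\<integral>x. (\<integral>s. gK x * (indicator {0..h} s * \<rho> (x - s *\<^sub>R e)) \<partial>lborel) \<partial>lborel)"
      by (simp add: \<Phi>)
    also have "\<dots> = (\<integral>s. (\<integral>x. gK x * (indicator {0..h} s * \<rho> (x - s *\<^sub>R e)) \<partial>lborel) \<partial>lborel)"
    proof (rule lborel_pair.Fubini_integral[symmetric], rule integrableI_bounded)
      show "(\<lambda>(x, s). gK x * (indicator {0..h} s * \<rho> (x - s *\<^sub>R e))) \<in> borel_measurable (lborel \<Otimes>\<^sub>M lborel)"
        by measurable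
      have "(\<integral>\<^sup>+x. ennreal (norm (case x of (x, s) \<Rightarrow> gK x * (indicator {0..h} s * \<rho> (x - s *\<^sub>R e)))) \<partial>(lborel \<Otimes>\<^sub>M lborel))
        \<le> (\<integral>\<^sup>+(x, s). ennreal \<bar>gK x\<bar> * indicator {0..h} s \<partial>(lborel \<Otimes>\<^sub>M lborel))"
        using \<rho> by (intro nn_integral_mono) (auto simp: abs_mult indicator_def intro!: ennreal_leI mult_left_le)
      also have "\<dots> = (\<integral>\<^sup>+x. (\<integral>\<^sup>+s. ennreal \<bar>gK x\<bar> * indicator {0..h} s \<partial>lborel) \<partial>lborel)"
        by (subst lborel.nn_integral_fst[symmetric]) auto
      also have "\<dots> = (\<integral>\<^sup>+x. ennreal \<bar>gK x\<bar> * ennreal h \<partial>lborel)"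
        using h by (intro nn_integral_cong) (simp add: nn_integral_cmult_indicator)
      also have "\<dots> = (\<integral>\<^sup>+x. ennreal \<bar>gK x\<bar> \<partial>lborel) * ennreal h" by (intro nn_integral_multc) measurable
      also have "\<dots> < \<infinity>" using gK by (auto simp: integrable_iff_bounded ennreal_mult_less_top)
      finally show "(\<integral>\<^sup>+x. ennreal (norm (case x of (x, s) \<Rightarrow> gK x * (indicator {0..h} s * \<rho> (x - s *\<^sub>R e)))) \<partial>(lborel \<Otimes>\<^sub>M lborel)) < \<infinity>" .
    qed
    \<comment> \<open>Translation by \<open>s *\<^sub>R e\<close> moves the shift from the bump to
      \<open>gK\<close>, as it did for \<open>fK\<close> in \<open>lhs\<close>.\<close>
    also have "\<dots> = (\<integral>s. (\<integral>x. \<rho> x * (indicator {0..h} s * gK (x + s *\<^sub>R e)) \<partial>lborel) \<partial>lborel)"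
    proof (rule Bochner_Integration.integral_cong[OF refl])
      fix s :: real
      have "integrable lborel (\<lambda>x. indicator {0..h} s * (\<rho> (x + - s *\<^sub>R e) * gK x))"
        by (rule integrable_mult_right) (rule \<rho>_int[OF gK])
      from tr(2)[OF this, of "s *\<^sub>R e"]
      show "(\<integral>x. gK x * (indicator {0..h} s * \<rho> (x - s *\<^sub>R e)) \<partial>lborel) = (\<integral>x. \<rho> x * (indicator {0..h} s * gK (x + s *\<^sub>R e)) \<partial>lborel)"
        by (simp add: ac_simps)
    qed
    also have "\<dots> = (\<integral>x. (\<integral>s. \<rho> x * (indicator {0..h} s * gK (x + s *\<^sub>R e)) \<partial>lborel) \<partial>lborel)"
      by (rule lborel_pair.Fubini_integral[OF int2]) (use \<rho> in auto)
    also have "\<dots> = (\<integral>x. \<rho> x * G x \<partial>lborel)" by (simp add: G_def)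
    finally have rhs: "(LINT x:U|lebesgue. g x * \<Phi> x) = (\<integral>x. \<rho> x * G x \<partial>lborel)" .
    note i1 = \<rho>_int[OF tr(1)[OF fK], of 0 "h *\<^sub>R e"] and i2 = \<rho>_int[OF fK, of 0] and i3 = \<rho>_int[OF G, of 0]
    from Bochner_Integration.integral_diff[OF Bochner_Integration.integrable_diff[OF i1 i2] i3]
      Bochner_Integration.integral_diff[OF i1 i2]
    have "(\<integral>y. \<rho> y * fK (y + h *\<^sub>R e) - \<rho> y * fK y - \<rho> y * G y \<partial>lborel)
      = (\<integral>y. \<rho> y * fK (y + h *\<^sub>R e) \<partial>lborel) - (\<integral>y. \<rho> y * fK y \<partial>lborel) - (\<integral>y. \<rho> y * G y \<partial>lborel)"
      by simp
    with lhs rhs test show ?thesis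
      by (simp add: \<rho>_def right_diff_distrib)
  qed
  have box0: "(\<integral>y. indicator (box l r) y * (fK (y + h *\<^sub>R e) - fK y - G y) \<partial>lborel) = 0"
    if "box l r \<subseteq> box L R" for l r
  proof -
    have "(\<lambda>n. \<integral>y. box_bump n l r y * (fK (y + h *\<^sub>R e) - fK y - G y) \<partial>lborel)
      \<longlonglongrightarrow> (\<integral>y. indicator (box l r) y * (fK (y + h *\<^sub>R e) - fK y - G y) \<partial>lborel)"
    proof (rule integral_dominated_convergence)
      show "integrable lborel (\<lambda>y. \<bar>fK (y + h *\<^sub>R e) - fK y - G y\<bar>)" using FF by simp
      show "AE y in lborel. (\<lambda>n. box_bump n l r y * (fK (y + h *\<^sub>R e) - fK y - G y))
          \<longlonglongrightarrow> indicator (box l r) y * (fK (y + h *\<^sub>R e) - fK y - G y)"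
        by (intro AE_I2 tendsto_mult box_bump_tendsto tendsto_const)
    qed (use FF box_bump_bounds[of _ l r] in \<open>auto simp: abs_mult mult_left_le_one_le\<close>)
    then show ?thesis using *[OF that] by (simp add: LIMSEQ_const_iff)
  qed
  have "AE y in lborel. F y = 0"
  proof (rule AE_eq_0_if_box_integrals_0[OF F])
    fix l r :: 'a
    obtain l' r' :: 'a where lr': "box l r \<inter> box L R = box l' r'" using box_Int_box by blast
    have "(\<lambda>y. indicator (box l r) y * F y) = (\<lambda>y. indicator (box l' r') y * (fK (y + h *\<^sub>R e) - fK y - G y))"
      unfolding lr'[symmetric] F_def by (simp add: indicator_inter_arith mult.assoc)
    moreover have "box l' r' \<subseteq> box L R" using lr' by blast
    ultimately show "(\<integral>x. indicator (box l r) x * F x \<partial>lborel) = 0" using box0 by simp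
  qed
  then show ?thesis
  proof eventually_elim
    case (elim y)
    show ?case
    proof
      assume y: "y \<in> box L R"
      then have "fK (y + h *\<^sub>R e) - fK y - G y = 0"
        using elim unfolding F_def by simp
      moreover have "fK y = f y" "fK (y + h *\<^sub>R e) = f (y + h *\<^sub>R e)"
        using shift[OF y, of 0] shift[OF y, of h] h unfolding fK_def by simp_all
      ultimately have "f (y + h *\<^sub>R e) - f y = G y" by linarith
      also have "G y = (\<integral>s. indicator {0..h} s * g (y + s *\<^sub>R e) \<partial>lborel)"
        unfolding G_def using shift[OF y]
        by (intro Bochner_Integration.integral_cong) (auto simp: gK_def indicator_def)
      \<comment> \<open>The Bochner integral of a function that is not integrable is 0, so the bound
        persists in that case.\<close>
      also have "ennreal \<bar>\<dots>\<bar> \<le> (\<integral>\<^sup>+s. ennreal \<bar>indicator {0..h} s * g (y + s *\<^sub>R e)\<bar> \<partial>lborel)"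
        using integral_norm_bound_ennreal[of lborel "\<lambda>s. indicator {0..h} s * g (y + s *\<^sub>R e)"]
        by (cases "integrable lborel (\<lambda>s. indicator {0..h} s * g (y + s *\<^sub>R e))")
          (auto simp: not_integrable_integral_eq)
      also have "\<dots> = (\<integral>\<^sup>+s\<in>{0..h}. ennreal \<bar>g (y + s *\<^sub>R e)\<bar> \<partial>lborel)"
        by (intro nn_integral_cong) (auto simp: indicator_def)
      finally show "ennreal \<bar>f (y + h *\<^sub>R e) - f y\<bar> \<le> \<dots>" .
    qed
  qed
qed

text \<open>For fixed \<open>h\<close> the points \<open>y\<close> with \<open>y\<close> and
  \<open>y + h e\<close> in \<open>U\<close> form an open set, which countably many boxes cover.
  This gives the bound for every \<open>h\<close> outside a null set of \<open>y\<close> that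
  depends on \<open>h\<close>; Fubini's theorem for null sets exchanges the quantifiers.\<close>

lemma weak_deriv_line:
  fixes f g :: "'a::euclidean_space \<Rightarrow> real"
  assumes wd: "has_weak_deriv f e g U" and U: "open U" "convex U"
    and [measurable]: "f \<in> borel_measurable borel" "g \<in> borel_measurable borel"
    and e: "e \<in> Basis"
  shows "AE y in lborel. AE h in lborel. y \<in> U \<longrightarrow> y + h *\<^sub>R e \<in> U \<longrightarrow>
    ennreal \<bar>f (y + h *\<^sub>R e) - f y\<bar> \<le> (\<integral>\<^sup>+s\<in>closed_segment 0 h. ennreal \<bar>g (y + s *\<^sub>R e)\<bar> \<partial>lborel)"
    (is "AE y in lborel. AE h in lborel. ?D y h")
proof -
  have pos: "AE y in lborel. ?D y h" if h: "0 \<le> h" for h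
  proof -
    have "open (U \<inter> (\<lambda>y. y + h *\<^sub>R e) -` U)"
      using U by (intro open_Int open_vimage continuous_intros)
    then obtain \<D> where \<D>: "countable \<D>" "\<D> \<subseteq> Pow (U \<inter> (\<lambda>y. y + h *\<^sub>R e) -` U)"
      "\<And>X. X \<in> \<D> \<Longrightarrow> \<exists>a b. X = cbox a b" "\<Union>\<D> = U \<inter> (\<lambda>y. y + h *\<^sub>R e) -` U"
      using open_countable_Union_open_cbox by metis
    have "AE y in lborel. y \<in> X \<longrightarrow> ?D y h" if X: "X \<in> \<D>" for X
    proof -
      obtain L R where LR: "X = cbox L R" using \<D>(3)[OF X] by blast
      have sub: "y \<in> U" "y + h *\<^sub>R e \<in> U" if "y \<in> cbox L R" for y
        using \<D>(2) X LR that by auto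
      \<comment> \<open>A point \<open>z\<close> of the swept box comes from some
        \<open>z - s *\<^sub>R e\<close> in \<open>cbox L R\<close> with
        \<open>0 \<le> s \<le> h\<close>. That point and its translate by \<open>h\<close> lie in
        \<open>U\<close>, and convexity covers \<open>z\<close> between them.\<close>
      have "cbox L (R + h *\<^sub>R e) \<subseteq> U" if ne: "cbox L R \<noteq> {}"
      proof
        fix z assume z: "z \<in> cbox L (R + h *\<^sub>R e)"
        define s where "s = max 0 (z \<bullet> e - R \<bullet> e)"
        have "R \<bullet> e - L \<bullet> e \<ge> 0" using ne e by (auto simp: box_ne_empty)
        moreover have "z \<bullet> e \<le> R \<bullet> e + h" "L \<bullet> e \<le> z \<bullet> e"
          using z e by (auto simp: mem_box inner_add_left)
        moreover have "L \<bullet> b \<le> z \<bullet> b \<and> z \<bullet> b \<le> R \<bullet> b" if "b \<in> Basis" "b \<noteq> e" for b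
          using z e that by (auto simp: mem_box inner_add_left inner_Basis dest!: bspec[of _ _ b])
        ultimately have y: "z - s *\<^sub>R e \<in> cbox L R" and s: "0 \<le> s" "s \<le> h"
          using e h by (auto simp: mem_box inner_diff_left inner_Basis s_def)
        show "z \<in> U"
        proof (cases "h = 0")
          case True
          then show ?thesis using s sub[OF y] by simp
        next
          case False
          have "(1 - s / h) *\<^sub>R (z - s *\<^sub>R e) + (s / h) *\<^sub>R (z - s *\<^sub>R e + h *\<^sub>R e) \<in> U"
            using U(2) sub[OF y] s False h by (intro convexD) auto
          then show ?thesis using False by (simp add: algebra_simps)
        qed
      qed
      then have "AE y in lborel. y \<in> box L R \<longrightarrow> ennreal \<bar>f (y + h *\<^sub>R e) - f y\<bar>
          \<le> (\<integral>\<^sup>+s\<in>{0..h}. ennreal \<bar>g (y + s *\<^sub>R e)\<bar> \<partial>lborel)"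
        using box_subset_cbox[of L R] by (cases "cbox L R = {}")
          (auto intro!: weak_deriv_difference[OF wd U(1) _ _ e h])
      moreover have "AE y in lborel. y \<notin> cbox L R - box L R"
      proof (rule AE_not_in)
        have "cbox L R - box L R \<in> null_sets lebesgue"
          using negligible_frontier_interval negligible_iff_null_sets by blast
        then show "cbox L R - box L R \<in> null_sets lborel"
          by (simp add: null_sets_completion_iff)
      qed
      ultimately show ?thesis
        by eventually_elim (use LR h in \<open>auto simp: closed_segment_eq_real_ivl\<close>)
    qed
    then have "AE y in lborel. \<forall>X\<in>\<D>. y \<in> X \<longrightarrow> ?D y h"
      by (subst AE_ball_countable[OF \<D>(1)]) blast
    then show ?thesis
      by eventually_elim (use \<D>(4) in blast)
  qed
  have all: "AE y in lborel. ?D y h" for h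
  proof (cases "0 \<le> h")
    case False
    \<comment> \<open>A negative step is a positive one read from the other end of the
      segment.\<close>
    have "AE y in lborel. ?D (y + h *\<^sub>R e) (- h)"
      by (rule AE_lborel_translate[OF pos]) (use False in simp)
    then show ?thesis
    proof eventually_elim
      case (elim y)
      have "(\<integral>\<^sup>+s\<in>closed_segment 0 (-h). ennreal \<bar>g (y + h *\<^sub>R e + s *\<^sub>R e)\<bar> \<partial>lborel)
         = (\<integral>\<^sup>+s\<in>closed_segment 0 h. ennreal \<bar>g (y + s *\<^sub>R e)\<bar> \<partial>lborel)"
        using False
        by (subst nn_integral_lborel_translate[of "\<lambda>s. ennreal \<bar>g (y + s *\<^sub>R e)\<bar> * indicator (closed_segment 0 h) s" h, symmetric])
          (auto simp: closed_segment_eq_real_ivl algebra_simps indicator_def intro!: nn_integral_cong)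
      with elim show ?case by (simp add: abs_minus_commute add.assoc)
    qed
  qed (rule pos)
  have [measurable]: "U \<in> sets borel" using U by simp
  \<comment> \<open>Written with inequalities, the integrand is visibly measurable jointly in
    \<open>y\<close>, \<open>h\<close> and \<open>s\<close>, as the exchange of quantifiers
    demands.\<close>
  have eq: "?D y h \<longleftrightarrow> (y \<in> U \<longrightarrow> y + h *\<^sub>R e \<in> U \<longrightarrow> ennreal \<bar>f (y + h *\<^sub>R e) - f y\<bar> \<le>
     (\<integral>\<^sup>+s. (if 0 \<le> s \<and> s \<le> h \<or> h \<le> s \<and> s \<le> 0 then ennreal \<bar>g (y + s *\<^sub>R e)\<bar> else 0) \<partial>lborel))" (is "_ = ?D' y h") for y h
  proof -
    have "(\<integral>\<^sup>+s\<in>closed_segment 0 h. ennreal \<bar>g (y + s *\<^sub>R e)\<bar> \<partial>lborel) =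
      (\<integral>\<^sup>+s. (if 0 \<le> s \<and> s \<le> h \<or> h \<le> s \<and> s \<le> 0 then ennreal \<bar>g (y + s *\<^sub>R e)\<bar> else 0) \<partial>lborel)"
      by (intro nn_integral_cong) (auto simp: closed_segment_eq_real_ivl indicator_def)
    then show ?thesis by simp
  qed
  have "AE h in lborel. AE y in lborel. ?D' y h" using all unfolding eq by simp
  then have "AE y in lborel. AE h in lborel. ?D' y h"
    by (subst lborel_pair.AE_commute) measurable
  then show ?thesis unfolding eq .
qed

text \<open>\<open>line_int e F\<close> is constant along \<open>e\<close>, so its integral over the
  whole space is 0 or infinite. Over a slab of width \<open>2 * m\<close> it is comparable with the
  integral of \<open>F\<close>, and statements about almost every line can be drawn from
  integrals.\<close>

lemma slab_line_int:
  fixes F :: "'a::euclidean_space \<Rightarrow> ennreal"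
  assumes [measurable]: "F \<in> borel_measurable borel" and e: "e \<in> Basis" and m: "0 \<le> m"
  shows "(\<integral>\<^sup>+y. indicator {- m..m} (y \<bullet> e) * line_int e F y \<partial>lborel) = ennreal (2 * m) * (\<integral>\<^sup>+y. F y \<partial>lborel)"
proof -
  have "(\<integral>\<^sup>+y. indicator {- m..m} (y \<bullet> e) * line_int e F y \<partial>lborel)
      = (\<integral>\<^sup>+y. (\<integral>\<^sup>+s. indicator {- m..m} (y \<bullet> e) * F (y + s *\<^sub>R e) \<partial>lborel) \<partial>lborel)"
    unfolding line_int_def by (subst nn_integral_cmult) auto
  also have "\<dots> = (\<integral>\<^sup>+s. (\<integral>\<^sup>+y. indicator {- m..m} (y \<bullet> e) * F (y + s *\<^sub>R e) \<partial>lborel) \<partial>lborel)"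
    by (rule lborel_pair.Fubini'[symmetric]) measurable
  also have "\<dots> = (\<integral>\<^sup>+s. (\<integral>\<^sup>+y. indicator {- m..m} (y \<bullet> e - s) * F y \<partial>lborel) \<partial>lborel)"
  proof (rule nn_integral_cong)
    fix s
    show "(\<integral>\<^sup>+y. indicator {- m..m} (y \<bullet> e) * F (y + s *\<^sub>R e) \<partial>lborel) = (\<integral>\<^sup>+y. indicator {- m..m} (y \<bullet> e - s) * F y \<partial>lborel)"
      using e by (subst nn_integral_lborel_translate[of "\<lambda>y. indicator {- m..m} (y \<bullet> e - s) * F y" "s *\<^sub>R e", symmetric])
        (auto simp: inner_add_left)
  qed
  also have "\<dots> = (\<integral>\<^sup>+y. (\<integral>\<^sup>+s. indicator {- m..m} (y \<bullet> e - s) * F y \<partial>lborel) \<partial>lborel)"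
    by (rule lborel_pair.Fubini') measurable
  also have "\<dots> = (\<integral>\<^sup>+y. ennreal (2 * m) * F y \<partial>lborel)"
  proof (rule nn_integral_cong)
    fix y
    have "(\<integral>\<^sup>+s. indicator {- m..m} (y \<bullet> e - s) * F y \<partial>lborel)
        = (\<integral>\<^sup>+s. F y * indicator {y \<bullet> e - m..y \<bullet> e + m} s \<partial>lborel)"
      by (intro nn_integral_cong) (auto simp: indicator_def)
    then show "(\<integral>\<^sup>+s. indicator {- m..m} (y \<bullet> e - s) * F y \<partial>lborel) = ennreal (2 * m) * F y"
      using m by (simp add: nn_integral_cmult_indicator mult.commute)
  qed
  also have "\<dots> = ennreal (2 * m) * (\<integral>\<^sup>+y. F y \<partial>lborel)" by (rule nn_integral_cmult) measurable
  finally show ?thesis .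
qed

lemma AE_if_AE_slab:
  fixes e :: "'a::euclidean_space"
  assumes "\<And>m. AE y in lborel. \<bar>y \<bullet> e\<bar> \<le> real m \<longrightarrow> P y"
  shows "AE y in lborel. P y"
proof -
  have "AE y in lborel. \<forall>m::nat. \<bar>y \<bullet> e\<bar> \<le> real m \<longrightarrow> P y"
    unfolding AE_all_countable using assms by blast
  then show ?thesis
    by eventually_elim (use real_arch_simple in blast)
qed

lemma AE_line_int_finite:
  fixes F :: "'a::euclidean_space \<Rightarrow> ennreal"
  assumes [measurable]: "F \<in> borel_measurable borel" and e: "e \<in> Basis" and fin: "(\<integral>\<^sup>+y. F y \<partial>lborel) < \<infinity>"
  shows "AE y in lborel. line_int e F y < \<infinity>"
proof (rule AE_if_AE_slab)
  fix m :: nat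
  have "(\<integral>\<^sup>+y. indicator {- real m..real m} (y \<bullet> e) * line_int e F y \<partial>lborel) \<noteq> \<infinity>"
    using fin e by (subst slab_line_int) (auto simp: ennreal_mult_eq_top_iff)
  then have "AE y in lborel. indicator {- real m..real m} (y \<bullet> e) * line_int e F y \<noteq> \<infinity>"
    by (intro nn_integral_PInf_AE) auto
  then show "AE y in lborel. \<bar>y \<bullet> e\<bar> \<le> real m \<longrightarrow> line_int e F y < \<infinity>"
    by eventually_elim (auto simp: indicator_def less_top abs_le_iff split: if_splits)
qed

section \<open>Vanishing of the essential infimum on lines\<close>

text \<open>A left half-line stays in \<Omega>; a positive lower bound on it would make the line
  integral infinite, which happens only for a null set of \<open>y\<close>.\<close>

lemma line_vanish_unbounded:
  fixes F :: "'a::euclidean_space \<Rightarrow> ennreal"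
  assumes [measurable]: "F \<in> borel_measurable borel" "\<Omega> \<in> sets borel" and e: "e \<in> Basis"
    and left: "\<And>y s. y \<in> \<Omega> \<Longrightarrow> s \<le> 0 \<Longrightarrow> y + s *\<^sub>R e \<in> \<Omega>"
    and fin: "(\<integral>\<^sup>+y\<in>\<Omega>. F y \<partial>lborel) < \<infinity>"
  shows "AE y in lborel. y \<in> \<Omega> \<longrightarrow> (\<forall>\<epsilon>>0. \<not> (AE s in lborel. y + s *\<^sub>R e \<in> \<Omega> \<longrightarrow> ennreal \<epsilon> \<le> F (y + s *\<^sub>R e)))"
proof -
  have "AE y in lborel. line_int e (\<lambda>y. F y * indicator \<Omega> y) y < \<infinity>"
    using e fin by (intro AE_line_int_finite) auto
  then show ?thesis
  proof (eventually_elim, safe)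
    fix y \<epsilon> assume fin: "line_int e (\<lambda>y. F y * indicator \<Omega> y) y < \<infinity>" and y: "y \<in> \<Omega>" and "0 < (\<epsilon>::real)"
      and ae: "AE s in lborel. y + s *\<^sub>R e \<in> \<Omega> \<longrightarrow> ennreal \<epsilon> \<le> F (y + s *\<^sub>R e)"
    have "emeasure lborel {..0::real} = \<infinity>"
    proof (rule ccontr)
      assume "emeasure lborel {..0::real} \<noteq> \<infinity>"
      then obtain r where r: "emeasure lborel {..0::real} = ennreal r" "0 \<le> r"
        by (cases "emeasure lborel {..0::real}") auto
      have "emeasure lborel {- (r + 1)..0} \<le> emeasure lborel {..0::real}"
        by (intro emeasure_mono) auto
      with r show False by simp
    qed
    then have "\<infinity> = ennreal \<epsilon> * emeasure lborel {..0::real}"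
      using \<open>0 < \<epsilon>\<close> by (simp add: ennreal_mult_top)
    also have "\<dots> = (\<integral>\<^sup>+s. ennreal \<epsilon> * indicator {..0::real} s \<partial>lborel)"
      by (simp add: nn_integral_cmult_indicator)
    also have "\<dots> \<le> line_int e (\<lambda>y. F y * indicator \<Omega> y) y"
      unfolding line_int_def using ae
      by (intro nn_integral_mono_AE, eventually_elim) (use left[OF y] in \<open>auto simp: indicator_def\<close>)
    finally show False using fin by simp
  qed
qed

text \<open>Means of \<open>F\<close> over thin strips at the left face tend to 0 in the integral
  over each slab. By Fatou's lemma their lower limit is 0 on almost every line, whereas a lower
  bound \<epsilon> on the line would keep every mean at \<epsilon> or above.\<close>

lemma line_vanish_strip:
  fixes F :: "'a::euclidean_space \<Rightarrow> ennreal"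
  assumes [measurable]: "F \<in> borel_measurable borel" "\<Omega> \<in> sets borel" and e: "e \<in> Basis"
    and A: "\<And>y. y \<in> \<Omega> \<Longrightarrow> A < y \<bullet> e"
    and left: "\<And>y s. y \<in> \<Omega> \<Longrightarrow> s \<le> 0 \<Longrightarrow> A < y \<bullet> e + s \<Longrightarrow> y + s *\<^sub>R e \<in> \<Omega>"
    and strip: "\<And>n::nat. of_nat (Suc n) * (\<integral>\<^sup>+y\<in>\<Omega> \<inter> {y. y \<bullet> e < A + 1 / Suc n}. F y \<partial>lborel) \<le> E n"
    and E: "E \<longlonglongrightarrow> 0"
  shows "AE y in lborel. y \<in> \<Omega> \<longrightarrow> (\<forall>\<epsilon>>0. \<not> (AE s in lborel. y + s *\<^sub>R e \<in> \<Omega> \<longrightarrow> ennreal \<epsilon> \<le> F (y + s *\<^sub>R e)))"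
proof -
  define S where "S n = \<Omega> \<inter> {y. y \<bullet> e < A + 1 / Suc n}" for n :: nat
  have [measurable]: "S n \<in> sets borel" for n unfolding S_def by measurable
  \<comment> \<open>The factor \<open>Suc n\<close> is the inverse width of the strip, so on a line
    that crosses the strip inside \<Omega> this is the mean of \<open>F\<close> over the
    crossing.\<close>
  define Q where "Q n = (\<lambda>y. of_nat (Suc n) * line_int e (\<lambda>y. F y * indicator (S n) y) y)" for n
  have [measurable]: "Q n \<in> borel_measurable borel" for n unfolding Q_def by measurable
  have "AE y in lborel. liminf (\<lambda>n. Q n y) = 0"
  proof (rule AE_if_AE_slab)
    fix m :: nat
    let ?I = "\<lambda>y. indicator {- real m..real m} (y \<bullet> e) :: ennreal"
    have "(\<integral>\<^sup>+y. ?I y * Q n y \<partial>lborel) \<le> ennreal (2 * real m) * E n" for n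
    proof -
      have "(\<integral>\<^sup>+y. ?I y * Q n y \<partial>lborel)
          = (\<integral>\<^sup>+y. of_nat (Suc n) * (?I y * line_int e (\<lambda>y. F y * indicator (S n) y) y) \<partial>lborel)"
        by (simp add: Q_def ac_simps)
      also have "\<dots> = of_nat (Suc n) * (ennreal (2 * real m) * (\<integral>\<^sup>+y\<in>S n. F y \<partial>lborel))"
        using e by (subst nn_integral_cmult, measurable, subst slab_line_int) auto
      also have "\<dots> \<le> ennreal (2 * real m) * E n"
        using mult_left_mono[OF strip[of n], of "ennreal (2 * real m)"] by (simp add: S_def ac_simps)
      finally show ?thesis .
    qed
    then have "liminf (\<lambda>n. \<integral>\<^sup>+y. ?I y * Q n y \<partial>lborel) \<le> liminf (\<lambda>n. ennreal (2 * real m) * E n)"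
      by (intro Liminf_mono) auto
    also have "\<dots> = 0"
      using tendsto_mult_ennreal[OF tendsto_const E, of "ennreal (2 * real m)"]
      by (intro lim_imp_Liminf) auto
    finally have "(\<integral>\<^sup>+y. liminf (\<lambda>n. ?I y * Q n y) \<partial>lborel) = 0"
      using nn_integral_liminf[of "\<lambda>n y. ?I y * Q n y" lborel] by simp
    then have "AE y in lborel. liminf (\<lambda>n. ?I y * Q n y) = 0"
      by (subst (asm) nn_integral_0_iff_AE) auto
    then show "AE y in lborel. \<bar>y \<bullet> e\<bar> \<le> real m \<longrightarrow> liminf (\<lambda>n. Q n y) = 0"
      by eventually_elim (auto simp: abs_le_iff)
  qed
  then show ?thesis
  proof (eventually_elim, safe)
    fix y \<epsilon> assume lim: "liminf (\<lambda>n. Q n y) = 0" and y: "y \<in> \<Omega>" and "0 < (\<epsilon>::real)"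
      and ae: "AE s in lborel. y + s *\<^sub>R e \<in> \<Omega> \<longrightarrow> ennreal \<epsilon> \<le> F (y + s *\<^sub>R e)"
    have "(\<lambda>n. 1 / real (Suc n)) \<longlonglongrightarrow> 0"
      using LIMSEQ_inverse_real_of_nat by (simp add: divide_inverse)
    then have "\<forall>\<^sub>F n in sequentially. 1 / real (Suc n) < y \<bullet> e - A"
      using A[OF y] by (intro order_tendstoD) auto
    then have "\<forall>\<^sub>F n in sequentially. ennreal \<epsilon> \<le> Q n y"
    proof eventually_elim
      case (elim n)
      \<comment> \<open>These parameters move \<open>y\<close> into the strip. Once the strip lies
        to the left of \<open>y\<close> they are negative, and \<open>left\<close> keeps the line in
        \<Omega>.\<close>
      let ?J = "{A - y \<bullet> e<..<A + 1 / Suc n - y \<bullet> e}"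
      have "ennreal \<epsilon> = of_nat (Suc n) * (ennreal \<epsilon> * ennreal (1 / Suc n))"
        using \<open>0 < \<epsilon>\<close> unfolding ennreal_of_nat_eq_real_of_nat
        by (simp flip: ennreal_mult del: of_nat_Suc)
      also have "ennreal \<epsilon> * ennreal (1 / Suc n) = (\<integral>\<^sup>+s. ennreal \<epsilon> * indicator ?J s \<partial>lborel)"
        by (simp add: nn_integral_cmult_indicator)
      also have "of_nat (Suc n) * \<dots> \<le> Q n y"
        unfolding Q_def line_int_def using ae
      proof (intro mult_left_mono nn_integral_mono_AE, eventually_elim)
        case (elim s)
        have "y + s *\<^sub>R e \<in> S n" if "s \<in> ?J"
          using that left[OF y, of s] \<open>1 / real (Suc n) < y \<bullet> e - A\<close> e
          by (auto simp: S_def inner_add_left)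
        then show ?case using elim by (auto simp: indicator_def S_def)
      qed auto
      finally show ?case .
    qed
    then have "ennreal \<epsilon> \<le> liminf (\<lambda>n. Q n y)" by (rule Liminf_bounded)
    with lim \<open>0 < \<epsilon>\<close> show False by simp
  qed
qed

lemma frechet_derivative_outside_support:
  assumes "x \<notin> closure {x. \<phi> x \<noteq> 0}"
  shows "frechet_derivative \<phi> (at x) v = (0::real)"
proof -
  have "((\<lambda>_. 0) has_derivative (\<lambda>_. 0)) (at x)" by simp
  then have "(\<phi> has_derivative (\<lambda>_. 0)) (at x)"
    by (rule has_derivative_transform_within_open[where s = "- closure {x. \<phi> x \<noteq> 0}"])
      (use assms closure_subset[of "{x. \<phi> x \<noteq> 0}"] in auto)
  then show ?thesis using frechet_derivative_at by metis
qed

text \<open>Moving left by \<open>h\<close> from the strip leaves \<Omega>, where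
  \<open>\<phi>\<close> vanishes. So \<open>\<phi> x\<close> is an integral of the derivative over a
  segment of length \<open>h\<close>, and Tonelli's theorem over the strip costs the factor
  \<open>h\<close>.\<close>

lemma test_fun_strip:
  fixes \<phi> :: "'a::euclidean_space \<Rightarrow> real"
  assumes \<phi>: "test_fun \<Omega> \<phi>" and [measurable]: "\<Omega> \<in> sets borel" and e: "e \<in> Basis" and h: "0 < h"
    and A: "\<And>y. y \<in> \<Omega> \<Longrightarrow> A < y \<bullet> e"
  defines "S \<equiv> \<Omega> \<inter> {y. y \<bullet> e < A + h}"
  shows "(\<integral>\<^sup>+y\<in>S. ennreal \<bar>\<phi> y\<bar> \<partial>lborel)
    \<le> ennreal h * (\<integral>\<^sup>+y\<in>S. ennreal \<bar>frechet_derivative \<phi> (at y) e\<bar> \<partial>lborel)"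
proof -
  have smooth: "C_inf \<phi>" and supp: "closure {x. \<phi> x \<noteq> 0} \<subseteq> \<Omega>"
    using \<phi> by (auto simp: test_fun_def)
  define \<psi> where "\<psi> y = frechet_derivative \<phi> (at y) e" for y
  have \<psi>_cont: "continuous_on UNIV \<psi>"
    unfolding \<psi>_def[abs_def] by (intro C_inf_continuous C_inf_frechet smooth e)
  have [measurable]: "S \<in> sets borel" "\<phi> \<in> borel_measurable borel" "\<psi> \<in> borel_measurable borel"
    using smooth \<psi>_cont by (auto simp: S_def intro!: borel_measurable_continuous_onI C_inf_continuous)
  have pt: "ennreal \<bar>\<phi> x\<bar> \<le> (\<integral>\<^sup>+s\<in>{-h..0}. ennreal \<bar>\<psi> (x + s *\<^sub>R e)\<bar> * indicator S (x + s *\<^sub>R e) \<partial>lborel)" if x: "x \<in> S" for x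
  proof -
    have "x + (- h) *\<^sub>R e \<notin> \<Omega>"
      using x A[of "x + (- h) *\<^sub>R e"] e by (auto simp: S_def inner_diff_left)
    then have 0: "\<phi> (x + (- h) *\<^sub>R e) = 0"
      using supp closure_subset[of "{x. \<phi> x \<noteq> 0}"] by blast
    have D: "((\<lambda>s. \<phi> (x + s *\<^sub>R e)) has_real_derivative \<psi> (x + s *\<^sub>R e)) (at s)" for s
    proof -
      have d: "(\<phi> has_derivative frechet_derivative \<phi> (at (x + s *\<^sub>R e))) (at (x + s *\<^sub>R e))"
        using C_inf_differentiable[OF smooth] by (simp add: frechet_derivative_works)
      have "((\<lambda>s. x + s *\<^sub>R e) has_derivative (\<lambda>t. t *\<^sub>R e)) (at s)"
        by (auto intro!: derivative_eq_intros)
      from has_derivative_compose[OF this d] show ?thesis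
        unfolding has_field_derivative_def \<psi>_def
        by (simp add: linear_cmul[OF has_derivative_linear[OF d]] mult.commute[of _ "frechet_derivative _ _ e"])
    qed
    have cont: "isCont (\<lambda>s. \<psi> (x + s *\<^sub>R e)) s" for s
      using \<psi>_cont by (intro continuous_intros isCont_o2[of s "\<lambda>s. x + s *\<^sub>R e"]) (auto simp: continuous_on_eq_continuous_at)
    have int: "integrable lborel (\<lambda>s. \<psi> (x + s *\<^sub>R e) * indicator {-h..0} s)"
      using borel_integrable_atLeastAtMost[of "-h" 0 "\<lambda>s. \<psi> (x + s *\<^sub>R e)"] cont by (simp add: mult.commute)
    have "\<phi> x = (\<integral>s. \<psi> (x + s *\<^sub>R e) * indicator {-h..0} s \<partial>lborel)"
      using integral_FTC_Icc_real[of "-h" 0 "\<lambda>s. \<phi> (x + s *\<^sub>R e)", OF _ D cont] h 0 by simp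
    then have "ennreal \<bar>\<phi> x\<bar> \<le> (\<integral>\<^sup>+s. ennreal \<bar>\<psi> (x + s *\<^sub>R e) * indicator {-h..0} s\<bar> \<partial>lborel)"
      using integral_norm_bound_ennreal[OF int] by simp
    also have "\<dots> = (\<integral>\<^sup>+s\<in>{-h..0}. ennreal \<bar>\<psi> (x + s *\<^sub>R e)\<bar> * indicator S (x + s *\<^sub>R e) \<partial>lborel)"
    proof (intro nn_integral_cong)
      fix s
      have "\<psi> (x + s *\<^sub>R e) = 0" if "s \<le> 0" "x + s *\<^sub>R e \<notin> S"
      proof -
        \<comment> \<open>Moving left keeps the point below level \<open>A + h\<close>, so leaving
          \<open>S\<close> means leaving \<Omega> and hence the support.\<close>
        have "x + s *\<^sub>R e \<notin> \<Omega>" using that x e by (auto simp: S_def inner_add_left)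
        then show ?thesis unfolding \<psi>_def using supp by (intro frechet_derivative_outside_support) blast
      qed
      then show "ennreal \<bar>\<psi> (x + s *\<^sub>R e) * indicator {-h..0} s\<bar>
          = ennreal \<bar>\<psi> (x + s *\<^sub>R e)\<bar> * indicator S (x + s *\<^sub>R e) * indicator {-h..0} s"
        by (auto simp: indicator_def)
    qed
    finally show ?thesis .
  qed
  have "(\<integral>\<^sup>+y\<in>S. ennreal \<bar>\<phi> y\<bar> \<partial>lborel)
      \<le> (\<integral>\<^sup>+y. (\<integral>\<^sup>+s\<in>{-h..0}. ennreal \<bar>\<psi> (y + s *\<^sub>R e)\<bar> * indicator S (y + s *\<^sub>R e) \<partial>lborel) \<partial>lborel)"
    using pt by (intro nn_integral_mono) (auto simp: indicator_def)
  also have "\<dots> = (\<integral>\<^sup>+s. (\<integral>\<^sup>+y. ennreal \<bar>\<psi> (y + s *\<^sub>R e)\<bar> * indicator S (y + s *\<^sub>R e) * indicator {-h..0} s \<partial>lborel) \<partial>lborel)"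
    by (rule lborel_pair.Fubini'[symmetric]) measurable
  also have "\<dots> = (\<integral>\<^sup>+s. (\<integral>\<^sup>+y\<in>S. ennreal \<bar>\<psi> y\<bar> \<partial>lborel) * indicator {-h..0} s \<partial>lborel)"
    by (intro nn_integral_cong)
      (simp add: nn_integral_multc nn_integral_lborel_translate[of "\<lambda>y. ennreal \<bar>\<psi> y\<bar> * indicator S y"])
  also have "\<dots> = (\<integral>\<^sup>+y\<in>S. ennreal \<bar>\<psi> y\<bar> \<partial>lborel) * emeasure lborel {-h..0}"
    by (rule nn_integral_cmult_indicator) simp
  also have "emeasure lborel {-h..0} = ennreal h" using h by simp
  also have "(\<integral>\<^sup>+y\<in>S. ennreal \<bar>\<psi> y\<bar> \<partial>lborel) * ennreal h = ennreal h * (\<integral>\<^sup>+y\<in>S. ennreal \<bar>\<psi> y\<bar> \<partial>lborel)"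
    by (rule mult.commute)
  finally show ?thesis by (simp add: \<psi>_def)
qed

section \<open>Borel representatives and invariance of weak derivatives under null sets\<close>

lemma locally_integrable_measurable:
  fixes g :: "'a::euclidean_space \<Rightarrow> real"
  assumes U: "open U" and g: "locally_integrable g U"
  shows "(\<lambda>x. indicator U x * g x) \<in> borel_measurable lebesgue"
proof -
  obtain \<D> where \<D>: "countable \<D>" "\<D> \<subseteq> Pow U" "\<And>X. X \<in> \<D> \<Longrightarrow> \<exists>a b. X = cbox a b" "\<Union>\<D> = U"
    using open_countable_Union_open_cbox[OF U] by metis
  show ?thesis
  proof (cases "\<D> = {}")
    case True
    with \<D>(4) have "U = {}" by blast
    then show ?thesis by simp
  next
    case False
    define c where "c = from_nat_into \<D>"
    have c: "range c = \<D>" unfolding c_def using False \<D>(1) by (simp add: range_from_nat_into)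
    \<comment> \<open>Local integrability yields measurability on compact subsets only; these finite
      unions of boxes exhaust \<open>U\<close>, and measurability survives the limit.\<close>
    define K where "K n = (\<Union>i<n. c i)" for n
    have c_in: "c i \<in> \<D>" for i using c by blast
    have "compact (c i)" for i using \<D>(3)[OF c_in[of i]] by (metis compact_cbox)
    then have K1: "compact (K n)" for n unfolding K_def by (intro compact_UN) auto
    have "c i \<subseteq> U" for i using c_in[of i] \<D>(2) by blast
    then have K2: "K n \<subseteq> U" for n unfolding K_def by (intro UN_least)
    show ?thesis
    proof (rule borel_measurable_LIMSEQ_real)
      fix n
      have "set_integrable lebesgue (K n) g" using g K1[of n] K2[of n] unfolding locally_integrable_def by simp
      then show "(\<lambda>x. indicator (K n) x * g x) \<in> borel_measurable lebesgue"
        unfolding set_integrable_def real_scaleR_def by (rule borel_measurable_integrable)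
    next
      show "(\<lambda>n. indicator (K n) x * g x) \<longlonglongrightarrow> indicator U x * g x" for x
      proof (rule tendsto_eventually)
        show "\<forall>\<^sub>F n in sequentially. indicator (K n) x * g x = indicator U x * g x"
        proof (cases "x \<in> U")
          case True
          then obtain i where "x \<in> c i" using \<D>(4) c by blast
          then have "x \<in> K n" if "i < n" for n using that by (auto simp: K_def)
          then show ?thesis
            using True by (intro eventually_mono[OF eventually_gt_at_top[of i]]) simp
        next
          case False
          then have "x \<notin> K n" for n using K2[of n] by auto
          then show ?thesis using False by simp
        qed
      qed
    qed
  qed
qed

text \<open>Restricting a Lebesgue measurable function to a line may destroy measurability, so the
  arguments on lines and time slices run through Borel representatives.\<close>

lemma locally_integrable_borel_rep:
  fixes g :: "'a::euclidean_space \<Rightarrow> real"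
  assumes "open U" "locally_integrable g U"
  obtains g' where "g' \<in> borel_measurable borel" "AE x in lborel. x \<in> U \<longrightarrow> g x = g' x"
proof -
  obtain g' where "g' \<in> borel_measurable lborel" and ae: "AE x in lborel. indicator U x * g x = g' x"
    using completion_ex_borel_measurable_real[OF locally_integrable_measurable[OF assms]] by blast
  moreover from ae have "AE x in lborel. x \<in> U \<longrightarrow> g x = g' x" by eventually_elim auto
  ultimately show ?thesis using that by simp
qed

lemma has_weak_deriv_cong_AE:
  assumes wd: "has_weak_deriv f v g U" and U: "open U" and v: "v \<in> Basis"
    and f': "AE x in lborel. x \<in> U \<longrightarrow> f x = f' x" and g': "AE x in lborel. x \<in> U \<longrightarrow> g x = g' x"
    and [measurable]: "f' \<in> borel_measurable borel" "g' \<in> borel_measurable borel"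
  shows "has_weak_deriv f' v g' U"
proof -
  have [measurable]: "U \<in> sets borel" using U by simp
  have li: "locally_integrable k' U"
    if "locally_integrable k U" and ae: "AE x in lborel. x \<in> U \<longrightarrow> k x = k' x" and "k' \<in> borel_measurable borel"
    for k k' :: "'a \<Rightarrow> real"
    unfolding locally_integrable_def
  proof safe
    fix K assume K: "compact K" "K \<subseteq> U"
    then have "set_integrable lebesgue K k" using that by (auto simp: locally_integrable_def)
    then show "set_integrable lebesgue K k'"
      unfolding set_integrable_def
    proof (rule integrable_cong_AE_imp)
      have "K \<in> sets borel" using K by (simp add: borel_closed compact_imp_closed)
      then have "(\<lambda>x. indicator K x *\<^sub>R k' x) \<in> borel_measurable lborel" using that(3) by simp
      then show "(\<lambda>x. indicator K x *\<^sub>R k' x) \<in> borel_measurable lebesgue"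
        by (rule measurable_completion)
      show "AE x in lebesgue. indicator K x *\<^sub>R k x = indicator K x *\<^sub>R k' x"
        unfolding AE_completion_iff using ae by eventually_elim (use K in \<open>auto simp: indicator_def\<close>)
    qed
  qed
  have int: "(LINT x:U|lebesgue. k x * w x) = (LINT x:U|lebesgue. k' x * w x)"
    if k: "locally_integrable k U" and ae: "AE x in lborel. x \<in> U \<longrightarrow> k x = k' x"
      and [measurable]: "k' \<in> borel_measurable borel" "w \<in> borel_measurable borel"
    for k k' w :: "'a \<Rightarrow> real"
    unfolding set_lebesgue_integral_def
  proof (rule integral_cong_AE)
    have "w \<in> borel_measurable lebesgue" by (intro measurable_completion) simp
    from borel_measurable_times[OF locally_integrable_measurable[OF U k] this]
    show "(\<lambda>x. indicator U x *\<^sub>R (k x * w x)) \<in> borel_measurable lebesgue"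
      by (simp add: mult.assoc)
    show "(\<lambda>x. indicator U x *\<^sub>R (k' x * w x)) \<in> borel_measurable lebesgue"
      by (intro measurable_completion) measurable
    show "AE x in lebesgue. indicator U x *\<^sub>R (k x * w x) = indicator U x *\<^sub>R (k' x * w x)"
      unfolding AE_completion_iff using ae by eventually_elim (auto simp: indicator_def)
  qed
  have lif: "locally_integrable f U" and lig: "locally_integrable g U"
    using wd by (auto simp: has_weak_deriv_def)
  have "(LINT x:U|lebesgue. f' x * frechet_derivative \<phi> (at x) v) = - (LINT x:U|lebesgue. g' x * \<phi> x)"
    if "test_fun U \<phi>" for \<phi>
  proof -
    have smooth: "C_inf \<phi>" using that by (simp add: test_fun_def)
    then have "(\<lambda>x. frechet_derivative \<phi> (at x) v) \<in> borel_measurable borel" "\<phi> \<in> borel_measurable borel"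
      using v by (auto intro!: borel_measurable_continuous_onI C_inf_continuous intro: C_inf_frechet)
    from int[OF lif f' _ this(1)] int[OF lig g' _ this(2)]
    have "(LINT x:U|lebesgue. f x * frechet_derivative \<phi> (at x) v) = (LINT x:U|lebesgue. f' x * frechet_derivative \<phi> (at x) v)"
      "(LINT x:U|lebesgue. g x * \<phi> x) = (LINT x:U|lebesgue. g' x * \<phi> x)" by simp_all
    moreover have "(LINT x:U|lebesgue. f x * frechet_derivative \<phi> (at x) v) = - (LINT x:U|lebesgue. g x * \<phi> x)"
      using wd that unfolding has_weak_deriv_def by blast
    ultimately show ?thesis by (simp only:)
  qed
  then show ?thesis
    using li[OF lif f'] li[OF lig g'] by (simp add: has_weak_deriv_def)
qed

text \<open>\<open>test_fun_strip\<close> is passed to the limit along the approximating test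
  functions for each fixed strip. Then \<open>E n\<close> is the integral of the weak derivative
  over the strip, and dominated convergence sends it to 0 because the strips shrink to the empty
  set.\<close>

lemma W11_0_strip:
  fixes u :: "'a::euclidean_space \<Rightarrow> real"
  assumes u: "W11_0 \<Omega> u" and \<Omega>: "open \<Omega>" and e: "e \<in> Basis"
    and A: "\<And>y. y \<in> \<Omega> \<Longrightarrow> A < y \<bullet> e"
    and [measurable]: "u' \<in> borel_measurable borel" and u': "AE x in lborel. x \<in> \<Omega> \<longrightarrow> u x = u' x"
  obtains E where "E \<longlonglongrightarrow> 0"
    "\<And>n::nat. of_nat (Suc n) * (\<integral>\<^sup>+y\<in>\<Omega> \<inter> {y. y \<bullet> e < A + 1 / Suc n}. ennreal \<bar>u' y\<bar> \<partial>lborel) \<le> E n"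
proof -
  have [measurable]: "\<Omega> \<in> sets borel" using \<Omega> by simp
  obtain g \<phi> where g: "\<forall>v\<in>Basis. has_weak_deriv u v (g v) \<Omega> \<and> set_integrable lebesgue \<Omega> (g v)"
    and \<phi>: "\<forall>k. test_fun \<Omega> (\<phi> k)"
    and lim: "(\<lambda>k. (\<integral>\<^sup>+x\<in>\<Omega>. ennreal \<bar>\<phi> k x - u x\<bar> \<partial>lebesgue) +
                (\<Sum>v\<in>Basis. \<integral>\<^sup>+x\<in>\<Omega>. ennreal \<bar>frechet_derivative (\<phi> k) (at x) v - g v x\<bar> \<partial>lebesgue)) \<longlonglongrightarrow> 0"
    using u unfolding W11_0_def by (elim conjE exE) (rule that)
  note g = g[rule_format, THEN conjunct1] g[rule_format, THEN conjunct2] and \<phi> = \<phi>[rule_format]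
  obtain g' where [measurable]: "g' \<in> borel_measurable borel" and g': "AE x in lborel. x \<in> \<Omega> \<longrightarrow> g e x = g' x"
    using locally_integrable_borel_rep[OF \<Omega>, of "g e"] g(1)[OF e] by (auto simp: has_weak_deriv_def)
  define \<psi> where "\<psi> k y = frechet_derivative (\<phi> k) (at y) e" for k y
  have [measurable]: "\<psi> k \<in> borel_measurable borel" "\<phi> k \<in> borel_measurable borel" for k
    using \<phi>[of k] e unfolding \<psi>_def[abs_def] test_fun_def
    by (auto intro!: borel_measurable_continuous_onI C_inf_continuous intro: C_inf_frechet)
  define d where "d k = (\<integral>\<^sup>+x\<in>\<Omega>. ennreal \<bar>\<phi> k x - u' x\<bar> \<partial>lborel) + (\<integral>\<^sup>+x\<in>\<Omega>. ennreal \<bar>\<psi> k x - g' x\<bar> \<partial>lborel)" for k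
  have d: "d \<longlonglongrightarrow> 0"
  proof (rule tendsto_sandwich[OF _ _ tendsto_const lim])
    show "\<forall>\<^sub>F k in sequentially. d k \<le> (\<integral>\<^sup>+x\<in>\<Omega>. ennreal \<bar>\<phi> k x - u x\<bar> \<partial>lebesgue) +
                (\<Sum>v\<in>Basis. \<integral>\<^sup>+x\<in>\<Omega>. ennreal \<bar>frechet_derivative (\<phi> k) (at x) v - g v x\<bar> \<partial>lebesgue)"
    proof (intro always_eventually allI)
      fix k
      have "(\<integral>\<^sup>+x\<in>\<Omega>. ennreal \<bar>\<phi> k x - u' x\<bar> \<partial>lborel) = (\<integral>\<^sup>+x\<in>\<Omega>. ennreal \<bar>\<phi> k x - u' x\<bar> \<partial>lebesgue)"
        by (simp add: nn_integral_completion)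
      also have "\<dots> = (\<integral>\<^sup>+x\<in>\<Omega>. ennreal \<bar>\<phi> k x - u x\<bar> \<partial>lebesgue)"
        by (rule nn_integral_cong_AE, unfold AE_completion_iff) (use u' in \<open>eventually_elim, auto simp: indicator_def\<close>)
      finally have 1: "(\<integral>\<^sup>+x\<in>\<Omega>. ennreal \<bar>\<phi> k x - u' x\<bar> \<partial>lborel) = (\<integral>\<^sup>+x\<in>\<Omega>. ennreal \<bar>\<phi> k x - u x\<bar> \<partial>lebesgue)" .
      have "(\<integral>\<^sup>+x\<in>\<Omega>. ennreal \<bar>\<psi> k x - g' x\<bar> \<partial>lborel) = (\<integral>\<^sup>+x\<in>\<Omega>. ennreal \<bar>\<psi> k x - g' x\<bar> \<partial>lebesgue)"
        by (simp add: nn_integral_completion)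
      also have "\<dots> = (\<integral>\<^sup>+x\<in>\<Omega>. ennreal \<bar>frechet_derivative (\<phi> k) (at x) e - g e x\<bar> \<partial>lebesgue)"
        unfolding \<psi>_def
        by (rule nn_integral_cong_AE, unfold AE_completion_iff) (use g' in \<open>eventually_elim, auto simp: indicator_def\<close>)
      also have "\<dots> \<le> (\<Sum>v\<in>Basis. \<integral>\<^sup>+x\<in>\<Omega>. ennreal \<bar>frechet_derivative (\<phi> k) (at x) v - g v x\<bar> \<partial>lebesgue)"
        using e by (intro member_le_sum) auto
      finally show "d k \<le> (\<integral>\<^sup>+x\<in>\<Omega>. ennreal \<bar>\<phi> k x - u x\<bar> \<partial>lebesgue) +
                (\<Sum>v\<in>Basis. \<integral>\<^sup>+x\<in>\<Omega>. ennreal \<bar>frechet_derivative (\<phi> k) (at x) v - g v x\<bar> \<partial>lebesgue)"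
        unfolding d_def 1 by (rule add_left_mono)
    qed
  qed simp
  define S where "S n = \<Omega> \<inter> {y. y \<bullet> e < A + 1 / Suc n}" for n :: nat
  have [measurable]: "S n \<in> sets borel" for n unfolding S_def by measurable
  define E where "E n = (\<integral>\<^sup>+y\<in>S n. ennreal \<bar>g' y\<bar> \<partial>lborel)" for n
  have "of_nat (Suc n) * (\<integral>\<^sup>+y\<in>S n. ennreal \<bar>u' y\<bar> \<partial>lborel) \<le> E n" for n
  proof -
    \<comment> \<open>The first error comes from replacing \<open>u'\<close> by
      \<open>\<phi> k\<close>, the second from replacing the derivative of \<open>\<phi> k\<close>
      by \<open>g'\<close>; both vanish as \<open>k\<close> grows with \<open>n\<close>
      fixed.\<close>
    have "of_nat (Suc n) * (\<integral>\<^sup>+y\<in>S n. ennreal \<bar>u' y\<bar> \<partial>lborel) \<le> of_nat (Suc n) * d k + d k + E n" for k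
    proof -
      have "(\<integral>\<^sup>+y\<in>S n. ennreal \<bar>u' y\<bar> \<partial>lborel)
          \<le> (\<integral>\<^sup>+y. ennreal \<bar>\<phi> k y - u' y\<bar> * indicator \<Omega> y + ennreal \<bar>\<phi> k y\<bar> * indicator (S n) y \<partial>lborel)"
        by (intro nn_integral_mono) (auto simp: indicator_def S_def simp flip: ennreal_plus intro!: ennreal_leI)
      also have "\<dots> = (\<integral>\<^sup>+y\<in>\<Omega>. ennreal \<bar>\<phi> k y - u' y\<bar> \<partial>lborel) + (\<integral>\<^sup>+y\<in>S n. ennreal \<bar>\<phi> k y\<bar> \<partial>lborel)"
        by (rule nn_integral_add) measurable
      also have "\<dots> \<le> d k + ennreal (1 / Suc n) * (\<integral>\<^sup>+y\<in>S n. ennreal \<bar>\<psi> k y\<bar> \<partial>lborel)"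
        unfolding S_def \<psi>_def d_def using e \<phi> A
        by (intro add_mono test_fun_strip) auto
      finally have "of_nat (Suc n) * (\<integral>\<^sup>+y\<in>S n. ennreal \<bar>u' y\<bar> \<partial>lborel)
          \<le> of_nat (Suc n) * (d k + ennreal (1 / Suc n) * (\<integral>\<^sup>+y\<in>S n. ennreal \<bar>\<psi> k y\<bar> \<partial>lborel))"
        by (rule mult_left_mono) simp
      also have "\<dots> = of_nat (Suc n) * d k + (of_nat (Suc n) * ennreal (1 / Suc n)) * (\<integral>\<^sup>+y\<in>S n. ennreal \<bar>\<psi> k y\<bar> \<partial>lborel)"
        by (simp only: distrib_left mult.assoc)
      also have "of_nat (Suc n) * ennreal (1 / Suc n) = 1"
        unfolding ennreal_of_nat_eq_real_of_nat by (simp flip: ennreal_mult del: of_nat_Suc)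
      also have "1 * (\<integral>\<^sup>+y\<in>S n. ennreal \<bar>\<psi> k y\<bar> \<partial>lborel)
          \<le> (\<integral>\<^sup>+y. ennreal \<bar>\<psi> k y - g' y\<bar> * indicator \<Omega> y + ennreal \<bar>g' y\<bar> * indicator (S n) y \<partial>lborel)"
        unfolding mult_1
        by (intro nn_integral_mono) (auto simp: indicator_def S_def simp flip: ennreal_plus intro!: ennreal_leI)
      also have "\<dots> = (\<integral>\<^sup>+y\<in>\<Omega>. ennreal \<bar>\<psi> k y - g' y\<bar> \<partial>lborel) + E n"
        unfolding E_def by (rule nn_integral_add) measurable
      also have "\<dots> \<le> d k + E n" by (intro add_right_mono) (simp add: d_def)
      finally show ?thesis by (simp add: add_left_mono add.assoc)
    qed
    moreover have "(\<lambda>k. of_nat (Suc n) * d k + d k + E n) \<longlonglongrightarrow> of_nat (Suc n) * 0 + 0 + E n"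
      by (intro tendsto_add tendsto_mult_ennreal tendsto_const d) auto
    ultimately show ?thesis
      using LIMSEQ_le_const[of "\<lambda>k. of_nat (Suc n) * d k + d k + E n"] by auto
  qed
  moreover have "E \<longlonglongrightarrow> 0"
  proof -
    have "(\<integral>\<^sup>+y\<in>\<Omega>. ennreal \<bar>g' y\<bar> \<partial>lborel) = (\<integral>\<^sup>+y\<in>\<Omega>. ennreal \<bar>g' y\<bar> \<partial>lebesgue)"
      by (simp add: nn_integral_completion)
    also have "\<dots> = (\<integral>\<^sup>+y. ennreal (norm (indicator \<Omega> y *\<^sub>R g e y)) \<partial>lebesgue)"
      by (rule nn_integral_cong_AE, unfold AE_completion_iff) (use g' in \<open>eventually_elim, auto simp: indicator_def\<close>)
    also have "\<dots> < \<infinity>"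
      using g(2)[OF e] by (simp add: set_integrable_def integrable_iff_bounded)
    finally have fin: "(\<integral>\<^sup>+y\<in>\<Omega>. ennreal \<bar>g' y\<bar> \<partial>lborel) < \<infinity>" .
    have "(\<lambda>n. \<integral>\<^sup>+y\<in>S n. ennreal \<bar>g' y\<bar> \<partial>lborel) \<longlonglongrightarrow> (\<integral>\<^sup>+y. 0 \<partial>(lborel :: 'a measure))"
    proof (rule nn_integral_dominated_convergence[where w="\<lambda>y. ennreal \<bar>g' y\<bar> * indicator \<Omega> y"])
      show "AE y in lborel. (\<lambda>n. ennreal \<bar>g' y\<bar> * indicator (S n) y) \<longlonglongrightarrow> 0"
      proof (intro AE_I2 tendsto_eventually)
        fix y
        show "\<forall>\<^sub>F n in sequentially. ennreal \<bar>g' y\<bar> * indicator (S n) y = 0"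
        proof (cases "y \<in> \<Omega>")
          case True
          have "(\<lambda>n. 1 / real (Suc n)) \<longlonglongrightarrow> 0"
            using LIMSEQ_inverse_real_of_nat by (simp add: divide_inverse)
          then have "\<forall>\<^sub>F n in sequentially. 1 / real (Suc n) < y \<bullet> e - A"
            using A[OF True] by (intro order_tendstoD) auto
          then show ?thesis by eventually_elim (auto simp: S_def)
        qed (simp add: S_def)
      qed
    qed (use fin in \<open>auto simp: S_def indicator_def\<close>)
    then show ?thesis by (simp add: E_def[abs_def])
  qed
  ultimately show ?thesis using that by (simp add: S_def)
qed

section \<open>Rectangular domains: openness, convexity, vanishing on lines\<close>

lemma rect_domain_eq: "rect_domain a b = (\<Inter>i. (\<lambda>x. x $ i) -` (ereal -` {a i<..<b i}))"
  unfolding rect_domain_def vimage_def by (intro set_eqI) simp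

lemma open_rect_domain: "open (rect_domain a b)"
  unfolding rect_domain_eq
proof (intro open_INT ballI)
  fix i :: 'a
  have "open (ereal -` {a i<..<b i})"
    by (intro open_vimage continuous_on_ereal continuous_on_id) simp
  then show "open ((\<lambda>x::real^'a. x $ i) -` (ereal -` {a i<..<b i}))"
    by (intro open_vimage[OF _ continuous_on_component[OF continuous_on_id]])
qed simp

lemma convex_rect_domain: "convex (rect_domain a b)"
  unfolding rect_domain_eq
proof (intro convex_INT convex_linear_vimage)
  fix i :: 'a
  show "linear (\<lambda>x::real^'a. x $ i)" by (rule linearI) simp_all
  have "is_interval (ereal -` {a i<..<b i})"
    unfolding is_interval_1
  proof (intro ballI allI impI, elim conjE)
    fix s t x assume "s \<in> ereal -` {a i<..<b i}" "t \<in> ereal -` {a i<..<b i}" "s \<le> x" "x \<le> t"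
    then have "a i < ereal s" "ereal s \<le> ereal x" "ereal x \<le> ereal t" "ereal t < b i" by simp_all
    then have "a i < ereal x" "ereal x < b i" by order+
    then show "x \<in> ereal -` {a i<..<b i}" by simp
  qed
  then show "convex (ereal -` {a i<..<b i})" by (simp add: is_interval_convex_1)
qed

text \<open>Following the line to the left decides. At a finite endpoint \<open>a i\<close> the
  approximation by test functions forces small means near the face; at an infinite one integrability
  of \<open>u\<close> forbids a positive lower bound.\<close>

lemma W11_0_vanish:
  fixes u :: "real^'n::finite \<Rightarrow> real"
  assumes u: "W11_0 (rect_domain a b) u" and ab: "a i < b i"
    and [measurable]: "u' \<in> borel_measurable borel" and u': "AE x in lborel. x \<in> rect_domain a b \<longrightarrow> u x = u' x"
  shows "AE y in lborel. y \<in> rect_domain a b \<longrightarrow> (\<forall>\<epsilon>>0. \<not> (AE s in lborel.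
    y + s *\<^sub>R axis i 1 \<in> rect_domain a b \<longrightarrow> ennreal \<epsilon> \<le> ennreal \<bar>u' (y + s *\<^sub>R axis i 1)\<bar>))"
proof -
  let ?\<Omega> = "rect_domain a b"
  have [measurable]: "?\<Omega> \<in> sets borel" by (simp add: open_rect_domain)
  have e: "axis i (1::real) \<in> Basis" by simp
  have left: "y + s *\<^sub>R axis i 1 \<in> ?\<Omega>" if y: "y \<in> ?\<Omega>" and s: "s \<le> 0" "a i < ereal (y $ i + s)" for y s
    unfolding rect_domain_def
  proof (rule CollectI, rule allI)
    fix j
    have yj: "a j < ereal (y $ j)" "ereal (y $ j) < b j" for j
      using y unfolding rect_domain_def by blast+
    show "a j < ereal ((y + s *\<^sub>R axis i 1) $ j) \<and> ereal ((y + s *\<^sub>R axis i 1) $ j) < b j"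
    proof (cases "j = i")
      case True
      have "ereal (y $ i + s) \<le> ereal (y $ i)" using s by simp
      then have "ereal (y $ i + s) < b i" using yj(2)[of i] by (rule le_less_trans)
      moreover have "(y + s *\<^sub>R axis i 1) $ j = y $ i + s" using True by (simp add: axis_def)
      ultimately show ?thesis using s(2) True by simp
    next
      case False
      then have "(y + s *\<^sub>R axis i 1) $ j = y $ j" by (simp add: axis_def)
      then show ?thesis using yj[of j] by (simp only:)
    qed
  qed
  consider A where "a i = ereal A" | "a i = -\<infinity>" using ab by (cases "a i") auto
  then show ?thesis
  proof cases
    case 1
    have A: "A < y \<bullet> axis i 1" if "y \<in> ?\<Omega>" for y
    proof -
      have "a i < ereal (y $ i)" using that unfolding rect_domain_def by blast
      then show ?thesis using 1 by (simp add: inner_axis)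
    qed
    obtain E where E: "E \<longlonglongrightarrow> 0"
      "\<And>n::nat. of_nat (Suc n) * (\<integral>\<^sup>+y\<in>?\<Omega> \<inter> {y. y \<bullet> axis i 1 < A + 1 / Suc n}. ennreal \<bar>u' y\<bar> \<partial>lborel) \<le> E n"
      by (rule W11_0_strip[OF u open_rect_domain e A _ u']) simp_all
    show ?thesis
      by (rule line_vanish_strip[OF _ _ e A _ E(2) E(1)]) (use left 1 in \<open>auto simp: inner_axis\<close>)
  next
    case 2
    have "(\<integral>\<^sup>+y\<in>?\<Omega>. ennreal \<bar>u' y\<bar> \<partial>lborel) = (\<integral>\<^sup>+y\<in>?\<Omega>. ennreal \<bar>u' y\<bar> \<partial>lebesgue)"
      by (simp add: nn_integral_completion)
    also have "\<dots> = (\<integral>\<^sup>+y. ennreal (norm (indicator ?\<Omega> y *\<^sub>R u y)) \<partial>lebesgue)"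
      by (rule nn_integral_cong_AE, unfold AE_completion_iff) (use u' in \<open>eventually_elim, auto simp: indicator_def\<close>)
    also have "\<dots> < \<infinity>"
      using u by (simp add: W11_0_def set_integrable_def integrable_iff_bounded)
    finally show ?thesis
      by (intro line_vanish_unbounded[OF _ _ e] left) (auto simp: 2)
  qed
qed

section \<open>Bounds for truncated powers along lines\<close>

lemma AE_line_segment_integral_finite:
  fixes g :: "'a::euclidean_space \<Rightarrow> real"
  assumes [measurable]: "g \<in> borel_measurable borel" "\<Omega> \<in> sets borel" and cvx: "convex \<Omega>" and e: "e \<in> Basis"
    and p: "1 \<le> p" and fin: "(\<integral>\<^sup>+y\<in>\<Omega>. ennreal (\<bar>g y\<bar> powr p) \<partial>lborel) < \<infinity>"
  shows "AE y in lborel. y \<in> \<Omega> \<longrightarrow> (\<forall>r. y + r *\<^sub>R e \<in> \<Omega> \<longrightarrow>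
    (\<integral>\<^sup>+s\<in>closed_segment 0 r. ennreal \<bar>g (y + s *\<^sub>R e)\<bar> \<partial>lborel) < \<infinity>)"
proof -
  have "AE y in lborel. line_int e (\<lambda>y. ennreal (\<bar>g y\<bar> powr p) * indicator \<Omega> y) y < \<infinity>"
    using e fin by (intro AE_line_int_finite) auto
  then show ?thesis
  proof (eventually_elim, safe)
    fix y r assume fin: "line_int e (\<lambda>y. ennreal (\<bar>g y\<bar> powr p) * indicator \<Omega> y) y < \<infinity>"
      and y: "y \<in> \<Omega>" "y + r *\<^sub>R e \<in> \<Omega>"
    have seg: "y + s *\<^sub>R e \<in> \<Omega>" if s: "s \<in> closed_segment 0 r" for s
    proof -
      obtain u where "0 \<le> u" "u \<le> 1" "s = u * r" using s by (auto simp: in_segment)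
      then have "y + s *\<^sub>R e = (1 - u) *\<^sub>R y + u *\<^sub>R (y + r *\<^sub>R e)" by (simp add: algebra_simps)
      then show ?thesis using convexD[OF cvx y, of "1 - u" u] \<open>0 \<le> u\<close> \<open>u \<le> 1\<close> by simp
    qed
    \<comment> \<open>Only the power \<open>p\<close> of \<open>\<bar>g\<bar>\<close> is integrable
      on the line; the summand 1 costs no more than the length of the bounded segment.\<close>
    have le: "\<bar>t\<bar> \<le> 1 + \<bar>t\<bar> powr p" for t :: real
    proof (cases "\<bar>t\<bar> \<le> 1")
      case False
      then have "\<bar>t\<bar> powr 1 \<le> \<bar>t\<bar> powr p" using p by (intro powr_mono) auto
      then show ?thesis using False by auto
    qed (auto intro: add_increasing2)
    have "(\<integral>\<^sup>+s\<in>closed_segment 0 r. ennreal \<bar>g (y + s *\<^sub>R e)\<bar> \<partial>lborel)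
      \<le> (\<integral>\<^sup>+s. indicator (closed_segment 0 r) s + ennreal (\<bar>g (y + s *\<^sub>R e)\<bar> powr p) * indicator \<Omega> (y + s *\<^sub>R e) \<partial>lborel)"
    proof (intro nn_integral_mono)
      fix s
      have "ennreal \<bar>g (y + s *\<^sub>R e)\<bar> \<le> 1 + ennreal (\<bar>g (y + s *\<^sub>R e)\<bar> powr p)"
        using ennreal_leI[OF le[of "g (y + s *\<^sub>R e)"]] by (simp add: ennreal_plus)
      then show "ennreal \<bar>g (y + s *\<^sub>R e)\<bar> * indicator (closed_segment 0 r) s
          \<le> indicator (closed_segment 0 r) s + ennreal (\<bar>g (y + s *\<^sub>R e)\<bar> powr p) * indicator \<Omega> (y + s *\<^sub>R e)"
        using seg[of s] by (simp add: indicator_def)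
    qed
    also have "\<dots> = emeasure lborel (closed_segment 0 r) + line_int e (\<lambda>y. ennreal (\<bar>g y\<bar> powr p) * indicator \<Omega> y) y"
      unfolding line_int_def by (subst nn_integral_add) auto
    also have "\<dots> < \<infinity>"
      using fin by (auto simp: closed_segment_eq_real_ivl)
    finally show "(\<integral>\<^sup>+s\<in>closed_segment 0 r. ennreal \<bar>g (y + s *\<^sub>R e)\<bar> \<partial>lborel) < \<infinity>" .
  qed
qed

text \<open>\<open>level_bound\<close> is applied to \<open>w powr \<alpha>\<close> on the line with
  cap \<open>k powr \<alpha>\<close>. Truncation commutes with the increasing power, and a lower
  bound \<epsilon> for \<open>w powr \<alpha>\<close> is the lower bound
  \<open>\<epsilon> powr (1 / \<alpha>)\<close> for \<open>w\<close>, which \<open>V\<close>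
  excludes. Halving the level there is the source of \<open>2 powr \<gamma>\<close>.\<close>

lemma truncated_power_line_bound:
  fixes w :: "'a::euclidean_space \<Rightarrow> real" and g :: "'a \<Rightarrow> real"
  assumes [measurable]: "w \<in> borel_measurable borel" "g \<in> borel_measurable borel" "\<Omega> \<in> sets borel"
    and cvx: "convex \<Omega>" and e: "e \<in> Basis" and w0: "\<And>y. 0 \<le> w y"
    and D: "AE y in lborel. AE h in lborel. y \<in> \<Omega> \<longrightarrow> y + h *\<^sub>R e \<in> \<Omega> \<longrightarrow>
      ennreal \<bar>w (y + h *\<^sub>R e) powr \<alpha> - w y powr \<alpha>\<bar> \<le> (\<integral>\<^sup>+s\<in>closed_segment 0 h. ennreal \<bar>g (y + s *\<^sub>R e)\<bar> \<partial>lborel)"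
    and V: "AE y in lborel. y \<in> \<Omega> \<longrightarrow> (\<forall>\<epsilon>>0. \<not> (AE s in lborel. y + s *\<^sub>R e \<in> \<Omega> \<longrightarrow> ennreal \<epsilon> \<le> ennreal (w (y + s *\<^sub>R e))))"
    and p: "1 \<le> p" and fin: "(\<integral>\<^sup>+y\<in>\<Omega>. ennreal (\<bar>g y\<bar> powr p) \<partial>lborel) < \<infinity>"
    and \<alpha>: "0 < \<alpha>" and \<gamma>: "1 \<le> \<gamma>" and k: "0 < k"
  shows "AE y in lborel. y \<in> \<Omega> \<longrightarrow> ennreal (min (w y) k powr (\<alpha> * \<gamma>))
    \<le> ennreal (2 powr \<gamma>) * line_int e (\<lambda>y. ennreal (min (w y) k powr (\<alpha> * (\<gamma> - 1))) * ennreal \<bar>g y\<bar> * indicator \<Omega> y) y"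
  using D V AE_line_segment_integral_finite[OF assms(2,3) cvx e p fin]
proof (eventually_elim, safe)
  fix y assume y: "y \<in> \<Omega>"
    and D: "AE h in lborel. y \<in> \<Omega> \<longrightarrow> y + h *\<^sub>R e \<in> \<Omega> \<longrightarrow>
      ennreal \<bar>w (y + h *\<^sub>R e) powr \<alpha> - w y powr \<alpha>\<bar> \<le> (\<integral>\<^sup>+s\<in>closed_segment 0 h. ennreal \<bar>g (y + s *\<^sub>R e)\<bar> \<partial>lborel)"
    and V: "\<forall>\<epsilon>>0. \<not> (AE s in lborel. y + s *\<^sub>R e \<in> \<Omega> \<longrightarrow> ennreal \<epsilon> \<le> ennreal (w (y + s *\<^sub>R e)))"
    and fin: "\<forall>r. y + r *\<^sub>R e \<in> \<Omega> \<longrightarrow> (\<integral>\<^sup>+s\<in>closed_segment 0 r. ennreal \<bar>g (y + s *\<^sub>R e)\<bar> \<partial>lborel) < \<infinity>"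
  define J where "J = {s. y + s *\<^sub>R e \<in> \<Omega>}"
  define f where "f s = w (y + s *\<^sub>R e) powr \<alpha>" for s
  have min_powr: "min (t powr \<alpha>) (k powr \<alpha>) = min t k powr \<alpha>" if "0 \<le> t" for t
    using that \<alpha> k by (cases "t \<le> k") (simp_all add: min_absorb1 min_absorb2 powr_mono2)
  have "ennreal ((min (f 0) (k powr \<alpha>) / 2) powr \<gamma>)
      \<le> (\<integral>\<^sup>+s\<in>J. ennreal (min (f s) (k powr \<alpha>) powr (\<gamma> - 1)) * ennreal \<bar>g (y + s *\<^sub>R e)\<bar> \<partial>lborel)"
  proof (rule level_bound)
    show "f \<in> borel_measurable borel" unfolding f_def[abs_def] by measurable
    show "J \<in> sets borel" unfolding J_def by measurable
    show "convex J"
      unfolding J_def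
    proof (rule convexI, simp)
      fix s t u v :: real assume st: "y + s *\<^sub>R e \<in> \<Omega>" "y + t *\<^sub>R e \<in> \<Omega>" and uv: "0 \<le> u" "0 \<le> v" "u + v = 1"
      have "u *\<^sub>R (y + s *\<^sub>R e) + v *\<^sub>R (y + t *\<^sub>R e) = (u + v) *\<^sub>R y + (u * s + v * t) *\<^sub>R e"
        by (simp add: algebra_simps)
      then show "y + (u * s + v * t) *\<^sub>R e \<in> \<Omega>" using convexD[OF cvx st uv] uv by simp
    qed
    show "0 \<in> J" using y by (simp add: J_def)
    show "AE r in lborel. r \<in> J \<longrightarrow> ennreal \<bar>f r - f 0\<bar> \<le> (\<integral>\<^sup>+s\<in>closed_segment 0 r. ennreal \<bar>g (y + s *\<^sub>R e)\<bar> \<partial>lborel)"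
      using D by eventually_elim (use y in \<open>auto simp: J_def f_def\<close>)
    show "(\<integral>\<^sup>+s\<in>closed_segment 0 r. ennreal \<bar>g (y + s *\<^sub>R e)\<bar> \<partial>lborel) < \<infinity>" if "r \<in> J" for r
      using fin that by (auto simp: J_def)
    show "\<not> (AE r in lborel. r \<in> J \<longrightarrow> \<epsilon> \<le> f r)" if \<epsilon>: "0 < \<epsilon>" for \<epsilon>
    proof
      assume "AE r in lborel. r \<in> J \<longrightarrow> \<epsilon> \<le> f r"
      then have "AE r in lborel. y + r *\<^sub>R e \<in> \<Omega> \<longrightarrow> ennreal (\<epsilon> powr (1 / \<alpha>)) \<le> ennreal (w (y + r *\<^sub>R e))"
      proof eventually_elim
        case (elim r)
        have "\<epsilon> powr (1 / \<alpha>) \<le> w (y + r *\<^sub>R e)" if "r \<in> J"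
          using powr_mono2[of "1 / \<alpha>" \<epsilon> "f r"] elim that \<alpha> \<epsilon> w0[of "y + r *\<^sub>R e"] by (simp add: f_def powr_powr)
        then show ?case by (auto simp: J_def intro: ennreal_leI)
      qed
      with V \<epsilon> show False by simp
    qed
  qed (use \<gamma> k in \<open>auto simp: f_def\<close>)
  also have "\<dots> = line_int e (\<lambda>y. ennreal (min (w y) k powr (\<alpha> * (\<gamma> - 1))) * ennreal \<bar>g y\<bar> * indicator \<Omega> y) y"
    unfolding line_int_def f_def
    by (intro nn_integral_cong) (auto simp: J_def indicator_def min_powr w0 powr_powr)
  finally have main: "ennreal ((min (f 0) (k powr \<alpha>) / 2) powr \<gamma>) \<le> \<dots>" .
  have "min (w y) k powr (\<alpha> * \<gamma>) = 2 powr \<gamma> * (min (f 0) (k powr \<alpha>) / 2) powr \<gamma>"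
    using w0[of y] k by (simp add: f_def min_powr powr_divide powr_powr)
  then have "ennreal (min (w y) k powr (\<alpha> * \<gamma>)) = ennreal (2 powr \<gamma>) * ennreal ((min (f 0) (k powr \<alpha>) / 2) powr \<gamma>)"
    by (simp add: ennreal_mult)
  also have "\<dots> \<le> ennreal (2 powr \<gamma>) * line_int e (\<lambda>y. ennreal (min (w y) k powr (\<alpha> * (\<gamma> - 1))) * ennreal \<bar>g y\<bar> * indicator \<Omega> y) y"
    using main by (rule mult_left_mono) simp
  finally show "ennreal (min (w y) k powr (\<alpha> * \<gamma>))
    \<le> ennreal (2 powr \<gamma>) * line_int e (\<lambda>y. ennreal (min (w y) k powr (\<alpha> * (\<gamma> - 1))) * ennreal \<bar>g y\<bar> * indicator \<Omega> y) y" .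
qed

section \<open>The anisotropic Sobolev inequality\<close>

lemma prod_Basis_vec: "(\<Prod>b\<in>(Basis :: (real^'n::finite) set). f b) = (\<Prod>i\<in>UNIV. f (axis i 1))"
proof -
  have 1: "(Basis :: (real^'n) set) = range (\<lambda>i. axis i 1)" by (auto simp: Basis_vec_def)
  have 2: "inj (\<lambda>i. axis i (1::real) :: real^'n)" by (auto simp: inj_on_def axis_eq_axis)
  show ?thesis unfolding 1 prod.reindex[OF 2] o_def ..
qed

lemma loomis_whitney_vec:
  fixes f :: "'n::finite \<Rightarrow> real^'n \<Rightarrow> ennreal"
  assumes "\<And>i. f i \<in> borel_measurable borel" and "CARD('n) \<ge> 2"
  shows "(\<integral>\<^sup>+x. (\<Prod>i\<in>UNIV. epow (line_int (axis i 1) (f i) x) (1 / (real CARD('n) - 1))) \<partial>lborel)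
    \<le> (\<Prod>i\<in>UNIV. epow (\<integral>\<^sup>+x. f i x \<partial>lborel) (1 / (real CARD('n) - 1)))"
proof -
  define F where "F b = f (THE i. b = axis i 1)" for b :: "real^'n"
  have F: "F (axis i 1) = f i" for i
  proof -
    have "(THE j. axis i (1::real) = (axis j 1 :: real^'n)) = i" by (rule the_equality) (auto simp: axis_eq_axis)
    then show ?thesis by (simp add: F_def)
  qed
  have "DIM(real^'n) \<ge> 2" using assms(2) by simp
  from loomis_whitney[of F, OF _ this]
  show ?thesis using assms(1) by (simp add: prod_Basis_vec F) (simp add: F_def)
qed

text \<open>With \<open>N = CARD('n)\<close>, the exponents \<open>(1 - 1 / p i) / (N - 1)\<close>
  of \<open>x\<close> on the right add up to \<open>1 - \<kappa>\<close>, where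
  \<open>\<kappa> = (s - 1) / (N - 1)\<close> is positive because \<open>s > 1\<close>. Dividing by
  \<open>x powr (1 - \<kappa>)\<close> and raising to \<open>1 / \<kappa>\<close> turns each
  \<open>1 / (N - 1)\<close> into \<open>\<tau>\<close>.\<close>

lemma absorb_power:
  fixes p c B :: "'n::finite \<Rightarrow> real"
  assumes p: "\<And>i. 1 < p i" and s: "1 < (\<Sum>i\<in>UNIV. 1 / p i)" and N: "2 \<le> CARD('n)"
    and x: "0 \<le> x" and c: "\<And>i. 0 \<le> c i" and B: "\<And>i. 0 < B i"
    and le: "x \<le> (\<Prod>i\<in>UNIV. (B i * (x powr (1 - 1 / p i) * c i powr (1 / p i))) powr (1 / (real CARD('n) - 1)))"
  defines "\<tau> \<equiv> 1 / ((\<Sum>i\<in>UNIV. 1 / p i) - 1)"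
  shows "x \<le> (\<Prod>i\<in>UNIV. B i) powr \<tau> * (\<Prod>i\<in>UNIV. c i powr (\<tau> / p i))"
proof (cases "x = 0")
  case True
  then show ?thesis using c by (simp add: prod_nonneg)
next
  case False
  with x have x: "0 < x" by simp
  define q where "q = 1 / (real CARD('n) - 1)"
  define s where "s = (\<Sum>i\<in>UNIV. 1 / p i)"
  define \<kappa> where "\<kappa> = q * (s - 1)"
  have q: "0 < q" and \<kappa>: "0 < \<kappa>" using N s by (auto simp: q_def \<kappa>_def s_def)
  have q\<kappa>: "q / \<kappa> = \<tau>" using q s by (simp add: \<kappa>_def \<tau>_def s_def)
  have "(\<Sum>i\<in>UNIV. q * (1 - 1 / p i)) = q * (real CARD('n) - s)"
    by (simp add: sum_distrib_left[symmetric] sum_subtractf s_def)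
  also have "\<dots> = 1 - \<kappa>"
  proof -
    have "q * (real CARD('n) - 1) = 1" using N by (simp add: q_def)
    then show ?thesis by (simp add: \<kappa>_def algebra_simps)
  qed
  finally have e: "(\<Sum>i\<in>UNIV. q * (1 - 1 / p i)) = 1 - \<kappa>" .
  have "(\<Prod>i\<in>UNIV. (B i * (x powr (1 - 1 / p i) * c i powr (1 / p i))) powr q)
      = (\<Prod>i\<in>UNIV. (B i powr q * c i powr (q / p i)) * x powr (q * (1 - 1 / p i)))"
  proof (rule prod.cong[OF refl])
    fix i
    show "(B i * (x powr (1 - 1 / p i) * c i powr (1 / p i))) powr q = (B i powr q * c i powr (q / p i)) * x powr (q * (1 - 1 / p i))"
      using B[of i] c[of i] by (simp add: powr_mult powr_powr mult.commute mult.left_commute less_imp_le)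
  qed
  also have "\<dots> = (\<Prod>i\<in>UNIV. B i powr q * c i powr (q / p i)) * x powr (1 - \<kappa>)"
    using x by (simp add: prod.distrib e[symmetric] powr_sum)
  finally have "x \<le> (\<Prod>i\<in>UNIV. B i powr q * c i powr (q / p i)) * x powr (1 - \<kappa>)"
    using le by (simp add: q_def)
  also have "x powr (1 - \<kappa>) = x / x powr \<kappa>" using x by (simp add: powr_diff)
  finally have "x powr \<kappa> \<le> (\<Prod>i\<in>UNIV. B i powr q * c i powr (q / p i))"
    using x by (simp add: field_simps)
  then have "(x powr \<kappa>) powr (1 / \<kappa>) \<le> (\<Prod>i\<in>UNIV. B i powr q * c i powr (q / p i)) powr (1 / \<kappa>)"
    using \<kappa> by (intro powr_mono2) auto
  also have "\<dots> = (\<Prod>i\<in>UNIV. (B i powr q * c i powr (q / p i)) powr (1 / \<kappa>))"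
    by (rule prod_powr_distrib)
  also have "\<dots> = (\<Prod>i\<in>UNIV. B i powr \<tau> * c i powr (\<tau> / p i))"
    using q\<kappa> by (intro prod.cong refl) (simp add: powr_mult powr_powr mult.commute flip: q\<kappa>)
  also have "\<dots> = (\<Prod>i\<in>UNIV. B i) powr \<tau> * (\<Prod>i\<in>UNIV. c i powr (\<tau> / p i))"
    by (simp add: prod.distrib prod_powr_distrib)
  finally show ?thesis using x \<kappa> by (simp add: powr_powr)
qed

text \<open>The bound for \<open>min (w y) k\<close> does not depend on \<open>k\<close>, and
  Fatou's lemma lets \<open>k\<close> grow. \<open>g i\<close> always belongs to the full power
  \<open>w powr \<alpha> i\<close>: the truncation enters through the levels on lines, so no
  derivative of a truncated function occurs.\<close>

lemma anisotropic_sobolev_power: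
  fixes p \<alpha> :: "'n::finite \<Rightarrow> real" and w :: "real^'n \<Rightarrow> real" and g :: "'n \<Rightarrow> real^'n \<Rightarrow> real"
  assumes p: "\<And>i. 1 < p i" and s: "1 < (\<Sum>i\<in>UNIV. 1 / p i)" and \<alpha>: "\<And>i. 0 < \<alpha> i"
    and r: "r = (\<Sum>i\<in>UNIV. \<alpha> i) / ((\<Sum>i\<in>UNIV. 1 / p i) - 1)" and \<sigma>: "0 < \<sigma>" "\<sigma> \<le> r"
    and [measurable]: "w \<in> borel_measurable borel" "\<And>i. g i \<in> borel_measurable borel" "\<Omega> \<in> sets borel"
    and cvx: "convex \<Omega>" and w0: "\<And>y. 0 \<le> w y"
    and D: "\<And>i. AE y in lborel. AE h in lborel. y \<in> \<Omega> \<longrightarrow> y + h *\<^sub>R axis i 1 \<in> \<Omega> \<longrightarrow>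
      ennreal \<bar>w (y + h *\<^sub>R axis i 1) powr \<alpha> i - w y powr \<alpha> i\<bar> \<le> (\<integral>\<^sup>+s\<in>closed_segment 0 h. ennreal \<bar>g i (y + s *\<^sub>R axis i 1)\<bar> \<partial>lborel)"
    and V: "\<And>i. AE y in lborel. y \<in> \<Omega> \<longrightarrow> (\<forall>\<epsilon>>0. \<not> (AE s in lborel. y + s *\<^sub>R axis i 1 \<in> \<Omega> \<longrightarrow> ennreal \<epsilon> \<le> ennreal (w (y + s *\<^sub>R axis i 1))))"
    and G: "\<And>i. (\<integral>\<^sup>+y\<in>\<Omega>. ennreal (\<bar>g i y\<bar> powr p i) \<partial>lborel) < \<infinity>"
    and I: "(\<integral>\<^sup>+y\<in>\<Omega>. ennreal (w y powr \<sigma>) \<partial>lborel) < \<infinity>"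
  defines "\<tau> \<equiv> 1 / ((\<Sum>i\<in>UNIV. 1 / p i) - 1)"
  shows "(\<integral>\<^sup>+y\<in>\<Omega>. ennreal (w y powr r) \<partial>lborel)
    \<le> ennreal ((\<Prod>i\<in>UNIV. 2 powr (1 + r * (1 - 1 / p i) / \<alpha> i)) powr \<tau>
        * (\<Prod>i\<in>UNIV. enn2real (\<integral>\<^sup>+y\<in>\<Omega>. ennreal (\<bar>g i y\<bar> powr p i) \<partial>lborel) powr (\<tau> / p i)))" (is "_ \<le> ennreal ?B")
proof -
  let ?N = "real CARD('n)"
  define \<gamma> where "\<gamma> i = 1 + r * (1 - 1 / p i) / \<alpha> i" for i
  define c where "c i = (\<integral>\<^sup>+y\<in>\<Omega>. ennreal (\<bar>g i y\<bar> powr p i) \<partial>lborel)" for i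
  have r0: "0 < r" using \<sigma> by simp
  have pm: "0 < 1 - 1 / p i" "0 < 1 / p i" for i using p[of i] by auto
  have \<gamma>1: "1 \<le> \<gamma> i" for i using r0 \<alpha>[of i] pm[of i] by (simp add: \<gamma>_def)
  \<comment> \<open>Terms of size at most 1 with a sum above 1 are at least two in number; this is
    what gives the exponent \<open>1 / (N - 1)\<close> a meaning.\<close>
  have N: "2 \<le> CARD('n)"
  proof -
    have "(\<Sum>i\<in>UNIV. 1 / p i) \<le> (\<Sum>i\<in>(UNIV::'n set). 1)" proof (rule sum_mono)
      fix i
      show "1 / p i \<le> 1" using p[of i] by simp
    qed
    then show ?thesis using s by simp
  qed
  define q where "q = 1 / (?N - 1)"
  have q0: "0 < q" using N by (simp add: q_def)
  have \<alpha>\<gamma>: "\<alpha> i * \<gamma> i = \<alpha> i + r * (1 - 1 / p i)" for i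
    using \<alpha>[of i] by (simp add: \<gamma>_def distrib_left)
  have \<alpha>\<gamma>1: "\<alpha> i * (\<gamma> i - 1) = r * (1 - 1 / p i)" for i
    using \<alpha>[of i] by (simp add: \<gamma>_def)
  have sum_\<alpha>\<gamma>: "(\<Sum>i\<in>UNIV. \<alpha> i * \<gamma> i * q) = r"
  proof -
    have "(\<Sum>i\<in>UNIV. \<alpha> i * \<gamma> i) = (\<Sum>i\<in>UNIV. \<alpha> i) + r * (?N - (\<Sum>i\<in>UNIV. 1 / p i))"
      unfolding \<alpha>\<gamma> by (simp add: sum.distrib sum_distrib_left[symmetric] sum_subtractf)
    also have "(\<Sum>i\<in>UNIV. \<alpha> i) = r * ((\<Sum>i\<in>UNIV. 1 / p i) - 1)" using r s by simp
    finally have "(\<Sum>i\<in>UNIV. \<alpha> i * \<gamma> i) = r * (?N - 1)" by (simp add: algebra_simps)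
    then show ?thesis unfolding sum_distrib_right[symmetric] using N by (simp add: q_def)
  qed
  have bound: "(\<integral>\<^sup>+y\<in>\<Omega>. ennreal (min (w y) k powr r) \<partial>lborel) \<le> ennreal ?B" if k: "0 < k" for k
  proof -
    define W where "W y = min (w y) k" for y
    have W0: "0 \<le> W y" for y using w0[of y] k by (simp add: W_def)
    have [measurable]: "W \<in> borel_measurable borel" unfolding W_def by measurable
    define X where "X = (\<integral>\<^sup>+y\<in>\<Omega>. ennreal (W y powr r) \<partial>lborel)"
    \<comment> \<open>Truncation at \<open>k\<close> and \<open>\<sigma> \<le> r\<close> are what make the later absorption of \<open>X\<close> legitimate.\<close>
    have X_fin: "X < \<infinity>"
    proof -
      have "X \<le> (\<integral>\<^sup>+y. ennreal (k powr (r - \<sigma>)) * (ennreal (w y powr \<sigma>) * indicator \<Omega> y) \<partial>lborel)"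
        unfolding X_def
      proof (intro nn_integral_mono)
        fix y
        have "W y powr r = W y powr (r - \<sigma>) * W y powr \<sigma>"
          by (simp flip: powr_add)
        also have "\<dots> \<le> k powr (r - \<sigma>) * w y powr \<sigma>"
          using W0[of y] w0[of y] \<sigma> by (intro mult_mono powr_mono2) (auto simp: W_def)
        finally show "ennreal (W y powr r) * indicator \<Omega> y \<le> ennreal (k powr (r - \<sigma>)) * (ennreal (w y powr \<sigma>) * indicator \<Omega> y)"
          by (auto simp: indicator_def simp flip: ennreal_mult intro!: ennreal_leI)
      qed
      also have "\<dots> = ennreal (k powr (r - \<sigma>)) * (\<integral>\<^sup>+y\<in>\<Omega>. ennreal (w y powr \<sigma>) \<partial>lborel)"
        by (rule nn_integral_cmult) measurable
      also have "\<dots> < \<infinity>" using I by (simp add: ennreal_mult_less_top)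
      finally show ?thesis .
    qed
    define H where "H i y = ennreal (W y powr (\<alpha> i * (\<gamma> i - 1))) * ennreal \<bar>g i y\<bar> * indicator \<Omega> y" for i y
    have [measurable]: "H i \<in> borel_measurable borel" for i unfolding H_def by measurable
    have ae: "AE y in lborel. \<forall>i. y \<in> \<Omega> \<longrightarrow> ennreal (W y powr (\<alpha> i * \<gamma> i)) \<le> ennreal (2 powr \<gamma> i) * line_int (axis i 1) (H i) y"
      unfolding AE_all_countable W_def H_def
      by (intro allI truncated_power_line_bound[OF _ _ _ cvx _ w0 D V _ G \<alpha> \<gamma>1 k]) (auto intro: less_imp_le p)
    have "X \<le> (\<integral>\<^sup>+y. (\<Prod>i\<in>UNIV. epow (ennreal (2 powr \<gamma> i)) q) * (\<Prod>i\<in>UNIV. epow (line_int (axis i 1) (H i) y) q) \<partial>lborel)"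
      unfolding X_def
    proof (rule nn_integral_mono_AE, use ae in eventually_elim)
      case (elim y)
      show ?case
      proof (cases "y \<in> \<Omega>")
        case True
        have "ennreal (W y powr r) = (\<Prod>i\<in>UNIV. epow (ennreal (W y powr (\<alpha> i * \<gamma> i))) q)"
        proof -
          have "W y powr r = (\<Prod>i\<in>UNIV. W y powr (\<alpha> i * \<gamma> i * q))"
          proof (cases "W y = 0")
            case False
            then show ?thesis by (simp add: powr_sum sum_\<alpha>\<gamma>[symmetric])
          qed simp
          then have "ennreal (W y powr r) = (\<Prod>i\<in>UNIV. ennreal (W y powr (\<alpha> i * \<gamma> i * q)))"
            by (simp add: prod_ennreal)
          also have "\<dots> = (\<Prod>i\<in>UNIV. epow (ennreal (W y powr (\<alpha> i * \<gamma> i))) q)"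
            using q0 by (intro prod.cong refl) (simp add: epow_ennreal powr_powr)
          finally show ?thesis .
        qed
        also have "\<dots> \<le> (\<Prod>i\<in>UNIV. epow (ennreal (2 powr \<gamma> i) * line_int (axis i 1) (H i) y) q)"
          using elim True q0 by (intro prod_mono_ennreal epow_mono) auto
        also have "\<dots> = (\<Prod>i\<in>UNIV. epow (ennreal (2 powr \<gamma> i)) q) * (\<Prod>i\<in>UNIV. epow (line_int (axis i 1) (H i) y) q)"
          using q0 by (simp add: epow_mult prod.distrib)
        finally show ?thesis using True by simp
      qed simp
    qed
    also have "\<dots> = (\<Prod>i\<in>UNIV. epow (ennreal (2 powr \<gamma> i)) q) * (\<integral>\<^sup>+y. (\<Prod>i\<in>UNIV. epow (line_int (axis i 1) (H i) y) q) \<partial>lborel)"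
      by (rule nn_integral_cmult) measurable
    also have "\<dots> \<le> (\<Prod>i\<in>UNIV. epow (ennreal (2 powr \<gamma> i)) q) * (\<Prod>i\<in>UNIV. epow (\<integral>\<^sup>+y. H i y \<partial>lborel) q)"
      unfolding q_def using N by (intro mult_left_mono loomis_whitney_vec) auto
    also have "\<dots> \<le> (\<Prod>i\<in>UNIV. epow (ennreal (2 powr \<gamma> i)) q) * (\<Prod>i\<in>UNIV. epow (epow X (1 - 1 / p i) * epow (c i) (1 / p i)) q)"
    proof (intro mult_left_mono prod_mono_ennreal epow_mono)
      fix i
      \<comment> \<open>Hoelder's inequality for two factors, indexed by \<open>bool\<close>. By
        \<open>\<alpha>\<gamma>1\<close> the factor of weight \<open>1 - 1 / p i\<close> is again
        \<open>W powr r\<close>, whatever the direction, so the same \<open>X\<close> returns in all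
        of them.\<close>
      define f where "f b y = (if b then ennreal (W y powr r) * indicator \<Omega> y else ennreal (\<bar>g i y\<bar> powr p i) * indicator \<Omega> y)" for b y
      define a where "a b = (if b then 1 - 1 / p i else 1 / p i)" for b
      have "(\<integral>\<^sup>+y. H i y \<partial>lborel) = (\<integral>\<^sup>+y. (\<Prod>b\<in>UNIV. epow (f b y) (a b)) \<partial>lborel)"
      proof (rule nn_integral_cong)
        fix y
        show "H i y = (\<Prod>b\<in>UNIV. epow (f b y) (a b))"
        proof (cases "y \<in> \<Omega>")
          case True
          have "epow (ennreal (W y powr r)) (1 - 1 / p i) = ennreal (W y powr (r * (1 - 1 / p i)))"
            using pm[of i] by (subst epow_ennreal) (auto simp: powr_powr)
          moreover have "epow (ennreal (\<bar>g i y\<bar> powr p i)) (1 / p i) = ennreal \<bar>g i y\<bar>"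
            using p[of i] by (subst epow_ennreal) (auto simp: powr_powr)
          ultimately show ?thesis using True by (simp add: UNIV_bool f_def a_def H_def \<alpha>\<gamma>1 mult.commute)
        next
          case False
          then show ?thesis using pm[of i] by (auto simp: UNIV_bool f_def a_def H_def epow_zero)
        qed
      qed
      also have "\<dots> \<le> (\<Prod>b\<in>UNIV. epow (\<integral>\<^sup>+y. f b y \<partial>lborel) (a b))"
        using pm[of i] by (intro Holder_nn_integral) (auto simp: UNIV_bool a_def f_def)
      also have "\<dots> = epow X (1 - 1 / p i) * epow (c i) (1 / p i)"
        by (simp add: UNIV_bool f_def a_def X_def c_def mult.commute)
      finally show "(\<integral>\<^sup>+y. H i y \<partial>lborel) \<le> epow X (1 - 1 / p i) * epow (c i) (1 / p i)" .
    qed (use q0 in auto)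
    finally have X_le: "X \<le> (\<Prod>i\<in>UNIV. epow (ennreal (2 powr \<gamma> i) * (epow X (1 - 1 / p i) * epow (c i) (1 / p i))) q)"
      using q0 by (simp add: epow_mult prod.distrib)
    define x where "x = enn2real X"
    define d where "d i = enn2real (c i)" for i
    have X: "X = ennreal x" "0 \<le> x" using X_fin by (auto simp: x_def less_top)
    have c: "c i = ennreal (d i)" "0 \<le> d i" for i using G[of i] by (auto simp: d_def c_def less_top)
    have "epow (ennreal (2 powr \<gamma> i) * (epow X (1 - 1 / p i) * epow (c i) (1 / p i))) q
        = ennreal ((2 powr \<gamma> i * (x powr (1 - 1 / p i) * d i powr (1 / p i))) powr q)" for i
    proof -
      have "epow X (1 - 1 / p i) = ennreal (x powr (1 - 1 / p i))" "epow (c i) (1 / p i) = ennreal (d i powr (1 / p i))"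
        unfolding X(1) c(1) using pm[of i] X(2) c(2)[of i] by (auto intro: epow_ennreal)
      then show ?thesis
        using q0 by (simp add: epow_ennreal flip: ennreal_mult)
    qed
    with X_le X have "ennreal x \<le> ennreal (\<Prod>i\<in>UNIV. (2 powr \<gamma> i * (x powr (1 - 1 / p i) * d i powr (1 / p i))) powr q)"
      by (simp add: prod_ennreal)
    then have "x \<le> (\<Prod>i\<in>UNIV. (2 powr \<gamma> i * (x powr (1 - 1 / p i) * d i powr (1 / p i))) powr (1 / (?N - 1)))"
      by (subst (asm) ennreal_le_iff) (auto simp: q_def intro: prod_nonneg)
    then have "x \<le> (\<Prod>i\<in>UNIV. 2 powr \<gamma> i) powr \<tau> * (\<Prod>i\<in>UNIV. d i powr (\<tau> / p i))"
      unfolding \<tau>_def using X(2) c(2) by (intro absorb_power p s N) auto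
    then show ?thesis
      unfolding X_def[symmetric] W_def[symmetric] X(1) by (auto simp: d_def c_def \<gamma>_def intro: ennreal_leI)
  qed
  have "(\<integral>\<^sup>+y\<in>\<Omega>. ennreal (w y powr r) \<partial>lborel)
      \<le> (\<integral>\<^sup>+y. liminf (\<lambda>n. ennreal (min (w y) (real (Suc n)) powr r) * indicator \<Omega> y) \<partial>lborel)"
  proof (rule nn_integral_mono)
    fix y
    have "\<forall>\<^sub>F n in sequentially. ennreal (w y powr r) * indicator \<Omega> y \<le> ennreal (min (w y) (real (Suc n)) powr r) * indicator \<Omega> y"
    proof -
      \<comment> \<open>From \<open>m\<close> on the truncation no longer acts at \<open>y\<close>.
        The levels are \<open>Suc n\<close> because \<open>bound\<close> asks for a positive
        one.\<close>
      obtain m where "w y \<le> real m" using real_arch_simple by blast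
      then have "min (w y) (real (Suc n)) = w y" if "m \<le> n" for n using that by simp
      then show ?thesis by (intro eventually_mono[OF eventually_ge_at_top[of m]]) simp
    qed
    then show "ennreal (w y powr r) * indicator \<Omega> y \<le> liminf (\<lambda>n. ennreal (min (w y) (real (Suc n)) powr r) * indicator \<Omega> y)"
      by (rule Liminf_bounded)
  qed
  also have "\<dots> \<le> liminf (\<lambda>n. \<integral>\<^sup>+y\<in>\<Omega>. ennreal (min (w y) (real (Suc n)) powr r) \<partial>lborel)"
    by (rule nn_integral_liminf) measurable
  also have "\<dots> \<le> ennreal ?B"
  proof -
    have "liminf (\<lambda>n. \<integral>\<^sup>+y\<in>\<Omega>. ennreal (min (w y) (real (Suc n)) powr r) \<partial>lborel) \<le> liminf (\<lambda>n. ennreal ?B)"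
      by (intro Liminf_mono always_eventually allI bound) simp
    then show ?thesis by (simp add: Liminf_const)
  qed
  finally show ?thesis .
qed

section \<open>The parabolic inequality\<close>

text \<open>Fubini's theorem for null sets fixes the first variable; exchanging the roles needs a
  measurable exceptional set, hence the Borel null set \<open>N\<close> in place of the negation of
  \<open>P\<close>.\<close>

lemma AE_lborel_pair_snd:
  assumes "AE z in (lborel :: ('a::euclidean_space \<times> 'b::euclidean_space) measure). P z"
  shows "AE t in lborel. AE x in lborel. P (x, t)"
proof -
  obtain N where N: "{z. \<not> P z} \<subseteq> N" "N \<in> null_sets lborel"
    using assms by (auto elim!: AE_E simp: null_sets_def)
  have "AE z in lborel \<Otimes>\<^sub>M lborel. z \<notin> N"
    unfolding lborel_prod by (rule AE_not_in[OF N(2)])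
  then have "AE x in lborel. AE t in lborel. (x, t) \<notin> N"
    by (rule lborel_pair.AE_pair)
  moreover have "{z \<in> space (lborel \<Otimes>\<^sub>M lborel). (fst z, snd z) \<notin> N} \<in> sets (lborel \<Otimes>\<^sub>M lborel)"
  proof -
    have "N \<in> sets (lborel \<Otimes>\<^sub>M lborel)" using N(2) unfolding lborel_prod by (simp add: null_sets_def)
    moreover have "{z \<in> space (lborel \<Otimes>\<^sub>M lborel). (fst z, snd z) \<notin> N} = space (lborel \<Otimes>\<^sub>M lborel) - N"
      by auto
    ultimately show ?thesis by (simp only: sets.compl_sets)
  qed
  ultimately have "AE t in lborel. AE x in lborel. (x, t) \<notin> N"
    by (subst lborel_pair.AE_commute[symmetric])
  then show ?thesis
    by eventually_elim (erule eventually_mono, use N in auto)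
qed

lemma nn_integral_cylinder:
  fixes F :: "'a::euclidean_space \<times> real \<Rightarrow> ennreal"
  assumes [measurable]: "F \<in> borel_measurable borel" "\<Omega> \<in> sets borel"
  shows "(\<integral>\<^sup>+z\<in>\<Omega> \<times> {0<..<T}. F z \<partial>lborel) = (\<integral>\<^sup>+t\<in>{0<..<T}. (\<integral>\<^sup>+x\<in>\<Omega>. F (x, t) \<partial>lborel) \<partial>lborel)"
proof -
  have [measurable]: "F \<in> borel_measurable (borel \<Otimes>\<^sub>M borel)" by (simp add: borel_prod)
  have [measurable]: "\<Omega> \<times> {0<..<T} \<in> sets (borel \<Otimes>\<^sub>M borel)" by (intro pair_measureI) auto
  have "(\<integral>\<^sup>+z\<in>\<Omega> \<times> {0<..<T}. F z \<partial>lborel) = (\<integral>\<^sup>+z. F z * indicator (\<Omega> \<times> {0<..<T}) z \<partial>(lborel \<Otimes>\<^sub>M lborel))"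
    by (simp add: lborel_prod)
  also have "\<dots> = (\<integral>\<^sup>+t. (\<integral>\<^sup>+x. F (x, t) * indicator (\<Omega> \<times> {0<..<T}) (x, t) \<partial>lborel) \<partial>lborel)"
    by (rule lborel_pair.nn_integral_snd[symmetric]) measurable
  also have "\<dots> = (\<integral>\<^sup>+t\<in>{0<..<T}. (\<integral>\<^sup>+x\<in>\<Omega>. F (x, t) \<partial>lborel) \<partial>lborel)"
    by (intro nn_integral_cong) (auto simp: indicator_def)
  finally show ?thesis .
qed

lemma nn_integral_lebesgue_eq_lborel:
  fixes F :: "'a::euclidean_space \<Rightarrow> ennreal"
  assumes [measurable]: "F' \<in> borel_measurable borel" "S \<in> sets borel" and ae: "AE x in lborel. x \<in> S \<longrightarrow> F x = F' x"
  shows "(\<integral>\<^sup>+x\<in>S. F x \<partial>lebesgue) = (\<integral>\<^sup>+x\<in>S. F' x \<partial>lborel)"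
proof -
  have "(\<integral>\<^sup>+x\<in>S. F x \<partial>lebesgue) = (\<integral>\<^sup>+x\<in>S. F' x \<partial>lebesgue)"
    by (rule nn_integral_cong_AE, unfold AE_completion_iff) (use ae in \<open>eventually_elim, auto simp: indicator_def\<close>)
  then show ?thesis by (simp add: nn_integral_completion)
qed

text \<open>The index \<open>None\<close> carries the constant function 1 with the weight that the
  \<open>a i\<close> leave over from 1; its integral over the time interval supplies the power of
  \<open>T\<close>.\<close>

lemma time_Holder:
  fixes \<Gamma> :: "'n::finite \<Rightarrow> real \<Rightarrow> ennreal"
  assumes [measurable]: "\<And>i. \<Gamma> i \<in> borel_measurable borel"
    and a: "\<And>i. 0 \<le> a i" "(\<Sum>i\<in>UNIV. a i) \<le> 1" and T: "0 < T"
  shows "(\<integral>\<^sup>+t\<in>{0<..<T}. (\<Prod>i\<in>UNIV. epow (\<Gamma> i t) (a i)) \<partial>lborel)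
    \<le> ennreal (T powr (1 - (\<Sum>i\<in>UNIV. a i))) * (\<Prod>i\<in>UNIV. epow (\<integral>\<^sup>+t\<in>{0<..<T}. \<Gamma> i t \<partial>lborel) (a i))"
proof -
  \<comment> \<open>The time interval is put into the measure: an indicator inside a factor would
    become 1 everywhere under a weight 0.\<close>
  let ?M = "restrict_space lborel {0<..<T}"
  define f where "f j t = (case j of None \<Rightarrow> 1 | Some i \<Rightarrow> \<Gamma> i t)" for j t
  define A where "A j = (case j of None \<Rightarrow> 1 - (\<Sum>i\<in>UNIV. a i) | Some i \<Rightarrow> a i)" for j
  have UN: "(UNIV :: 'n option set) = insert None (range Some)" by (auto simp: UNIV_option_conv)
  have prodo: "(\<Prod>j\<in>UNIV. h j) = h None * (\<Prod>i\<in>UNIV. h (Some i))" for h :: "'n option \<Rightarrow> ennreal"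
    unfolding UN by (simp add: prod.reindex o_def)
  have sumo: "(\<Sum>j\<in>UNIV. h j) = h None + (\<Sum>i\<in>UNIV. h (Some i))" for h :: "'n option \<Rightarrow> real"
    unfolding UN by (simp add: sum.reindex o_def)
  have f_meas: "f j \<in> borel_measurable ?M" for j
    by (rule measurable_restrict_space1) (cases j; simp add: f_def[abs_def])
  have restr: "(\<integral>\<^sup>+t\<in>{0<..<T}. h t \<partial>lborel) = (\<integral>\<^sup>+t. h t \<partial>?M)" for h
    by (subst nn_integral_restrict_space) auto
  have "(\<integral>\<^sup>+t. (\<Prod>j\<in>UNIV. epow (f j t) (A j)) \<partial>?M) \<le> (\<Prod>j\<in>UNIV. epow (\<integral>\<^sup>+t. f j t \<partial>?M) (A j))"
    using a f_meas by (intro Holder_nn_integral) (auto simp: sumo A_def split: option.splits)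
  moreover have "(\<integral>\<^sup>+t. f None t \<partial>?M) = ennreal T"
    using T by (simp add: f_def emeasure_restrict_space space_restrict_space)
  moreover have "epow (ennreal T) (A None) = ennreal (T powr (1 - (\<Sum>i\<in>UNIV. a i)))"
    using T by (simp add: epow_def A_def)
  ultimately show ?thesis
    by (simp add: restr prodo f_def A_def)
qed

text \<open>The finiteness premises express the convention that the right-hand side is infinite as
  soon as a factor is: \<open>enn2real top\<close> is 0, so infinite integrals must not reach the
  real-valued bound.\<close>

theorem theorem2p4:
  fixes p \<alpha> :: "'n::finite \<Rightarrow> real" and \<theta> \<sigma> :: real
  assumes "\<forall>i. p i > 1"
    and "pbar p < real CARD('n)"
    and "\<forall>i. \<alpha> i > 0"
    and "1 \<le> \<sigma>" and "\<sigma> \<le> p_star_alpha p \<alpha>"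
    and "0 \<le> \<theta>" and "\<theta> \<le> pbar p / pbar_star p"
  shows "\<exists>C>0. \<forall>(a :: 'n \<Rightarrow> ereal) b (T :: real) (u :: (real^'n) \<times> real \<Rightarrow> real)
                 (g :: 'n \<Rightarrow> (real^'n) \<times> real \<Rightarrow> real).
     (\<forall>i. a i < b i) \<longrightarrow> T > 0 \<longrightarrow>
     L1_W11_0 T (rect_domain a b) u \<longrightarrow>
     (\<forall>i. has_weak_deriv (\<lambda>z. \<bar>u z\<bar> powr \<alpha> i) (axis i 1, 0) (g i) (rect_domain a b \<times> {0<..<T})) \<longrightarrow>
     (\<forall>i. (\<integral>\<^sup>+z\<in>rect_domain a b \<times> {0<..<T}. ennreal (\<bar>g i z\<bar> powr p i) \<partial>lebesgue) < \<infinity>) \<longrightarrow>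
     (SUP t\<in>{0..T}. \<integral>\<^sup>+x\<in>rect_domain a b. ennreal (\<bar>u (x, t)\<bar> powr \<sigma>) \<partial>lebesgue) < \<infinity> \<longrightarrow>
     (\<integral>\<^sup>+z\<in>rect_domain a b \<times> {0<..<T}.
          ennreal (\<bar>u z\<bar> powr (\<theta> * p_star_alpha p \<alpha> + \<sigma> * (1 - \<theta>))) \<partial>lebesgue)
     \<le> ennreal (C * T powr (1 - \<theta> * pbar_star p / pbar p)
         * pw (enn2real (SUP t\<in>{0..T}. \<integral>\<^sup>+x\<in>rect_domain a b. ennreal (\<bar>u (x, t)\<bar> powr \<sigma>) \<partial>lebesgue)) (1 - \<theta>)
         * (\<Prod>i\<in>UNIV. pw (enn2real (\<integral>\<^sup>+z\<in>rect_domain a b \<times> {0<..<T}. ennreal (\<bar>g i z\<bar> powr p i) \<partial>lebesgue))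
                         (\<theta> * pbar_star p / (real CARD('n) * p i))))"
proof -
  define s where "s = (\<Sum>i\<in>UNIV. 1 / p i)"
  define N where "N = real CARD('n)"
  define r where "r = p_star_alpha p \<alpha>"
  define \<tau> where "\<tau> = 1 / (s - 1)"
  define q where "q = \<theta> * r + \<sigma> * (1 - \<theta>)"
  have p: "1 < p i" and \<alpha>: "0 < \<alpha> i" for i using assms by auto
  have N: "0 < N" by (simp add: N_def)
  have s0: "0 < s" unfolding s_def using p by (intro sum_pos) (auto intro: less_trans[OF zero_less_one])
  have pbar: "pbar p = N / s" by (simp add: pbar_def s_def N_def inverse_eq_divide)
  \<comment> \<open>As \<open>pbar p = N / s\<close>, the assumption \<open>pbar p < N\<close> is
    precisely \<open>s > 1\<close>.\<close>
  have s1: "1 < s" using assms(2) N s0 unfolding pbar N_def[symmetric] by (simp add: field_simps)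
  have pstar: "pbar_star p = N * \<tau>"
    using N s0 s1 unfolding pbar_star_def pbar N_def[symmetric] \<tau>_def by (simp add: field_simps)
  have r: "r = (\<Sum>i\<in>UNIV. \<alpha> i) / (s - 1)"
    using N unfolding r_def p_star_alpha_def pstar N_def[symmetric] \<tau>_def by simp
  have \<tau>0: "0 < \<tau>" using s1 by (simp add: \<tau>_def)
  have ratio: "pbar_star p / pbar p = \<tau> * s" using N s0 unfolding pstar pbar by simp
  \<comment> \<open>In these terms the upper bound on \<theta> says that the Hoelder weights
    \<open>a i\<close> in time add up to at most 1; what is left over is the exponent of
    \<open>T\<close>.\<close>
  have \<theta>\<tau>: "\<theta> * \<tau> * s \<le> 1"
  proof -
    have "\<theta> \<le> 1 / (\<tau> * s)" using assms(7) N s0 \<tau>0 unfolding pstar pbar by (simp add: field_simps)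
    then show ?thesis using \<tau>0 s0 by (simp add: field_simps)
  qed
  \<comment> \<open>\<open>\<tau> * s = s / (s - 1)\<close> exceeds 1, so \<theta> stays strictly
    below 1 and the exponent \<open>1 - \<theta>\<close> is positive.\<close>
  have \<theta>1: "\<theta> < 1"
  proof (rule ccontr)
    assume "\<not> \<theta> < 1"
    then have "1 * (\<tau> * s) \<le> \<theta> * (\<tau> * s)" using \<tau>0 s0 by (intro mult_right_mono) auto
    moreover have "1 < \<tau> * s" using s1 by (simp add: \<tau>_def field_simps)
    ultimately show False using \<theta>\<tau> by (simp add: mult.assoc)
  qed
  define a where "a i = \<theta> * \<tau> / p i" for i
  have a_eq: "\<theta> * pbar_star p / (real CARD('n) * p i) = a i" for i
    using N unfolding pstar a_def N_def[symmetric] by simp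
  have a0: "0 \<le> a i" for i using assms(6) \<tau>0 p[of i] by (simp add: a_def)
  have a_sum: "(\<Sum>i\<in>UNIV. a i) = \<theta> * \<tau> * s" by (simp add: a_def s_def sum_distrib_left)
  have T_exp: "1 - \<theta> * pbar_star p / pbar p = 1 - (\<Sum>i\<in>UNIV. a i)"
    using ratio by (simp add: a_sum mult.assoc flip: times_divide_eq_right)
  \<comment> \<open>The constant of the Sobolev inequality on a slice; interpolation raises it to
    the power \<theta>.\<close>
  define C0 where "C0 = (\<Prod>i\<in>UNIV. 2 powr (1 + r * (1 - 1 / p i) / \<alpha> i)) powr \<tau>"
  have C0: "0 < C0" unfolding C0_def by (simp add: prod_pos powr_gt_zero less_imp_neq[symmetric])
  show ?thesis
  proof (intro exI[of _ "C0 powr \<theta>"] conjI allI impI)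
    show "0 < C0 powr \<theta>" using C0 by simp
    fix l b :: "'n \<Rightarrow> ereal" and T :: real and u :: "(real^'n) \<times> real \<Rightarrow> real" and g :: "'n \<Rightarrow> (real^'n) \<times> real \<Rightarrow> real"
    let ?\<Omega> = "rect_domain l b"
    let ?Q = "?\<Omega> \<times> {0<..<T}"
    assume lb: "\<forall>i. l i < b i" and T: "0 < T" and u: "L1_W11_0 T ?\<Omega> u"
      and wd: "\<forall>i. has_weak_deriv (\<lambda>z. \<bar>u z\<bar> powr \<alpha> i) (axis i 1, 0) (g i) ?Q"
      and gfin: "\<forall>i. (\<integral>\<^sup>+z\<in>?Q. ennreal (\<bar>g i z\<bar> powr p i) \<partial>lebesgue) < \<infinity>"
      and Sfin: "(SUP t\<in>{0..T}. \<integral>\<^sup>+x\<in>?\<Omega>. ennreal (\<bar>u (x, t)\<bar> powr \<sigma>) \<partial>lebesgue) < \<infinity>"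
    define S where "S = (SUP t\<in>{0..T}. \<integral>\<^sup>+x\<in>?\<Omega>. ennreal (\<bar>u (x, t)\<bar> powr \<sigma>) \<partial>lebesgue)"
    have \<Omega>: "open ?\<Omega>" "convex ?\<Omega>" by (rule open_rect_domain, rule convex_rect_domain)
    have Q: "open ?Q" "convex ?Q" using \<Omega> by (simp_all add: open_Times convex_Times)
    note [measurable] = borel_open[OF \<Omega>(1)] borel_open[OF Q(1)]
    have e: "(axis i 1, 0) \<in> (Basis :: ((real^'n) \<times> real) set)" for i
      by (auto simp: Basis_prod_def)
    obtain u' where u'_meas: "u' \<in> borel_measurable lborel" and u': "AE z in lborel. u z = u' z"
      using completion_ex_borel_measurable_real[OF conjunct1[OF u[unfolded L1_W11_0_def]]] by blast
    have "\<forall>i. \<exists>h. h \<in> borel_measurable borel \<and> (AE z in lborel. z \<in> ?Q \<longrightarrow> g i z = h z)"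
    proof
      fix i
      have "locally_integrable (g i) ?Q" using wd[rule_format, of i] unfolding has_weak_deriv_def by blast
      then show "\<exists>h. h \<in> borel_measurable borel \<and> (AE z in lborel. z \<in> ?Q \<longrightarrow> g i z = h z)"
        by (rule locally_integrable_borel_rep[OF Q(1)]) (intro exI conjI)
    qed
    then obtain h where "\<forall>i. h i \<in> borel_measurable borel \<and> (AE z in lborel. z \<in> ?Q \<longrightarrow> g i z = h i z)"
      by (rule choice[THEN exE])
    then have h_meas: "\<And>i. h i \<in> borel_measurable borel"
      and h: "\<And>i. AE z in lborel. z \<in> ?Q \<longrightarrow> g i z = h i z" by blast+
    define w where "w z = \<bar>u' z\<bar>" for z
    have w_meas [measurable]: "w \<in> borel_measurable borel" using u'_meas by (simp add: w_def[abs_def])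
    note h_meas [measurable]
    have wu: "AE z in lborel. w z = \<bar>u z\<bar>" using u' by eventually_elim (simp add: w_def)
    have slice [measurable]: "(\<lambda>x. w (x, t)) \<in> borel_measurable borel" "(\<lambda>x. h i (x, t)) \<in> borel_measurable borel" for i t
      by measurable
    define \<Gamma> where "\<Gamma> i t = (\<integral>\<^sup>+x\<in>?\<Omega>. ennreal (\<bar>h i (x, t)\<bar> powr p i) \<partial>lborel)" for i t
    define I where "I c t = (\<integral>\<^sup>+x\<in>?\<Omega>. ennreal (w (x, t) powr c) \<partial>lborel)" for c t
    have [measurable]: "\<Gamma> i \<in> borel_measurable borel" for i unfolding \<Gamma>_def[abs_def] by measurable
    have \<Gamma>_int: "(\<integral>\<^sup>+z\<in>?Q. ennreal (\<bar>g i z\<bar> powr p i) \<partial>lebesgue) = (\<integral>\<^sup>+t\<in>{0<..<T}. \<Gamma> i t \<partial>lborel)" for i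
    proof -
      have "(\<integral>\<^sup>+z\<in>?Q. ennreal (\<bar>g i z\<bar> powr p i) \<partial>lebesgue) = (\<integral>\<^sup>+z\<in>?Q. ennreal (\<bar>h i z\<bar> powr p i) \<partial>lborel)"
        by (rule nn_integral_lebesgue_eq_lborel, measurable) (use h[of i] in \<open>eventually_elim, auto\<close>)
      also have "\<dots> = (\<integral>\<^sup>+t\<in>{0<..<T}. \<Gamma> i t \<partial>lborel)" unfolding \<Gamma>_def by (rule nn_integral_cylinder) measurable
      finally show ?thesis .
    qed
    have \<Gamma>_int_fin: "(\<integral>\<^sup>+t\<in>{0<..<T}. \<Gamma> i t \<partial>lborel) < \<infinity>" for i
      using gfin[rule_format, of i] unfolding \<Gamma>_int .
    have I_int: "(\<integral>\<^sup>+z\<in>?Q. ennreal (\<bar>u z\<bar> powr q) \<partial>lebesgue) = (\<integral>\<^sup>+t\<in>{0<..<T}. I q t \<partial>lborel)"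
    proof -
      have "(\<integral>\<^sup>+z\<in>?Q. ennreal (\<bar>u z\<bar> powr q) \<partial>lebesgue) = (\<integral>\<^sup>+z\<in>?Q. ennreal (w z powr q) \<partial>lborel)"
        by (rule nn_integral_lebesgue_eq_lborel, measurable) (use wu in \<open>eventually_elim, auto\<close>)
      also have "\<dots> = (\<integral>\<^sup>+t\<in>{0<..<T}. I q t \<partial>lborel)" unfolding I_def by (rule nn_integral_cylinder) measurable
      finally show ?thesis .
    qed
    have wu_slice: "AE t in lborel. AE x in lborel. w (x, t) = \<bar>u (x, t)\<bar>"
      using AE_lborel_pair_snd[OF wu] .
    have u'_slice: "AE t in lborel. AE x in lborel. u (x, t) = u' (x, t)"
      using AE_lborel_pair_snd[OF u'] .
    have W: "AE t in lborel. t \<in> {0<..<T} \<longrightarrow> W11_0 ?\<Omega> (\<lambda>x. u (x, t))"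
    proof -
      from u obtain G where "AE t in lborel. t \<in> {0<..<T} \<longrightarrow> W11_0 ?\<Omega> (\<lambda>x. u (x, t)) \<and>
           (\<forall>i. has_weak_deriv (\<lambda>x. u (x, t)) (axis i 1) (\<lambda>x. G i (x, t)) ?\<Omega>)"
        unfolding L1_W11_0_def by blast
      then show ?thesis by eventually_elim blast
    qed
    \<comment> \<open>The supremum runs over the slices of \<open>u\<close> itself. The Borel
      function \<open>w\<close> agrees with \<open>\<bar>u\<bar>\<close> on almost every slice,
      which suffices for the integral in time.\<close>
    have I_\<sigma>: "AE t in lborel. t \<in> {0<..<T} \<longrightarrow> I \<sigma> t \<le> S"
      using wu_slice
    proof (eventually_elim, safe)
      fix t assume ae: "AE x in lborel. w (x, t) = \<bar>u (x, t)\<bar>" and t: "t \<in> {0<..<T}"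
      have "I \<sigma> t = (\<integral>\<^sup>+x\<in>?\<Omega>. ennreal (\<bar>u (x, t)\<bar> powr \<sigma>) \<partial>lebesgue)"
        unfolding I_def by (rule nn_integral_lebesgue_eq_lborel[symmetric], measurable) (use ae in \<open>eventually_elim, auto\<close>)
      also have "\<dots> \<le> S" unfolding S_def using t by (intro SUP_upper) auto
      finally show "I \<sigma> t \<le> S" .
    qed
    have \<Gamma>_fin: "AE t in lborel. \<forall>i. t \<in> {0<..<T} \<longrightarrow> \<Gamma> i t < \<infinity>"
      unfolding AE_all_countable
    proof
      fix i
      have "AE t in lborel. \<Gamma> i t * indicator {0<..<T} t \<noteq> \<infinity>"
        using \<Gamma>_int_fin[of i] by (intro nn_integral_PInf_AE) auto
      then show "AE t in lborel. t \<in> {0<..<T} \<longrightarrow> \<Gamma> i t < \<infinity>"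
        by eventually_elim (auto simp: less_top)
    qed
    \<comment> \<open>The direction \<open>(axis i 1, 0)\<close> leaves \<open>t\<close> fixed, so
      the line bound on the cylinder restricts to almost every slice, without forming weak
      derivatives of the slices.\<close>
    have D: "AE t in lborel. \<forall>i. t \<in> {0<..<T} \<longrightarrow> (AE x in lborel. AE k in lborel. x \<in> ?\<Omega> \<longrightarrow> x + k *\<^sub>R axis i 1 \<in> ?\<Omega> \<longrightarrow>
        ennreal \<bar>w (x + k *\<^sub>R axis i 1, t) powr \<alpha> i - w (x, t) powr \<alpha> i\<bar>
          \<le> (\<integral>\<^sup>+v\<in>closed_segment 0 k. ennreal \<bar>h i (x + v *\<^sub>R axis i 1, t)\<bar> \<partial>lborel))"
      unfolding AE_all_countable
    proof
      fix i
      have "has_weak_deriv (\<lambda>z. w z powr \<alpha> i) (axis i 1, 0) (h i) ?Q"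
        by (rule has_weak_deriv_cong_AE[OF wd[rule_format] Q(1) e])
          (use wu h[of i] in \<open>auto elim!: eventually_mono\<close>)
      from weak_deriv_line[OF this Q _ _ e]
      have "AE z in lborel. AE k in lborel. z \<in> ?Q \<longrightarrow> z + k *\<^sub>R (axis i 1, 0) \<in> ?Q \<longrightarrow>
        ennreal \<bar>w (z + k *\<^sub>R (axis i 1, 0)) powr \<alpha> i - w z powr \<alpha> i\<bar>
          \<le> (\<integral>\<^sup>+v\<in>closed_segment 0 k. ennreal \<bar>h i (z + v *\<^sub>R (axis i 1, 0))\<bar> \<partial>lborel)"
        by simp
      from AE_lborel_pair_snd[OF this]
      show "AE t in lborel. t \<in> {0<..<T} \<longrightarrow> (AE x in lborel. AE k in lborel. x \<in> ?\<Omega> \<longrightarrow> x + k *\<^sub>R axis i 1 \<in> ?\<Omega> \<longrightarrow>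
        ennreal \<bar>w (x + k *\<^sub>R axis i 1, t) powr \<alpha> i - w (x, t) powr \<alpha> i\<bar>
          \<le> (\<integral>\<^sup>+v\<in>closed_segment 0 k. ennreal \<bar>h i (x + v *\<^sub>R axis i 1, t)\<bar> \<partial>lborel))"
      proof (rule eventually_mono, intro impI)
        fix t assume t: "t \<in> {0<..<T}"
          and ae: "AE x in lborel. AE k in lborel. (x, t) \<in> ?Q \<longrightarrow> (x, t) + k *\<^sub>R (axis i 1, 0) \<in> ?Q \<longrightarrow>
            ennreal \<bar>w ((x, t) + k *\<^sub>R (axis i 1, 0)) powr \<alpha> i - w (x, t) powr \<alpha> i\<bar>
              \<le> (\<integral>\<^sup>+v\<in>closed_segment 0 k. ennreal \<bar>h i ((x, t) + v *\<^sub>R (axis i 1, 0))\<bar> \<partial>lborel)"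
        have shift: "(x, t) + k *\<^sub>R (axis i 1, 0) = (x + k *\<^sub>R axis i 1, t)" for x :: "real^'n" and k by simp
        have mem: "(x, t) \<in> ?Q \<longleftrightarrow> x \<in> ?\<Omega>" for x using t by simp
        show "AE x in lborel. AE k in lborel. x \<in> ?\<Omega> \<longrightarrow> x + k *\<^sub>R axis i 1 \<in> ?\<Omega> \<longrightarrow>
          ennreal \<bar>w (x + k *\<^sub>R axis i 1, t) powr \<alpha> i - w (x, t) powr \<alpha> i\<bar>
            \<le> (\<integral>\<^sup>+v\<in>closed_segment 0 k. ennreal \<bar>h i (x + v *\<^sub>R axis i 1, t)\<bar> \<partial>lborel)"
          using ae unfolding shift mem .
      qed
    qed
    have main: "AE t in lborel. t \<in> {0<..<T} \<longrightarrow>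
        I q t \<le> ennreal (C0 powr \<theta>) * epow S (1 - \<theta>) * (\<Prod>i\<in>UNIV. epow (\<Gamma> i t) (a i))"
      using D \<Gamma>_fin I_\<sigma> W u'_slice
    proof (eventually_elim, intro impI)
      fix t assume t: "t \<in> {0<..<T}"
      assume D: "\<forall>i. t \<in> {0<..<T} \<longrightarrow> (AE x in lborel. AE k in lborel. x \<in> ?\<Omega> \<longrightarrow> x + k *\<^sub>R axis i 1 \<in> ?\<Omega> \<longrightarrow>
          ennreal \<bar>w (x + k *\<^sub>R axis i 1, t) powr \<alpha> i - w (x, t) powr \<alpha> i\<bar>
          \<le> (\<integral>\<^sup>+v\<in>closed_segment 0 k. ennreal \<bar>h i (x + v *\<^sub>R axis i 1, t)\<bar> \<partial>lborel))"
        and \<Gamma>_fin: "\<forall>i. t \<in> {0<..<T} \<longrightarrow> \<Gamma> i t < \<infinity>"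
        and I_\<sigma>: "t \<in> {0<..<T} \<longrightarrow> I \<sigma> t \<le> S"
        and W: "t \<in> {0<..<T} \<longrightarrow> W11_0 ?\<Omega> (\<lambda>x. u (x, t))"
        and u': "AE x in lborel. u (x, t) = u' (x, t)"
      have u'_t: "(\<lambda>x. u' (x, t)) \<in> borel_measurable borel"
      proof -
        have [measurable]: "u' \<in> borel_measurable borel" using u'_meas by simp
        show ?thesis by measurable
      qed
      have V: "AE y in lborel. y \<in> ?\<Omega> \<longrightarrow> (\<forall>\<epsilon>>0. \<not> (AE v in lborel. y + v *\<^sub>R axis i 1 \<in> ?\<Omega> \<longrightarrow> ennreal \<epsilon> \<le> ennreal (w (y + v *\<^sub>R axis i 1, t))))" for i
        unfolding w_def
        by (rule W11_0_vanish[OF W[rule_format, OF t] lb[rule_format] u'_t]) (use u' in \<open>auto elim!: eventually_mono\<close>)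
      have I_r: "I r t \<le> ennreal (C0 * (\<Prod>i\<in>UNIV. enn2real (\<Gamma> i t) powr (\<tau> / p i)))"
        unfolding I_def C0_def \<Gamma>_def \<tau>_def s_def
      proof (rule anisotropic_sobolev_power[where \<sigma>=\<sigma> and \<alpha>=\<alpha> and w="\<lambda>x. w (x, t)" and g="\<lambda>i x. h i (x, t)"])
        show "(\<integral>\<^sup>+y\<in>?\<Omega>. ennreal (w (y, t) powr \<sigma>) \<partial>lborel) < \<infinity>"
          using I_\<sigma> t Sfin unfolding I_def S_def by auto
        show "(\<integral>\<^sup>+y\<in>?\<Omega>. ennreal (\<bar>h i (y, t)\<bar> powr p i) \<partial>lborel) < \<infinity>" for i
          using \<Gamma>_fin t unfolding \<Gamma>_def by blast
        show "1 < (\<Sum>i\<in>UNIV. 1 / p i)" using s1 by (simp add: s_def)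
        show "r = (\<Sum>i\<in>UNIV. \<alpha> i) / ((\<Sum>i\<in>UNIV. 1 / p i) - 1)" using r by (simp add: s_def)
        show "0 < \<sigma>" "\<sigma> \<le> r" using assms(4,5) by (auto simp: r_def)
        show "0 \<le> w (y, t)" for y by (simp add: w_def)
        show "AE y in lborel. AE k in lborel. y \<in> ?\<Omega> \<longrightarrow> y + k *\<^sub>R axis i 1 \<in> ?\<Omega> \<longrightarrow>
          ennreal \<bar>w (y + k *\<^sub>R axis i 1, t) powr \<alpha> i - w (y, t) powr \<alpha> i\<bar>
          \<le> (\<integral>\<^sup>+v\<in>closed_segment 0 k. ennreal \<bar>h i (y + v *\<^sub>R axis i 1, t)\<bar> \<partial>lborel)" for i
          using D t by blast
        show "1 < p i" "0 < \<alpha> i" for i by (rule p, rule \<alpha>)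
        show "(\<lambda>x. w (x, t)) \<in> borel_measurable borel" "(\<lambda>x. h i (x, t)) \<in> borel_measurable borel" for i
          by (rule slice)+
        show "?\<Omega> \<in> sets borel" by (rule borel_open[OF \<Omega>(1)])
        show "convex ?\<Omega>" by (rule \<Omega>(2))
        show "AE y in lborel. y \<in> ?\<Omega> \<longrightarrow> (\<forall>\<epsilon>>0. \<not> (AE v in lborel. y + v *\<^sub>R axis i 1 \<in> ?\<Omega> \<longrightarrow> ennreal \<epsilon> \<le> ennreal (w (y + v *\<^sub>R axis i 1, t))))" for i
          by (rule V)
      qed
      \<comment> \<open>Two factors indexed by \<open>bool\<close>: weight \<theta> goes to the
        power \<open>r\<close>, weight \<open>1 - \<theta>\<close> to \<sigma>. At \<theta> = 0 the
        first becomes \<open>epow _ 0 = 1\<close> and \<open>q\<close> is \<sigma>.\<close>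
      define f where "f c x = (if c then ennreal (w (x, t) powr r) * indicator ?\<Omega> x else ennreal (w (x, t) powr \<sigma>) * indicator ?\<Omega> x)" for c x
      define A where "A c = (if c then \<theta> else 1 - \<theta>)" for c
      have "I q t \<le> (\<integral>\<^sup>+x. (\<Prod>c\<in>UNIV. epow (f c x) (A c)) \<partial>lborel)"
        unfolding I_def
      proof (rule nn_integral_mono)
        fix x
        show "ennreal (w (x, t) powr q) * indicator ?\<Omega> x \<le> (\<Prod>c\<in>UNIV. epow (f c x) (A c))"
        proof (cases "x \<in> ?\<Omega>")
          case True
          have "epow (ennreal (w (x, t) powr \<sigma>)) (1 - \<theta>) = ennreal (w (x, t) powr (\<sigma> * (1 - \<theta>)))"
            using \<theta>1 by (subst epow_ennreal) (auto simp: powr_powr)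
          moreover have "ennreal (w (x, t) powr q) \<le> epow (ennreal (w (x, t) powr r)) \<theta> * ennreal (w (x, t) powr (\<sigma> * (1 - \<theta>)))"
          proof (cases "\<theta> = 0")
            case False
            then show ?thesis
              by (subst epow_ennreal) (auto simp: powr_powr q_def powr_add mult.commute[of r] simp flip: ennreal_mult)
          qed (simp add: q_def)
          ultimately show ?thesis using True by (simp add: UNIV_bool f_def A_def mult.commute)
        qed simp
      qed
      also have "\<dots> \<le> (\<Prod>c\<in>UNIV. epow (\<integral>\<^sup>+x. f c x \<partial>lborel) (A c))"
        using \<theta>1 assms(6) by (intro Holder_nn_integral) (auto simp: UNIV_bool A_def f_def)
      also have "\<dots> = epow (I r t) \<theta> * epow (I \<sigma> t) (1 - \<theta>)"
        by (simp add: UNIV_bool f_def A_def I_def mult.commute)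
      also have "\<dots> \<le> (ennreal (C0 powr \<theta>) * (\<Prod>i\<in>UNIV. epow (\<Gamma> i t) (a i))) * epow S (1 - \<theta>)"
      proof (rule mult_mono)
        have G: "ennreal (enn2real (\<Gamma> i t) powr (\<tau> / p i)) = epow (\<Gamma> i t) (\<tau> / p i)" for i
          using \<Gamma>_fin[rule_format, OF t, of i] \<tau>0 p[of i] by (auto simp: epow_def)
        have "epow (I r t) \<theta> \<le> epow (ennreal C0 * (\<Prod>i\<in>UNIV. epow (\<Gamma> i t) (\<tau> / p i))) \<theta>"
          using I_r C0 assms(6) by (intro epow_mono) (simp_all add: ennreal_mult prod_nonneg prod_ennreal[symmetric] G)
        also have "\<dots> = epow (ennreal C0) \<theta> * (\<Prod>i\<in>UNIV. epow (\<Gamma> i t) (a i))"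
          using assms(6) \<tau>0 p
          by (simp add: epow_mult epow_prod epow_epow a_def less_imp_le[OF less_trans[OF zero_less_one]] mult.commute)
        also have "epow (ennreal C0) \<theta> = ennreal (C0 powr \<theta>)" using C0 by (simp add: epow_def)
        finally show "epow (I r t) \<theta> \<le> ennreal (C0 powr \<theta>) * (\<Prod>i\<in>UNIV. epow (\<Gamma> i t) (a i))" .
        show "epow (I \<sigma> t) (1 - \<theta>) \<le> epow S (1 - \<theta>)" using I_\<sigma> t \<theta>1 by (intro epow_mono) auto
      qed auto
      finally show "I q t \<le> ennreal (C0 powr \<theta>) * epow S (1 - \<theta>) * (\<Prod>i\<in>UNIV. epow (\<Gamma> i t) (a i))"
        by (simp only: ac_simps)
    qed
    have "(\<integral>\<^sup>+t\<in>{0<..<T}. I q t \<partial>lborel)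
        \<le> (\<integral>\<^sup>+t. (ennreal (C0 powr \<theta>) * epow S (1 - \<theta>)) * ((\<Prod>i\<in>UNIV. epow (\<Gamma> i t) (a i)) * indicator {0<..<T} t) \<partial>lborel)"
      using main by (intro nn_integral_mono_AE, eventually_elim) (auto simp: indicator_def)
    also have "\<dots> = (ennreal (C0 powr \<theta>) * epow S (1 - \<theta>)) * (\<integral>\<^sup>+t\<in>{0<..<T}. (\<Prod>i\<in>UNIV. epow (\<Gamma> i t) (a i)) \<partial>lborel)"
      by (rule nn_integral_cmult) measurable
    also have "\<dots> \<le> (ennreal (C0 powr \<theta>) * epow S (1 - \<theta>)) *
        (ennreal (T powr (1 - (\<Sum>i\<in>UNIV. a i))) * (\<Prod>i\<in>UNIV. epow (\<integral>\<^sup>+t\<in>{0<..<T}. \<Gamma> i t \<partial>lborel) (a i)))"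
      using a0 \<theta>\<tau> T by (intro mult_left_mono time_Holder) (auto simp: a_sum)
    also have "epow S (1 - \<theta>) = ennreal (pw (enn2real S) (1 - \<theta>))"
      using Sfin by (intro epow_pw) (simp add: S_def)
    also have "(\<Prod>i\<in>UNIV. epow (\<integral>\<^sup>+t\<in>{0<..<T}. \<Gamma> i t \<partial>lborel) (a i))
        = ennreal (\<Prod>i\<in>UNIV. pw (enn2real (\<integral>\<^sup>+t\<in>{0<..<T}. \<Gamma> i t \<partial>lborel)) (a i))"
    proof -
      have "(\<Prod>i\<in>UNIV. epow (\<integral>\<^sup>+t\<in>{0<..<T}. \<Gamma> i t \<partial>lborel) (a i))
          = (\<Prod>i\<in>UNIV. ennreal (pw (enn2real (\<integral>\<^sup>+t\<in>{0<..<T}. \<Gamma> i t \<partial>lborel)) (a i)))"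
        using \<Gamma>_int_fin by (intro prod.cong refl epow_pw) simp
      then show ?thesis by (simp add: prod_ennreal pw_def)
    qed
    finally have "(\<integral>\<^sup>+z\<in>?Q. ennreal (\<bar>u z\<bar> powr q) \<partial>lebesgue)
        \<le> ennreal (C0 powr \<theta> * T powr (1 - (\<Sum>i\<in>UNIV. a i)) * pw (enn2real S) (1 - \<theta>)
          * (\<Prod>i\<in>UNIV. pw (enn2real (\<integral>\<^sup>+t\<in>{0<..<T}. \<Gamma> i t \<partial>lborel)) (a i)))"
      unfolding I_int by (simp add: ennreal_mult pw_def prod_nonneg ac_simps)
    then show "(\<integral>\<^sup>+z\<in>?Q. ennreal (\<bar>u z\<bar> powr (\<theta> * p_star_alpha p \<alpha> + \<sigma> * (1 - \<theta>))) \<partial>lebesgue)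
     \<le> ennreal (C0 powr \<theta> * T powr (1 - \<theta> * pbar_star p / pbar p)
         * pw (enn2real (SUP t\<in>{0..T}. \<integral>\<^sup>+x\<in>?\<Omega>. ennreal (\<bar>u (x, t)\<bar> powr \<sigma>) \<partial>lebesgue)) (1 - \<theta>)
         * (\<Prod>i\<in>UNIV. pw (enn2real (\<integral>\<^sup>+z\<in>?Q. ennreal (\<bar>g i z\<bar> powr p i) \<partial>lebesgue))
                         (\<theta> * pbar_star p / (real CARD('n) * p i))))"
      unfolding T_exp a_eq \<Gamma>_int by (simp only: q_def r_def S_def)
  qed
qed

end
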